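(* The functions associated to the cyclic $(3,4)$-curve $y^3=x^4+\lambda_3x^3+\lambda_2x^2+\lambda_1x+\lambda_0$ satisfy the following complete set of quadratic 3-index relations (identities of meromorphic functions of $\boldsymbol u\in\mathbb C^3$), where $Q=Q_{1333}$: $\wp_{333}^2=4\wp_{33}^3+4\wp_{13}+\wp_{23}^2-4\wp_{22}\wp_{33}$ $\wp_{233}\wp_{333}=4\wp_{23}\wp_{33}^2-2\wp_{12}-\wp_{22}\wp_{23}+2\lambda_3\wp_{33}^2$ $\wp_{233}^2=4\wp_{23}^2\wp_{33}+\wp_{22}^2+4\lambda_3\wp_{23}\wp_{33}+4\wp_{33}\lambda_2-\frac43Q$ $\wp_{223}\wp_{333}=2\wp_{23}^2\wp_{33}+2\wp_{22}\wp_{33}^2-2\wp_{22}^2+\lambda_3\wp_{23}\wp_{33}+4\wp_{13}\wp_{33}+\frac23Q$ $\wp_{223}\wp_{233}=2\wp_{13}\lambda_3+2\lambda_1+4\wp_{13}\wp_{23}+2\wp_{23}\wp_{22}\wp_{33}+2\wp_{23}^3+\wp_{22}\wp_{33}\lambda_3+2\wp_{23}^2\lambda_3+2\wp_{23}\lambda_2$ $\wp_{222}\wp_{333}=6\wp_{23}\wp_{22}\wp_{33}-4\wp_{12}\wp_{33}-2\wp_{23}^3+4\wp_{22}\wp_{33}\lambda_3-8\wp_{13}\wp_{23}-\wp_{23}^2\lambda_3-4\wp_{13}\lambda_3$ $\wp_{223}^2=4\wp_{23}^2\wp_{22}+4\wp_{11}-4\wp_{12}\wp_{23}+4\wp_{13}\wp_{22}-4\wp_{12}\lambda_3+4\lambda_3\wp_{22}\wp_{23}+\lambda_3^2\wp_{33}^2+4\lambda_2\wp_{22}-4\lambda_2\wp_{33}^2+\frac43\wp_{33}Q$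 $\wp_{222}\wp_{233}=2\wp_{23}^2\wp_{22}+2\wp_{22}^2\wp_{33}+4\wp_{12}\wp_{23}+2\wp_{12}\lambda_3+\lambda_3\wp_{22}\wp_{23}-2\lambda_3^2\wp_{33}^2+8\lambda_2\wp_{33}^2-\frac83\wp_{33}Q$ $\wp_{133}\wp_{333}=\wp_{12}\wp_{23}-2\wp_{13}\wp_{22}+4\wp_{13}\wp_{33}^2+\frac23\wp_{33}Q$ $\wp_{222}\wp_{223}=2\wp_{22}^2\lambda_3-\lambda_3^2\wp_{23}\wp_{33}+4\wp_{22}^2\wp_{23}+4\lambda_2\wp_{23}\wp_{33}+4\wp_{33}\lambda_1-\frac23\lambda_3Q-\frac43\wp_{23}Q$ $\wp_{133}\wp_{233}=2\lambda_3\wp_{13}\wp_{33}+2\wp_{33}\lambda_1+\wp_{12}\wp_{22}+4\wp_{33}\wp_{23}\wp_{13}+\frac23\wp_{23}Q$ $\wp_{123}\wp_{333}=2\wp_{12}\wp_{33}^2-2\wp_{12}\wp_{22}+2\wp_{33}\wp_{23}\wp_{13}+2\lambda_3\wp_{13}\wp_{33}-\frac13\wp_{23}Q$ $\wp_{222}^2=4\wp_{22}^3+8\wp_{11}\wp_{33}-8\wp_{13}^2-4\wp_{33}\wp_{12}\lambda_3+4\wp_{23}\wp_{13}\lambda_3+4\wp_{13}\lambda_3^2-4\wp_{22}\wp_{33}\lambda_3^2+\wp_{23}^2\lambda_3^2-8\wp_{13}\lambda_2+16\wp_{33}\lambda_2\wp_{22}-4\wp_{23}^2\lambda_2-8\lambda_0-4\wp_{22}Q-4\wp_{23}\lambda_1$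 $\wp_{133}\wp_{223}=2\wp_{13}\wp_{33}\wp_{22}+2\wp_{13}\wp_{23}^2+2\wp_{11}\wp_{33}+2\wp_{13}^2-\wp_{33}\wp_{12}\lambda_3+2\wp_{13}\lambda_2+2\wp_{23}\wp_{13}\lambda_3+2\lambda_0+\frac23\wp_{22}Q$ $\wp_{123}\wp_{233}=2\wp_{13}\lambda_2+2\wp_{13}^2+2\wp_{33}\wp_{12}\lambda_3+2\wp_{23}\wp_{33}\wp_{12}+2\wp_{13}\wp_{23}^2-2\wp_{11}\wp_{33}+2\wp_{23}\wp_{13}\lambda_3+2\lambda_0-\frac13\wp_{22}Q$ $\wp_{122}\wp_{333}=2\wp_{13}\wp_{33}\wp_{22}-2\wp_{13}\wp_{23}^2+4\wp_{23}\wp_{33}\wp_{12}-2\wp_{11}\wp_{33}-6\wp_{13}^2+2\lambda_0+2\wp_{33}\wp_{12}\lambda_3-\wp_{23}\wp_{13}\lambda_3-2\wp_{13}\lambda_2+\wp_{23}\lambda_1+\frac23\wp_{22}Q$ $\wp_{133}\wp_{222}=-2\wp_{12}\wp_{23}^2+4\wp_{23}\wp_{13}\wp_{22}-\wp_{23}\wp_{12}\lambda_3+2\wp_{22}\wp_{13}\lambda_3+2\wp_{33}\wp_{12}\wp_{22}+4\wp_{33}^2\lambda_1-\frac23\wp_{33}\lambda_3Q$ $\wp_{123}\wp_{223}=2\wp_{22}\lambda_1+2\wp_{22}\wp_{13}\lambda_3-2\wp_{33}^2\lambda_1+2\wp_{12}\wp_{23}^2+2\wp_{23}\wp_{13}\wp_{22}-2\wp_{11}\wp_{23}+2\wp_{23}\wp_{12}\lambda_3+\frac13\wp_{33}\lambda_3Q$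 $\wp_{122}\wp_{233}=-\wp_{22}\wp_{13}\lambda_3+4\wp_{12}\wp_{13}+2\wp_{12}\wp_{23}^2+2\wp_{12}\lambda_2-\wp_{22}\lambda_1+2\wp_{23}\wp_{12}\lambda_3+4\wp_{33}^2\lambda_1+2\wp_{33}\wp_{12}\wp_{22}-\frac23\wp_{33}\lambda_3Q$ $\wp_{133}^2=\wp_{12}^2+4\wp_{33}\lambda_0+4\wp_{33}\wp_{13}^2+\frac43\wp_{13}Q$ $\wp_{123}\wp_{222}=2\wp_{22}\wp_{23}\wp_{12}-2\wp_{12}^2+2\wp_{13}\wp_{22}^2-2\wp_{23}\wp_{33}\lambda_1-2\lambda_3^2\wp_{13}\wp_{33}+2\wp_{22}\wp_{12}\lambda_3+8\wp_{33}\wp_{13}\lambda_2-\frac83\wp_{13}Q+\frac13\wp_{23}\lambda_3Q$ $\wp_{122}\wp_{223}=4\wp_{22}\wp_{23}\wp_{12}-2\wp_{11}\wp_{22}+2\wp_{12}^2+2\wp_{22}\wp_{12}\lambda_3+\lambda_3^2\wp_{13}\wp_{33}+4\wp_{23}\wp_{33}\lambda_1+\wp_{33}\lambda_3\lambda_1+8\wp_{33}\lambda_0+\frac43\wp_{13}Q-\frac23\wp_{23}\lambda_3Q-4\wp_{33}\wp_{13}\lambda_2-\frac23\lambda_2Q$ $\wp_{113}\wp_{333}=2\wp_{33}\wp_{13}^2+2\wp_{33}^2\wp_{11}-2\wp_{12}^2+2\wp_{33}\wp_{13}\lambda_2-\wp_{23}\wp_{33}\lambda_1-2\wp_{33}\lambda_0-\frac23\wp_{13}Q$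 $\wp_{123}\wp_{133}=2\wp_{23}\wp_{13}^2+2\wp_{13}\lambda_1+2\wp_{13}^2\lambda_3-2\wp_{23}\lambda_0+2\wp_{33}\wp_{12}\wp_{13}+\frac13\wp_{12}Q$ $\wp_{122}\wp_{222}=6\wp_{33}\wp_{22}\lambda_1-\wp_{23}\lambda_3\lambda_1-2\wp_{33}\wp_{12}\lambda_3^2-2\wp_{23}^2\lambda_1+2\lambda_3\wp_{13}\lambda_2+2\lambda_3\wp_{11}\wp_{33}+\wp_{23}\wp_{13}\lambda_3^2-2\wp_{13}^2\lambda_3-\frac23\wp_{22}\lambda_3Q+4\wp_{33}\wp_{12}\lambda_2-2\lambda_3\lambda_0+4\wp_{22}^2\wp_{12}-\frac43\wp_{12}Q-8\wp_{13}\lambda_1$ $\wp_{113}\wp_{233}=2\wp_{13}^2\lambda_3+2\wp_{23}\wp_{13}^2+2\wp_{33}\wp_{12}\lambda_2+2\wp_{13}\lambda_1+2\wp_{33}\wp_{23}\wp_{11}-2\wp_{23}\lambda_0-\wp_{33}\wp_{22}\lambda_1-\frac23\wp_{12}Q$ $\wp_{112}\wp_{333}=2\wp_{23}\wp_{13}\lambda_2-\wp_{23}^2\lambda_1-4\wp_{13}^2\lambda_3+4\wp_{33}\wp_{12}\wp_{13}-2\wp_{23}\lambda_0+2\wp_{33}\wp_{23}\wp_{11}-2\wp_{23}\wp_{13}^2+\frac43\wp_{12}Q$ $\wp_{123}^2=\frac13\wp_{23}\wp_{12}\lambda_2-\frac83\wp_{11}\wp_{13}+\frac{10}3\wp_{13}\wp_{23}\wp_{12}-\frac13\wp_{33}\wp_{11}\wp_{22}+\frac29\wp_{33}\lambda_2Q-\frac13\wp_{23}\wp_{22}\lambda_1+\frac13\wp_{22}\wp_{13}\lambda_2+3\wp_{22}\lambda_0+\frac13\wp_{12}\lambda_1+\frac13\wp_{23}^2\wp_{11}+\frac13\wp_{13}^2\wp_{22}-\frac83\wp_{33}^2\lambda_0+\frac13\wp_{33}\wp_{12}^2+3\wp_{12}\wp_{13}\lambda_3-\frac13\wp_{33}^2\lambda_3\lambda_1$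 $\wp_{122}\wp_{133}=-\frac83\wp_{11}\wp_{13}+\frac43\wp_{13}\wp_{23}\wp_{12}+\frac23\wp_{33}\wp_{11}\wp_{22}-\frac23\wp_{23}^2\wp_{11}+\frac43\wp_{13}^2\wp_{22}+\frac43\wp_{33}\wp_{12}^2+\frac23\wp_{23}\wp_{22}\lambda_1-\frac23\wp_{22}\wp_{13}\lambda_2-\frac23\wp_{23}\wp_{12}\lambda_2+3\wp_{12}\wp_{13}\lambda_3+\frac23\wp_{33}^2\lambda_3\lambda_1+\frac13\wp_{12}\lambda_1+\frac{16}3\wp_{33}^2\lambda_0-\frac49\wp_{33}\lambda_2Q$ $\wp_{113}\wp_{223}=\frac43\wp_{11}\wp_{13}+\frac43\wp_{13}\wp_{23}\wp_{12}+\frac23\wp_{33}\wp_{11}\wp_{22}+\frac43\wp_{23}^2\wp_{11}+\frac43\wp_{23}\wp_{12}\lambda_2+\frac43\wp_{13}^2\wp_{22}-\frac23\wp_{33}\wp_{12}^2-\frac43\wp_{23}\wp_{22}\lambda_1+\frac43\wp_{22}\wp_{13}\lambda_2-\frac13\wp_{33}^2\lambda_3\lambda_1+\frac43\wp_{12}\lambda_1-\frac83\wp_{33}^2\lambda_0+\frac29\wp_{33}\lambda_2Q$ $\wp_{112}\wp_{233}=\frac{16}3\wp_{11}\wp_{13}+\frac43\wp_{13}\wp_{23}\wp_{12}+\frac23\wp_{33}\wp_{11}\wp_{22}+\frac43\wp_{23}^2\wp_{11}-\frac49\wp_{33}\lambda_2Q-\frac23\wp_{13}^2\wp_{22}+\frac43\wp_{33}\wp_{12}^2-\frac13\wp_{23}\wp_{22}\lambda_1-\frac23\wp_{22}\wp_{13}\lambda_2-6\wp_{22}\lambda_0+\frac43\wp_{23}\wp_{12}\lambda_2+\frac23\wp_{33}^2\lambda_3\lambda_1+\frac{10}3\wp_{12}\lambda_1+\frac{16}3\wp_{33}^2\lambda_0$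 $\wp_{122}\wp_{123}=2\wp_{33}\lambda_3\lambda_0+2\wp_{12}\wp_{13}\wp_{22}-2\wp_{11}\wp_{12}+2\lambda_1\wp_{13}\wp_{33}+2\lambda_3\wp_{12}^2+2\wp_{23}\wp_{12}^2-\frac13\lambda_1Q-\frac13\wp_{13}\lambda_3Q$ $\wp_{113}\wp_{222}=-8\wp_{23}\wp_{33}\lambda_0-4\wp_{33}\lambda_3\lambda_0+8\lambda_1\wp_{13}\wp_{33}+4\wp_{22}\wp_{12}\lambda_2+\frac23\lambda_1Q+4\wp_{12}\wp_{13}\wp_{22}+4\wp_{11}\wp_{12}-\lambda_3\wp_{23}\wp_{33}\lambda_1-2\wp_{23}\wp_{12}^2+2\wp_{22}\wp_{23}\wp_{11}-4\lambda_3\wp_{12}^2-2\wp_{22}^2\lambda_1+\frac23\wp_{23}\lambda_2Q-\frac43\wp_{13}\lambda_3Q$ $\wp_{112}\wp_{223}=8\wp_{33}\lambda_3\lambda_0+\lambda_3\wp_{23}\wp_{33}\lambda_1-4\lambda_1\wp_{13}\wp_{33}+2\wp_{23}\wp_{12}^2+\frac23\wp_{13}\lambda_3Q+2\wp_{22}\wp_{23}\wp_{11}+8\wp_{23}\wp_{33}\lambda_0+2\lambda_3\wp_{12}^2-\frac23\wp_{23}\lambda_2Q-\frac43\lambda_1Q$ $\wp_{122}^2=-4\lambda_2\wp_{13}^2-4\lambda_2\lambda_0+\lambda_1^2-16\lambda_0\wp_{13}-8\lambda_0\wp_{23}^2+4\wp_{22}\wp_{12}^2+2\lambda_3\wp_{13}\lambda_1+\wp_{13}^2\lambda_3^2+4\lambda_1\wp_{13}\wp_{23}+4\lambda_1\wp_{12}\wp_{33}+8\wp_{33}\wp_{22}\lambda_0-\frac43\wp_{12}\lambda_3Q+\frac43\wp_{11}Q-4\lambda_3\wp_{23}\lambda_0$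 $\wp_{111}\wp_{333}=-9\lambda_3\wp_{23}\lambda_0-2\wp_{13}\lambda_2^2+\lambda_2\wp_{23}\lambda_1-2\lambda_2\wp_{11}\wp_{33}+2\wp_{11}Q-10\lambda_0\wp_{23}^2+6\wp_{33}\wp_{13}\wp_{11}-10\lambda_0\wp_{13}-2\wp_{13}^3+7\lambda_1\wp_{13}\wp_{23}+2\lambda_1\wp_{12}\wp_{33}-2\wp_{33}\wp_{22}\lambda_0+6\lambda_3\wp_{13}\lambda_1+2\lambda_1^2-6\lambda_2\lambda_0-4\lambda_2\wp_{13}^2$ $\wp_{113}\wp_{133}=2\wp_{33}\wp_{13}\wp_{11}+2\lambda_2\wp_{13}^2+2\lambda_0\wp_{13}+2\lambda_0\wp_{23}^2+2\wp_{13}^3+\lambda_1\wp_{12}\wp_{33}-2\wp_{33}\wp_{22}\lambda_0-2\lambda_1\wp_{13}\wp_{23}$ $\wp_{112}\wp_{222}=4\lambda_2\wp_{13}^2+2\wp_{23}\lambda_3\wp_{13}\lambda_2-2\lambda_2\wp_{23}\lambda_1+4\lambda_2\wp_{11}\wp_{33}-\wp_{23}^2\lambda_3\lambda_1+4\lambda_2\lambda_0-2\lambda_1^2+8\lambda_0\wp_{23}^2+2\wp_{11}\wp_{22}^2+2\wp_{22}\wp_{12}^2+\frac23\wp_{12}\lambda_3Q-2\lambda_3\wp_{33}\wp_{12}\lambda_2+2\lambda_3\wp_{33}\wp_{22}\lambda_1+4\wp_{13}\lambda_2^2-8\lambda_3\wp_{13}\lambda_1-\frac83\wp_{11}Q-8\lambda_1\wp_{13}\wp_{23}+4\lambda_1\wp_{12}\wp_{33}+8\lambda_3\wp_{23}\lambda_0-\frac23\lambda_2\wp_{22}Q-2\wp_{13}^2\lambda_3^2$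 $\wp_{113}\wp_{123}=-2\wp_{33}^2\lambda_3\lambda_0+2\lambda_2\wp_{12}\wp_{13}+2\wp_{12}\wp_{13}^2+2\wp_{12}\lambda_0-2\wp_{23}\wp_{22}\lambda_0+2\wp_{13}\wp_{23}\wp_{11}+\frac13\wp_{33}\lambda_1Q$ $\wp_{111}\wp_{233}=2\wp_{12}\wp_{33}\wp_{11}-2\wp_{12}\wp_{13}^2+6\lambda_1\wp_{12}\lambda_3+6\lambda_1\wp_{12}\wp_{23}+4\wp_{13}\wp_{23}\wp_{11}-2\wp_{12}\lambda_2^2-2\wp_{11}\lambda_1-4\lambda_2\wp_{12}\wp_{13}+\lambda_2\wp_{22}\lambda_1-2\lambda_2\wp_{23}\wp_{11}-8\wp_{23}\wp_{22}\lambda_0+\wp_{13}\wp_{22}\lambda_1+4\wp_{33}^2\lambda_3\lambda_0+6\wp_{11}\wp_{13}\lambda_3-9\lambda_3\wp_{22}\lambda_0+2\wp_{12}\lambda_0-\frac23\wp_{33}\lambda_1Q$ $\wp_{112}\wp_{133}=4\wp_{33}^2\lambda_3\lambda_0+2\wp_{12}\wp_{33}\wp_{11}+2\lambda_2\wp_{12}\wp_{13}-2\wp_{13}\wp_{22}\lambda_1+2\wp_{12}\lambda_0+2\wp_{12}\wp_{13}^2+4\wp_{23}\wp_{22}\lambda_0-\frac23\wp_{33}\lambda_1Q-\lambda_1\wp_{12}\wp_{23}$ $\wp_{113}\wp_{122}=2\wp_{22}\wp_{13}\wp_{11}-4\wp_{33}\lambda_2\lambda_0+2\wp_{12}^2\wp_{13}-4\wp_{22}^2\lambda_0+\wp_{33}\lambda_1^2+2\wp_{12}\wp_{22}\lambda_1-4\wp_{23}\wp_{33}\lambda_3\lambda_0+\lambda_1\lambda_3\wp_{13}\wp_{33}-\frac23\wp_{13}\lambda_2Q+8\wp_{13}\wp_{33}\lambda_0+\frac43\lambda_0Q+\frac23\wp_{23}\lambda_1Q$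 $\wp_{112}\wp_{123}=8\wp_{33}\lambda_2\lambda_0+2\wp_{12}^2\wp_{13}+2\wp_{12}\wp_{23}\wp_{11}+2\wp_{22}^2\lambda_0-2\wp_{33}\lambda_1^2+2\lambda_2\wp_{12}^2-2\wp_{12}\wp_{22}\lambda_1+2\wp_{23}\wp_{33}\lambda_3\lambda_0-\frac83\lambda_0Q-\frac13\wp_{23}\lambda_1Q$ $\wp_{111}\wp_{223}=-12\wp_{33}\lambda_2\lambda_0+2\wp_{22}\wp_{13}\wp_{11}+6\wp_{11}\lambda_3\wp_{12}-4\wp_{11}^2+4\wp_{33}\lambda_1^2-4\wp_{22}^2\lambda_0-2\lambda_2\wp_{11}\wp_{22}-8\wp_{13}\wp_{33}\lambda_0-\frac43\wp_{23}\lambda_1Q-\lambda_2\wp_{33}\lambda_3\lambda_1+8\wp_{23}\wp_{33}\lambda_3\lambda_0+\frac23\wp_{13}\lambda_2Q+\frac23\lambda_2^2Q-2\lambda_2\wp_{12}^2-2\wp_{12}^2\wp_{13}+4\wp_{12}\wp_{23}\wp_{11}-\lambda_1\lambda_3\wp_{13}\wp_{33}-2\lambda_3\lambda_1Q+4\wp_{12}\wp_{22}\lambda_1+\frac43\lambda_0Q+9\wp_{33}\lambda_3^2\lambda_0$ $\wp_{111}\wp_{222}=6\lambda_3\lambda_2\lambda_0-6\lambda_1\lambda_0-2\lambda_3\lambda_1^2-2\wp_{22}\lambda_1Q-6\lambda_3^2\wp_{13}\lambda_1-8\lambda_3\lambda_0\wp_{13}-2\wp_{12}^3+2\wp_{1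2}\lambda_2Q+10\lambda_3\lambda_0\wp_{23}^2+4\wp_{23}\lambda_2^2\wp_{13}-2\lambda_3\wp_{11}Q+6\wp_{11}\wp_{22}\wp_{12}-4\wp_{33}\wp_{12}\lambda_2^2-16\lambda_0\wp_{13}\wp_{23}+9\lambda_3^2\wp_{23}\lambda_0-4\wp_{23}\lambda_1^2-2\lambda_3\lambda_2\wp_{13}^2+2\lambda_3\wp_{13}\lambda_2^2+6\lambda_2\wp_{13}\lambda_1-8\lambda_0\wp_{12}\wp_{33}+10\lambda_1\wp_{13}^2+2\lambda_3\lambda_2\wp_{11}\wp_{33}-2\wp_{23}^2\lambda_2\lambda_1+4\lambda_3\lambda_1\wp_{12}\wp_{33}+2\lambda_2\wp_{33}\wp_{22}\lambda_1-\lambda_3\lambda_2\wp_{23}\lambda_1+2\wp_{11}\wp_{33}\lambda_1-7\lambda_3\lambda_1\wp_{13}\wp_{23}+2\lambda_3\lambda_0\wp_{22}\wp_{33}$ $\wp_{112}\wp_{122}=2\wp_{11}\wp_{22}\wp_{12}+2\wp_{11}\wp_{33}\lambda_1-2\lambda_1\lambda_0-8\lambda_3\lambda_0\wp_{13}+2\wp_{12}^3-2\lambda_3\lambda_0\wp_{23}^2+8\lambda_0\wp_{12}\wp_{33}+2\lambda_3\lambda_0\wp_{22}\wp_{33}+2\lambda_2\wp_{13}\lambda_1+\lambda_3\lambda_1\wp_{13}\wp_{23}-\wp_{23}\lambda_1^2-2\lambda_1\wp_{13}^2-\frac23\wp_{12}\lambda_2Q$ $\wp_{113}^2=4\wp_{13}^2\wp_{11}-4\lambda_0\wp_{13}\wp_{22}-4\lambda_0\wp_{12}\wp_{23}-4\wp_{33}^2\lambda_2\lambda_0+\wp_{33}^2\lambda_1^2+4\lambda_1\wp_{12}\wp_{13}+\frac43\wp_{33}\lambda_0Q$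 $\wp_{111}\wp_{133}=8\lambda_0\wp_{12}\wp_{23}-\lambda_1\wp_{12}\lambda_2-6\lambda_2\wp_{22}\lambda_0+2\lambda_2\wp_{11}\wp_{13}+2\wp_{22}\lambda_1^2-2\wp_{33}^2\lambda_1^2-6\lambda_0\wp_{11}+2\wp_{33}\wp_{11}^2+9\lambda_0\wp_{12}\lambda_3-\frac83\wp_{33}\lambda_0Q-\lambda_1\wp_{12}\wp_{13}-2\lambda_1\wp_{11}\wp_{23}+2\wp_{13}^2\wp_{11}-4\lambda_0\wp_{13}\wp_{22}+8\wp_{33}^2\lambda_2\lambda_0$ $\wp_{112}\wp_{113}=-4\wp_{23}\wp_{33}\lambda_2\lambda_0+2\lambda_1\wp_{12}^2+\wp_{23}\wp_{33}\lambda_1^2-4\lambda_0\wp_{12}\wp_{22}+4\wp_{12}\wp_{13}\wp_{11}+\frac43\wp_{23}\lambda_0Q-\frac23\wp_{13}\lambda_1Q+4\lambda_0\lambda_3\wp_{13}\wp_{33}$ $\wp_{111}\wp_{123}=2\wp_{12}\wp_{13}\wp_{11}-2\wp_{33}\lambda_3\lambda_1^2+2\lambda_1\wp_{33}\lambda_0-2\lambda_0\lambda_3\wp_{13}\wp_{33}+2\wp_{11}\wp_{12}\lambda_2-2\wp_{11}\wp_{22}\lambda_1+6\lambda_2\wp_{33}\lambda_3\lambda_0+8\wp_{23}\wp_{33}\lambda_2\lambda_0+2\lambda_0\wp_{12}\wp_{22}-2\wp_{23}\wp_{33}\lambda_1^2+\frac13\lambda_2\lambda_1Q-3\lambda_3\lambda_0Q-\frac83\wp_{23}\lambda_0Q+\frac13\wp_{13}\lambda_1Q+2\wp_{23}\wp_{11}^2$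 $\wp_{111}\wp_{122}=-3\lambda_3\lambda_1\lambda_0-\lambda_2\lambda_1^2+4\lambda_2^2\lambda_0-8\lambda_0^2-\lambda_1\wp_{13}^2\lambda_3-8\lambda_1\lambda_0\wp_{23}-2\wp_{23}^2\lambda_1^2+4\lambda_2\lambda_0\wp_{23}^2-\frac83\wp_{22}\lambda_0Q+\frac23\wp_{12}\lambda_1Q-\frac23\lambda_2\wp_{11}Q+\lambda_1^2\wp_{13}+8\lambda_2\lambda_0\wp_{13}-9\lambda_3^2\lambda_0\wp_{13}-2\lambda_3\lambda_1^2\wp_{23}+2\wp_{11}^2\wp_{22}-2\lambda_2\lambda_1\wp_{12}\wp_{33}+2\wp_{11}\wp_{12}^2+8\lambda_0\wp_{13}^2+\lambda_2\lambda_3\wp_{13}\lambda_1+4\lambda_3\lambda_0\wp_{12}\wp_{33}+2\lambda_2\lambda_1\wp_{13}\wp_{23}-8\lambda_3\lambda_0\wp_{13}\wp_{23}+4\lambda_2\wp_{33}\wp_{22}\lambda_0+2\lambda_3\lambda_1\wp_{11}\wp_{33}+6\lambda_2\lambda_3\wp_{23}\lambda_0$ $\wp_{112}^2=-8\lambda_0\wp_{13}^2+8\lambda_0\wp_{11}\wp_{33}-4\lambda_1\lambda_0\wp_{23}-4\lambda_2\lambda_0\wp_{23}^2-8\lambda_2\lambda_0\wp_{13}+4\wp_{11}\wp_{12}^2-8\lambda_0^2+4\lambda_3\lambda_0\wp_{13}\wp_{23}+4\lambda_3\lambda_0\wp_{12}\wp_{33}+\wp_{23}^2\lambda_1^2+4\lambda_1^2\wp_{13}+\frac43\wp_{22}\lambda_0Q-\frac43\wp_{12}\lambda_1Q$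 $\wp_{111}\wp_{113}=4\lambda_0\wp_{33}\wp_{13}\lambda_2+4\wp_{11}^2\wp_{13}-\wp_{33}\lambda_2\lambda_1^2+4\wp_{33}\lambda_2^2\lambda_0-\lambda_1^2\wp_{13}\wp_{33}-3\wp_{33}\lambda_3\lambda_1\lambda_0+2\wp_{12}\wp_{11}\lambda_1-6\wp_{22}\lambda_0\wp_{11}+2\lambda_0\wp_{12}^2-2\lambda_2\lambda_0Q-\frac43\lambda_0\wp_{13}Q+\frac23\lambda_1^2Q+8\wp_{33}\lambda_0^2$ $\wp_{111}\wp_{112}=-\frac43\wp_{12}\lambda_0Q+2\lambda_3\wp_{13}\lambda_1^2+8\lambda_2\lambda_1\lambda_0+\lambda_1^2\wp_{13}\wp_{23}-\frac23\wp_{11}\lambda_1Q+6\lambda_3\wp_{33}\lambda_0\wp_{11}+4\wp_{11}^2\wp_{12}+4\wp_{23}\lambda_2^2\lambda_0-18\lambda_3\lambda_0^2-2\lambda_1^3-16\wp_{23}\lambda_0^2-2\lambda_3\wp_{13}^2\lambda_0-6\lambda_3\wp_{13}\lambda_2\lambda_0-3\lambda_1\lambda_3\wp_{23}\lambda_0+2\lambda_1\wp_{33}\wp_{22}\lambda_0-\lambda_2\wp_{23}\lambda_1^2-2\lambda_1^2\wp_{12}\wp_{33}-2\lambda_1\lambda_0\wp_{23}^2+8\lambda_1\lambda_0\wp_{13}+4\lambda_0\wp_{33}\wp_{12}\lambda_2$ $\wp_{111}^2=-4\wp_{23}\lambda_1^3-8\wp_{23}^2\lambda_0^2-8\wp_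{13}\lambda_2^2\lambda_0-4\lambda_2\lambda_0\wp_{13}^2+16\wp_{23}\lambda_2\lambda_1\lambda_0+4\wp_{23}\lambda_1\lambda_0\wp_{13}+6\lambda_3\lambda_1\lambda_0\wp_{13}-4\lambda_0\wp_{11}Q-36\lambda_3\wp_{23}\lambda_0^2+18\lambda_3\lambda_2\lambda_1\lambda_0+\lambda_2^2\lambda_1^2-4\lambda_3\lambda_1^3-4\lambda_2^3\lambda_0-4\lambda_1^2\lambda_0-27\lambda_3^2\lambda_0^2+12\lambda_2\lambda_0^2+2\wp_{13}\lambda_2\lambda_1^2+16\wp_{13}\lambda_0^2+\lambda_1^2\wp_{13}^2-4\wp_{12}\lambda_1\wp_{33}\lambda_0-4\wp_{11}\wp_{33}\lambda_1^2+16\wp_{11}\wp_{33}\lambda_2\lambda_0+4\wp_{11}^3+8\wp_{33}\wp_{22}\lambda_0^2$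
   Context: Let $C$ be the compact Riemann surface (genus $3$, one point $\infty$ at infinity) of the cyclic $(3,4)$-curve $y^3=x^4+\lambda_3x^3+\lambda_2x^2+\lambda_1x+\lambda_0$, assumed non-singular, $\lambda_j\in\mathbb C$. Put $\boldsymbol{du}=\big(\frac{dx}{3y^2},\frac{x\,dx}{3y^2},\frac{y\,dx}{3y^2}\big)$. $\Lambda\subset\mathbb C^3$ is the lattice of all periods of $\boldsymbol{du}$ over $H_1(C,\mathbb Z)$, $J=\mathbb C^3/\Lambda$, $\kappa:\mathbb C^3\to J$ the projection, $W^{[2]}\subset J$ the image of $(P_1,P_2)\mapsto\int_\infty^{P_1}\boldsymbol{du}+\int_\infty^{P_2}\boldsymbol{du}$, and $\Theta^{[2]}=W^{[2]}\cup(-W^{[2]})$. The Kleinian sigma function $\sigma(\boldsymbol u)$, $\boldsymbol u=(u_1,u_2,u_3)\in\mathbb C^3$, is classically $c\exp(\frac12\boldsymbol u\eta'(\omega')^{-1}\boldsymbol u^T)$ times the Riemann theta function whose characteristic gives the Riemann constant with base point $\infty$. It is uniquely determined by: (i) $\sigma$ is entire, with zeros of order one along $\kappa^{-1}(\Theta^{[2]})$ and no other zeros; (ii) for each $\boldsymbol\ell\in\Lambda$, $\sigma(\boldsymbol u+\boldsymbol\ell)=\chi(\boldsymbol\ell)\exp(L(\boldsymbol u+\frac12\boldsymbol\ell,\boldsymbol\ell))\sigma(\boldsymbol u)$ with $\chi(\boldsymbol\ell)\in\{\pm1\}$ and $L(\cdot,\boldsymbol\ell)$ a $\mathbb C$-linear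 form; (iii) $\sigma(-\boldsymbol u)=-\sigma(\boldsymbol u)$; (iv) giving $u_1,u_2,u_3$ weights $5,2,1$, the lowest-weight part of the Taylor expansion of $\sigma$ at $0$ is $\frac1{20}u_3^5-u_3u_2^2+u_1$; (v) (normalisation of the quadratic exponential factor, corresponding to the standard choice of second kind differentials) with $\wp_{ij}=-\partial_{u_i}\partial_{u_j}\log\sigma$ and $(\varphi_1,\varphi_2,\varphi_3)=(1,x,y)$, for generic $P_k=(x_k,y_k)$ ($k=1,2,3$), $\boldsymbol u=\sum_k\int_\infty^{P_k}\boldsymbol{du}$ and $P=(x,y)$, one has for each $k$: $\sum_{i,j=1}^3\wp_{ij}\big(\int_\infty^P\boldsymbol{du}-\boldsymbol u\big)\varphi_i(P)\varphi_j(P_k)=\frac{3y^2y_k^2+y_kT(x,x_k)+yT(x_k,x)}{(x-x_k)^2}$, where $T(x,z)=3\lambda_0+(z+2x)\lambda_1+x(x+2z)\lambda_2+3\lambda_3x^2z+x^2z^2+2x^3z$. For $m\ge2$, $\wp_{i_1\dots i_m}=-\frac{\partial}{\partial u_{i_1}}\cdots\frac{\partial}{\partial u_{i_m}}\log\sigma$, and $Q_{1333}=\wp_{1333}-6\wp_{13}\wp_{33}$. "Quadratic 3-index relations" are relations expressing the products of two 3-index functions $\wp_{ijk}\wp_{lmn}$ as polynomials of degree at most three in the fundamental basis functions, i.e. the $\wp_{ij}$ and $Q_{1333}$. *)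

theory Defs
  imports "HOL-Complex_Analysis.Complex_Analysis" "HOL-Computational_Algebra.Polynomial"
begin

text \<open>
  The curve \<open>y\<^sup>3 = f(x)\<close>, where \<open>f\<close> is the quartic
  \<open>[:\<lambda>\<^sub>0, \<lambda>\<^sub>1, \<lambda>\<^sub>2, \<lambda>\<^sub>3, 1:]\<close>.  The point at infinity of such a curve is always
  smooth, so only the affine part enters the condition of non-singularity.
\<close>

definition affine_curve :: "complex poly \<Rightarrow> (complex \<times> complex) set" where
  "affine_curve f = {(x, y). y ^ 3 = poly f x}"

definition nonsingular_curve :: "complex poly \<Rightarrow> bool" where
  "nonsingular_curve f \<longleftrightarrow>
     (\<forall>(x, y) \<in> affine_curve f. \<not> (3 * y ^ 2 = 0 \<and> poly (pderiv f) x = 0))"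

text \<open>
  The compact Riemann surface is the affine curve together with one point at infinity, here
  \<^term>\<open>None\<close>.
\<close>

definition compact_curve :: "complex poly \<Rightarrow> (complex \<times> complex) option set" where
  "compact_curve f = insert None (Some ` affine_curve f)"

text \<open>
  The value of \<open>du = (dx/3y\<^sup>2, x dx/3y\<^sup>2, y dx/3y\<^sup>2)\<close> at the point \<open>(x, y)\<close> on the tangent
  vector \<open>(\<xi>, \<eta>)\<close>.  On the curve \<open>3y\<^sup>2 dy = f'(x) dx\<close>, so that at a branch point, where
  \<open>y = 0\<close> and \<open>x\<close> is not a local parameter, \<open>dx/3y\<^sup>2\<close> has to be read as \<open>dy/f'(x)\<close>.
\<close>

definition du_form :: "complex poly \<Rightarrow> complex \<times> complex \<Rightarrow> complex \<times> complex \<Rightarrow> complex ^ 3" where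
  "du_form f = (\<lambda>(x, y) (\<xi>, \<eta>).
     let w = (if y \<noteq> 0 then \<xi> / (3 * y ^ 2) else \<eta> / poly (pderiv f) x)
     in vector [w, x * w, y * w])"

definition du_integral ::
    "complex poly \<Rightarrow> real \<Rightarrow> real \<Rightarrow> (real \<Rightarrow> complex \<times> complex) \<Rightarrow> complex ^ 3" where
  "du_integral f a b \<gamma> =
     integral {a..b} (\<lambda>t. du_form f (\<gamma> t) (vector_derivative \<gamma> (at t)))"

text \<open>
  Every class in the first integral homology of the compact curve is represented by a single
  piecewise smooth loop avoiding the point at infinity, so the periods over
  all of the homology are the integrals over closed paths in the affine curve.
\<close>

definition period_lattice :: "complex poly \<Rightarrow> (complex ^ 3) set" where
  "period_lattice f = {du_integral f 0 1 \<gamma> | \<gamma>.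
     valid_path \<gamma> \<and> path_image \<gamma> \<subseteq> affine_curve f \<and> pathfinish \<gamma> = pathstart \<gamma>}"

text \<open>
  All values of the integral of \<open>du\<close> from infinity to \<open>P\<close>; they form a coset of the period
  lattice.  For affine \<open>P\<close> the paths leave infinity at time \<open>0\<close> and stay in the affine curve
  afterwards (the affine coordinates are unbounded precisely near infinity), and the integral
  is the limit of the integrals over \<open>{\<epsilon>..1}\<close>.  From infinity to itself one obtains the periods.
\<close>

fun abel_values :: "complex poly \<Rightarrow> (complex \<times> complex) option \<Rightarrow> (complex ^ 3) set" where
  "abel_values f None = period_lattice f"
| "abel_values f (Some P) = {v. \<exists>\<gamma>.
     (\<forall>\<epsilon>. 0 < \<epsilon> \<and> \<epsilon> < 1 \<longrightarrow> \<gamma> piecewise_C1_differentiable_on {\<epsilon>..1}) \<and>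
     \<gamma> ` {0<..1} \<subseteq> affine_curve f \<and>
     filterlim \<gamma> at_infinity (at_right 0) \<and> \<gamma> 1 = P \<and>
     ((\<lambda>\<epsilon>. du_integral f \<epsilon> 1 \<gamma>) \<longlongrightarrow> v) (at_right 0)}"

text \<open>
  The inverse images in \<open>\<complex>\<^sup>3\<close> of \<open>W\<^sup>[\<^sup>2\<^sup>]\<close> and \<open>\<Theta>\<^sup>[\<^sup>2\<^sup>]\<close> under the projection to the Jacobian.
  Since \<^const>\<open>abel_values\<close> collects the integrals over all paths, these sets are
  invariant under translation by periods, i.e. they are full inverse images.
\<close>

definition W2_preimage :: "complex poly \<Rightarrow> (complex ^ 3) set" where
  "W2_preimage f = {v\<^sub>1 + v\<^sub>2 | v\<^sub>1 v\<^sub>2 P\<^sub>1 P\<^sub>2. P\<^sub>1 \<in> compact_curve f \<and> P\<^sub>2 \<in> compact_curve f \<and>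
     v\<^sub>1 \<in> abel_values f P\<^sub>1 \<and> v\<^sub>2 \<in> abel_values f P\<^sub>2}"

definition Theta2_preimage :: "complex poly \<Rightarrow> (complex ^ 3) set" where
  "Theta2_preimage f = W2_preimage f \<union> uminus ` W2_preimage f"

definition complex_linear_form :: "(complex ^ 3 \<Rightarrow> complex) \<Rightarrow> bool" where
  "complex_linear_form L \<longleftrightarrow>
     (\<forall>v w. L (v + w) = L v + L w) \<and> (\<forall>c v. L (c *s v) = c * L v)"

definition entire3 :: "(complex ^ 3 \<Rightarrow> complex) \<Rightarrow> bool" where
  "entire3 g \<longleftrightarrow> (\<forall>u. \<exists>D. (g has_derivative D) (at u) \<and> complex_linear_form D)"

definition partial_deriv :: "3 \<Rightarrow> (complex ^ 3 \<Rightarrow> complex) \<Rightarrow> complex ^ 3 \<Rightarrow> complex" where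
  "partial_deriv i g u = deriv (\<lambda>z. g (u + axis i z)) 0"

text \<open>
  As \<open>log \<sigma>\<close> is multi-valued, its first derivatives are taken to be \<open>\<partial>\<^sub>j\<sigma> / \<sigma>\<close>, which is the
  derivative of every local branch.
\<close>

definition wp2 :: "(complex ^ 3 \<Rightarrow> complex) \<Rightarrow> 3 \<Rightarrow> 3 \<Rightarrow> complex ^ 3 \<Rightarrow> complex" where
  "wp2 \<sigma> i j = (\<lambda>u. - partial_deriv i (\<lambda>v. partial_deriv j \<sigma> v / \<sigma> v) u)"

definition wp3 :: "(complex ^ 3 \<Rightarrow> complex) \<Rightarrow> 3 \<Rightarrow> 3 \<Rightarrow> 3 \<Rightarrow> complex ^ 3 \<Rightarrow> complex" where
  "wp3 \<sigma> i j k = partial_deriv i (wp2 \<sigma> j k)"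

definition wp4 :: "(complex ^ 3 \<Rightarrow> complex) \<Rightarrow> 3 \<Rightarrow> 3 \<Rightarrow> 3 \<Rightarrow> 3 \<Rightarrow> complex ^ 3 \<Rightarrow> complex" where
  "wp4 \<sigma> i j k l = partial_deriv i (wp3 \<sigma> j k l)"

definition Q1333 :: "(complex ^ 3 \<Rightarrow> complex) \<Rightarrow> complex ^ 3 \<Rightarrow> complex" where
  "Q1333 \<sigma> u = wp4 \<sigma> 1 3 3 3 u - 6 * wp2 \<sigma> 1 3 u * wp2 \<sigma> 3 3 u"

definition taylor_coeff :: "(complex ^ 3 \<Rightarrow> complex) \<Rightarrow> nat \<Rightarrow> nat \<Rightarrow> nat \<Rightarrow> complex" where
  "taylor_coeff g a b c =
     ((partial_deriv 1 ^^ a) ((partial_deriv 2 ^^ b) ((partial_deriv 3 ^^ c) g))) 0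
       / (fact a * fact b * fact c)"

text \<open>
  The part of weight \<open>n\<close> of the Taylor expansion at \<open>0\<close>, the variables having weights \<open>5, 2, 1\<close>.
\<close>

definition weight_part :: "(complex ^ 3 \<Rightarrow> complex) \<Rightarrow> nat \<Rightarrow> complex ^ 3 \<Rightarrow> complex" where
  "weight_part g n u =
     (\<Sum>(a, b, c) | 5 * a + 2 * b + c = n.
        taylor_coeff g a b c * (u $ 1) ^ a * (u $ 2) ^ b * (u $ 3) ^ c)"

definition klein_T :: "complex poly \<Rightarrow> complex \<Rightarrow> complex \<Rightarrow> complex" where
  "klein_T f x z =
     3 * coeff f 0 + (z + 2 * x) * coeff f 1 + x * (x + 2 * z) * coeff f 2
       + 3 * coeff f 3 * x ^ 2 * z + x ^ 2 * z ^ 2 + 2 * x ^ 3 * z"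

text \<open>
  A zero of order one along the divisor means that the differential of \<open>\<sigma>\<close> does not vanish
  identically on any relatively open part of the zero set, i.e. it is nonzero on a dense subset.
\<close>

definition sigma_divisor :: "complex poly \<Rightarrow> (complex ^ 3 \<Rightarrow> complex) \<Rightarrow> bool" where
  "sigma_divisor f \<sigma> \<longleftrightarrow>
     {u. \<sigma> u = 0} = Theta2_preimage f \<and>
     Theta2_preimage f \<subseteq> closure {u \<in> Theta2_preimage f. \<exists>i. partial_deriv i \<sigma> u \<noteq> 0}"

definition sigma_quasi_periodic :: "complex poly \<Rightarrow> (complex ^ 3 \<Rightarrow> complex) \<Rightarrow> bool" where
  "sigma_quasi_periodic f \<sigma> \<longleftrightarrow>
     (\<forall>l \<in> period_lattice f. \<exists>s L.
        s \<in> {1, -1} \<and> complex_linear_form L \<and>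
        (\<forall>u. \<sigma> (u + l) = s * exp (L (u + (1 / 2) *s l)) * \<sigma> u))"

definition sigma_leading_part :: "(complex ^ 3 \<Rightarrow> complex) \<Rightarrow> bool" where
  "sigma_leading_part \<sigma> \<longleftrightarrow>
     (\<forall>n < 5. \<forall>u. weight_part \<sigma> n u = 0) \<and>
     (\<forall>u. weight_part \<sigma> 5 u = 1 / 20 * (u $ 3) ^ 5 - u $ 3 * (u $ 2) ^ 2 + u $ 1)"

text \<open>
  Generic points are those for which both sides of the identity are defined: \<open>\<sigma>\<close> does not vanish
  at the argument of the \<open>\<wp>\<^sub>i\<^sub>j\<close>, and the denominator is nonzero.  By periodicity of the
  \<open>\<wp>\<^sub>i\<^sub>j\<close> the identity does not depend on the choice of the paths of integration.
\<close>

definition sigma_klein_formula :: "complex poly \<Rightarrow> (complex ^ 3 \<Rightarrow> complex) \<Rightarrow> bool" where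
  "sigma_klein_formula f \<sigma> \<longleftrightarrow>
     (\<forall>x y v (X :: 3 \<Rightarrow> complex) (Y :: 3 \<Rightarrow> complex) (V :: 3 \<Rightarrow> complex ^ 3).
        (x, y) \<in> affine_curve f \<and> v \<in> abel_values f (Some (x, y)) \<and>
        (\<forall>k. (X k, Y k) \<in> affine_curve f \<and> V k \<in> abel_values f (Some (X k, Y k))) \<and>
        \<sigma> (v - (\<Sum>m\<in>UNIV. V m)) \<noteq> 0 \<longrightarrow>
        (\<forall>k. x \<noteq> X k \<longrightarrow>
          (let \<phi> = (\<lambda>(a, b). vector [1, a, b] :: complex ^ 3) in
           (\<Sum>i\<in>UNIV. \<Sum>j\<in>UNIV.
              wp2 \<sigma> i j (v - (\<Sum>m\<in>UNIV. V m)) * \<phi> (x, y) $ i * \<phi> (X k, Y k) $ j)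
           = (3 * y ^ 2 * Y k ^ 2 + Y k * klein_T f x (X k) + y * klein_T f (X k) x)
               / (x - X k) ^ 2)))"

text \<open>
  These conditions determine the Kleinian sigma function of the curve uniquely.
\<close>

definition is_sigma_function :: "complex poly \<Rightarrow> (complex ^ 3 \<Rightarrow> complex) \<Rightarrow> bool" where
  "is_sigma_function f \<sigma> \<longleftrightarrow>
     entire3 \<sigma> \<and> sigma_divisor f \<sigma> \<and> sigma_quasi_periodic f \<sigma> \<and>
     (\<forall>u. \<sigma> (- u) = - \<sigma> u) \<and> sigma_leading_part \<sigma> \<and> sigma_klein_formula f \<sigma>"

end

theory Submission
  imports Defs
begin

text \<open>
  In a disc around \<open>\<infinity>\<close> the curve is parametrised by \<open>x = t\<^sup>-\<^sup>3\<close>, \<open>y = t\<^sup>-\<^sup>4 h(t)\<close>, and the integral of \<open>du\<close>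
  from \<open>\<infinity>\<close> is an explicit holomorphic function of \<open>t\<close>.  Letting \<open>P = P(t)\<close> tend to \<open>\<infinity>\<close> in the formula of
  Klein turns it into an identity of power series in \<open>t\<close>.  Its coefficients of order at most \<open>4\<close> express, on
  the three points of a generic divisor, the functions \<open>x\<^sup>2\<close>, \<open>xy\<close>, \<open>y\<^sup>2\<close>, \<open>f'(x)\<close> and
  \<open>y(5x\<^sup>2 + 3\<lambda>\<^sub>3x + \<lambda>\<^sub>2)\<close> as combinations of \<open>1, x, y\<close> whose coefficients are linear in the
  \<open>\<wp>\<close>-functions.  As \<open>1, x, y\<close> are independent on the divisor, associativity of the multiplication
  and the equation of the curve are polynomial relations between these coefficients.  They extend to all of
  \<open>\<sigma> \<noteq> 0\<close> by the identity theorem and split into even and odd parts under \<open>u \<mapsto> - u\<close>.  Differentiating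
  them expresses every \<open>\<wp>\<^sub>i\<^sub>j\<close>, \<open>\<wp>\<^sub>i\<^sub>j\<^sub>k\<close> and \<open>Q\<close> as a polynomial in the structure
  constants of the three-dimensional algebra, where all relations of the theorem hold modulo a single equation,
  which is monic in one of the structure constants.
\<close>

section \<open>Complex differentiable functions of three variables\<close>

text \<open>The infix \<open>$\<close> is reserved for vector components.\<close>

no_notation fps_nth (infixl \<open>$\<close> 75)

text \<open>Three points close to infinity are enough: paths and integrals are explicit there, and
  their Abel sums fill an open set, which is all that the identity theorem asks for. The expansion
  stops at order 4 because there \<wp>_11 enters for the first time, the index 1 being carried by
  t^4. Each coefficient mixes derivatives of even and odd order, so parity yields two relations from
  one. The formula \<wp>_3333 = 6 \<wp>_33^2 - 3 \<wp>_22 is reached only after multiplication by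
  \<wp>_333. Cancelling this factor requires that it does not vanish identically, and this is where
  the leading part of \<sigma> enters. The functions still missing then come from differentiating
  known relations and comparing mixed derivatives. Of the three coordinates of the curve equation,
  those of 1 and x are solved for l0 and l1. That of y is kept as an equation for d^2, since solving
  it for l2 would mean dividing by \<wp>_33. There remain eight quantities a, b, d, e, \<wp>_33,
  \<wp>_23, l2, l3 with one equation, hence seven degrees of freedom: three coordinates of u and
  four coefficients of the curve.\<close>

definition hol3 :: "(complex ^ 3) set \<Rightarrow> (complex ^ 3 \<Rightarrow> complex) \<Rightarrow> bool" where
  "hol3 U g \<longleftrightarrow> (\<forall>u\<in>U. \<exists>D. (g has_derivative D) (at u) \<and> complex_linear_form D)"

text \<open>A relation instead of a value: \<open>deriv\<close> has some value even where no
  derivative exists, while \<open>haspd\<close> records existence and can be assembled by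
  introduction rules.\<close>

definition haspd :: "3 \<Rightarrow> (complex ^ 3 \<Rightarrow> complex) \<Rightarrow> complex \<Rightarrow> complex ^ 3 \<Rightarrow> bool" where
  "haspd i g D u \<longleftrightarrow> ((\<lambda>z. g (u + axis i z)) has_field_derivative D) (at 0)"

lemma axis_eq_smult: "axis i (z::complex) = z *s axis i 1"
  by (simp add: axis_def vec_eq_iff vector_scalar_mult_def)

lemma axis_zero [simp]: "axis i (0::complex) = 0"
  by (simp add: axis_def vec_eq_iff)

lemma axis_add: "axis i (z + w :: complex) = axis i z + axis i w"
  by (simp add: axis_def vec_eq_iff)

lemma norm_axis_complex: "norm (axis i (z::complex) :: complex ^ 3) = norm z"
proof -
  have "(\<Sum>j\<in>UNIV. (norm ((axis i z :: complex ^ 3) $ j))\<^sup>2) = (\<Sum>j\<in>UNIV. if j = i then (norm z)\<^sup>2 else 0)"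
    by (intro sum.cong) (auto simp: axis_def)
  then show ?thesis by (simp add: norm_vec_def L2_set_def)
qed

lemma bounded_linear_axis: "bounded_linear (axis i :: complex \<Rightarrow> complex ^ 3)"
  by (rule bounded_linear_intro[where K = 1]) (auto simp: axis_add norm_axis_complex, simp add: axis_def vec_eq_iff)

lemma vec3_decomp: "(h::complex ^ 3) = (\<Sum>j\<in>UNIV. (h $ j) *s axis j 1)"
  by (simp add: vec_eq_iff axis_def vector_scalar_mult_def if_distrib cong: if_cong)

lemma complex_linear_form_sum:
  assumes "complex_linear_form D"
  shows "D (\<Sum>j\<in>A. f j) = (\<Sum>j\<in>A. D (f j))" 
proof -
  have 0: "D 0 = 0"
    using assms unfolding complex_linear_form_def by (metis add_cancel_right_right)
  show ?thesis
    by (induction A rule: infinite_finite_induct) (use assms 0 in \<open>auto simp: complex_linear_form_def\<close>)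
qed

lemma haspd_unique: "haspd i g D u \<Longrightarrow> haspd i g E u \<Longrightarrow> D = E"
  unfolding haspd_def by (rule DERIV_unique)

lemma haspd_imp_eq: "haspd i g D u \<Longrightarrow> partial_deriv i g u = D"
  unfolding haspd_def partial_deriv_def by (rule DERIV_imp_deriv)

lemma has_derivative_haspd:
  assumes "(g has_derivative D) (at u)" "complex_linear_form D"
  shows "haspd i g (D (axis i 1)) u"
proof -
  have "((\<lambda>z. u + axis i z) has_derivative axis i) (at 0)"
    by (auto intro!: derivative_eq_intros bounded_linear_imp_has_derivative bounded_linear_axis)
  then have "((\<lambda>z. g (u + axis i z)) has_derivative (\<lambda>z. D (axis i z))) (at 0)"
    by (rule has_derivative_compose) (use assms in simp)
  moreover have "(\<lambda>z. D (axis i z)) = (*) (D (axis i 1))"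
  proof
    fix z show "D (axis i z) = D (axis i 1) * z"
      using assms(2) by (subst axis_eq_smult) (simp only: complex_linear_form_def mult.commute)
  qed
  ultimately show ?thesis by (simp add: haspd_def has_field_derivative_def)
qed

lemma hol3_haspd: "hol3 U g \<Longrightarrow> u \<in> U \<Longrightarrow> haspd i g (partial_deriv i g u) u"
  unfolding hol3_def by (metis has_derivative_haspd haspd_imp_eq)

lemma hol3_has_derivative:
  assumes "hol3 U g" "u \<in> U"
  shows "(g has_derivative (\<lambda>h. \<Sum>j\<in>UNIV. partial_deriv j g u * h $ j)) (at u)"
proof -
  obtain D where D: "(g has_derivative D) (at u)" "complex_linear_form D"
    using assms unfolding hol3_def by blast
  have "D h = (\<Sum>j\<in>UNIV. partial_deriv j g u * h $ j)" for h
  proof -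
    have "D h = D (\<Sum>j\<in>UNIV. (h $ j) *s axis j 1)" using vec3_decomp by metis
    also have "\<dots> = (\<Sum>j\<in>UNIV. D ((h $ j) *s axis j 1))"
      by (rule complex_linear_form_sum[OF D(2)])
    also have "\<dots> = (\<Sum>j\<in>UNIV. partial_deriv j g u * h $ j)"
      using D haspd_imp_eq[OF has_derivative_haspd[OF D]] by (simp add: complex_linear_form_def mult.commute)
    finally show ?thesis .
  qed
  then have "D = (\<lambda>h. \<Sum>j\<in>UNIV. partial_deriv j g u * h $ j)" ..
  then show ?thesis using D by simp
qed

lemma hol3I:
  assumes "\<And>u. u \<in> U \<Longrightarrow> (g has_derivative (\<lambda>h. \<Sum>j\<in>UNIV. c j u * h $ j)) (at u)"
  shows "hol3 U g"
  unfolding hol3_def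
proof
  fix u assume "u \<in> U"
  then show "\<exists>D. (g has_derivative D) (at u) \<and> complex_linear_form D"
    by (intro exI[of _ "\<lambda>h. \<Sum>j\<in>UNIV. c j u * h $ j"])
      (simp add: assms complex_linear_form_def sum.distrib sum_distrib_left distrib_left mult.left_commute)
qed

lemma hol3_continuous_on: "hol3 U g \<Longrightarrow> continuous_on U g"
  unfolding hol3_def using has_derivative_continuous continuous_at_imp_continuous_on by blast

lemma hol3_subset: "hol3 U g \<Longrightarrow> V \<subseteq> U \<Longrightarrow> hol3 V g"
  unfolding hol3_def by blast

lemma hol3_DERIV_line:
  assumes "hol3 U g" "u + axis i z \<in> U"
  shows "((\<lambda>w. g (u + axis i w)) has_field_derivative partial_deriv i g (u + axis i z)) (at z)"
proof -
  have "((\<lambda>w. g (u + axis i z + axis i w)) has_field_derivative partial_deriv i g (u + axis i z)) (at 0)"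
    using hol3_haspd[OF assms] by (simp add: haspd_def)
  then have "((\<lambda>w. g (u + axis i (w + z))) has_field_derivative partial_deriv i g (u + axis i z)) (at 0)"
    by (simp add: axis_add add_ac)
  then show ?thesis using DERIV_shift[of "\<lambda>w. g (u + axis i w)" _ 0 z] by simp
qed

text \<open>Cauchy's formula for the derivative in one coordinate; the velocity 2 pi i z of the
  circle cancels the constant and one of the two powers of z in the denominator. A partial
  derivative becomes a parameter integral, which can itself be differentiated in
  \<open>u\<close>.\<close>

lemma partial_deriv_Cauchy:
  assumes g: "hol3 U g" and r: "r > 0" and sub: "\<And>z. norm z \<le> r \<Longrightarrow> u + axis i z \<in> U"
  shows "partial_deriv i g u =
    integral {0..1} (\<lambda>t. g (u + axis i (circlepath 0 r t)) / circlepath 0 r t)"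
proof -
  let ?f = "\<lambda>z. g (u + axis i z)"
  have d: "(?f has_field_derivative partial_deriv i g (u + axis i z)) (at z)" if "norm z \<le> r" for z
    using hol3_DERIV_line[OF g sub[OF that]] .
  have c: "continuous_on (cball 0 r) ?f"
    by (rule DERIV_continuous_on[of _ _ "\<lambda>z. partial_deriv i g (u + axis i z)"])
      (use d in \<open>auto intro: has_field_derivative_at_within\<close>)
  have h: "?f holomorphic_on ball 0 r"
    unfolding holomorphic_on_open[OF open_ball] using d by (metis less_imp_le mem_ball_0)
  have "(?f has_field_derivative (1 / (2 * of_real pi * \<i>) * contour_integral (circlepath 0 r) (\<lambda>w. ?f w / (w - 0)^2))) (at 0)"
    by (rule Cauchy_derivative_integral_circlepath(2)[OF c h]) (use r in auto)
  then have "partial_deriv i g u = 1 / (2 * of_real pi * \<i>) * contour_integral (circlepath 0 r) (\<lambda>w. ?f w / (w - 0)^2)"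
    using d[of 0] r by (auto intro: DERIV_unique)
  also have "\<dots> = 1 / (2 * of_real pi * \<i>) * integral {0..1} (\<lambda>t. ?f (circlepath 0 r t) / (circlepath 0 r t)^2 * (2 * of_real pi * \<i> * circlepath 0 r t))"
    unfolding contour_integral_integral
    by (intro arg_cong2[where f = "(*)"] refl integral_cong)
       (simp_all only: vector_derivative_circlepath, simp_all add: circlepath)
  also have "\<dots> = integral {0..1} (\<lambda>t. 1 / (2 * of_real pi * \<i>) * (?f (circlepath 0 r t) / (circlepath 0 r t)^2 * (2 * of_real pi * \<i> * circlepath 0 r t)))"
    by (rule integral_mult_right[symmetric])
  also have "\<dots> = integral {0..1} (\<lambda>t. ?f (circlepath 0 r t) / circlepath 0 r t)"
    by (intro integral_cong) (use r in \<open>auto simp: power2_eq_square circlepath\<close>)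
  finally show ?thesis .
qed

lemma continuous_on_slice:
  assumes "continuous_on (S \<times> T) (\<lambda>(u, t). f u t)" "u \<in> S"
  shows "continuous_on T (f u)"
proof -
  have "continuous_on T ((\<lambda>(u, t). f u t) \<circ> Pair u)"
    by (rule continuous_on_compose)
      (use assms in \<open>auto intro!: continuous_intros intro: continuous_on_subset\<close>)
  then show ?thesis by (simp add: o_def)
qed

text \<open>The Cauchy integral shows first that the partial derivatives are continuous and then, by
  the Leibniz rule, that they are differentiable. The derivative of \<open>partial_deriv i g\<close>
  in direction j is the same integral with \<open>partial_deriv j g\<close> in place of
  \<open>g\<close>, that is, the i-th partial derivative of \<open>partial_deriv j g\<close>; hence
  the symmetry.\<close>

lemma partial_deriv_props:
  assumes g: "hol3 U g" and U: "open U"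
  shows hol3_partial_deriv: "hol3 U (partial_deriv i g)"
    and partial_deriv_commute: "u \<in> U \<Longrightarrow> partial_deriv j (partial_deriv i g) u = partial_deriv i (partial_deriv j g) u"
proof -
  \<comment> \<open>Room for two shifts by at most \<open>r\<close>: from radius \<open>r\<close>
    they lead into radius \<open>3 * r\<close>, where the partial derivatives are known to be
    continuous, and from there into \<open>U\<close>.\<close>
  have main: "(\<forall>u\<in>ball u0 r. \<forall>i. continuous (at u) (partial_deriv i g)) \<and>
     (\<forall>i. (partial_deriv i g has_derivative (\<lambda>h. \<Sum>j\<in>UNIV. integral {0..1} (\<lambda>t. partial_deriv j g (u0 + axis i (circlepath 0 r t)) / circlepath 0 r t) * h $ j)) (at u0))"
    if r: "r > 0" "ball u0 (4 * r) \<subseteq> U" for u0 r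
  proof -
    have inU: "u + axis i z \<in> U" if "u \<in> ball u0 (3*r)" "norm z \<le> r" for u z i
    proof -
      have "dist u0 (u + axis i z) \<le> dist u0 u + norm z"
        using norm_triangle_ineq4[of "u0 - u" "axis i z"] by (simp add: dist_norm norm_axis_complex diff_diff_eq)
      then show ?thesis using that r by (auto intro!: set_mp[OF r(2)])
    qed
    have cauchy: "partial_deriv i g u = integral {0..1} (\<lambda>t. g (u + axis i (circlepath 0 r t)) / circlepath 0 r t)"
      if "u \<in> ball u0 (3*r)" for u i
      by (rule partial_deriv_Cauchy[OF g r(1)]) (use inU that in auto)
    have ncirc: "norm (circlepath 0 r t) = r" "circlepath 0 r t \<noteq> 0" for t
      using r by (auto simp: circlepath norm_mult)
    have ccirc: "continuous_on S (\<lambda>p. circlepath 0 r (snd p))" for S :: "('b::topological_space \<times> real) set"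
      unfolding circlepath by (intro continuous_intros)
    have cont_comp: "continuous_on (ball u0 s \<times> {0..1}) (\<lambda>(u,t). f (u + axis i (circlepath 0 r t)) / circlepath 0 r t)"
      if f: "continuous_on V f" and V: "\<And>u z. u \<in> ball u0 s \<Longrightarrow> norm z \<le> r \<Longrightarrow> u + axis i z \<in> V" for f :: "complex^3 \<Rightarrow> complex" and s V i
      unfolding split_beta
      by (intro continuous_intros ccirc continuous_on_compose2[OF f] bounded_linear.continuous_on[OF bounded_linear_axis])
         (use ncirc V in auto)
    have cont: "continuous_on (ball u0 (3*r)) (partial_deriv i g)" for i
    proof -
      have "continuous_on (ball u0 (3*r)) (\<lambda>u. integral (cbox 0 1) (\<lambda>t. g (u + axis i (circlepath 0 r t)) / circlepath 0 r t))"
        by (rule integral_continuous_on_param) (use cont_comp[OF hol3_continuous_on[OF g] inU] in auto)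
      then show ?thesis
      proof (rule continuous_on_eq)
        fix u assume "u \<in> ball u0 (3*r)"
        from cauchy[OF this, of i]
        show "integral (cbox 0 1) (\<lambda>t. g (u + axis i (circlepath 0 r t)) / circlepath 0 r t) = partial_deriv i g u"
          by simp
      qed
    qed
    have cat: "continuous (at u) (partial_deriv i g)" if "u \<in> ball u0 r" for u i
      using cont[of i] that r by (simp add: continuous_on_eq_continuous_at)
    have in3: "u + axis i z \<in> ball u0 (3*r)" if "u \<in> ball u0 r" "norm z \<le> r" for u z i
    proof -
      have "dist u0 (u + axis i z) \<le> dist u0 u + norm z"
        using norm_triangle_ineq4[of "u0 - u" "axis i z"] by (simp add: dist_norm norm_axis_complex diff_diff_eq)
      then show ?thesis using that r by auto
    qed
    have bl: "bounded_linear (\<lambda>h::complex^3. h $ j)" for j by (rule bounded_linear_vec_nth)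
    \<comment> \<open>The derivative of the integrand in \<open>u\<close>, as a bounded linear map
      because \<open>leibniz_rule\<close> integrates it in this form.\<close>
    define fx where "fx = (\<lambda>i (u::complex^3) t. \<Sum>j\<in>UNIV. blinfun_compose (blinfun_mult_right (partial_deriv j g (u + axis i (circlepath 0 r t)) / circlepath 0 r t)) (Blinfun (\<lambda>h::complex^3. h $ j)))"
    have fx_apply: "blinfun_apply (fx i u t) = (\<lambda>h. \<Sum>j\<in>UNIV. partial_deriv j g (u + axis i (circlepath 0 r t)) / circlepath 0 r t * h $ j)" for i u t
      by (rule ext) (simp add: fx_def blinfun.sum_left bounded_linear_Blinfun_apply[OF bl])
    have cpd: "continuous_on (ball u0 r \<times> {0..1}) (\<lambda>(u,t). partial_deriv j g (u + axis i (circlepath 0 r t)) / circlepath 0 r t)" for i j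
      by (rule cont_comp[OF cont in3])
    have cfx: "continuous_on (ball u0 r \<times> {0..1}) (\<lambda>(u,t). fx i u t)" for i
      unfolding fx_def split_beta
      by (intro continuous_intros bounded_linear.continuous_on[OF bounded_linear_blinfun_mult_right] cpd[unfolded split_beta])
    have "(partial_deriv i g has_derivative (\<lambda>h. \<Sum>j\<in>UNIV. integral {0..1} (\<lambda>t. partial_deriv j g (u0 + axis i (circlepath 0 r t)) / circlepath 0 r t) * h $ j)) (at u0)" for i
    proof -
      have "((\<lambda>u. integral (cbox 0 1) (\<lambda>t. g (u + axis i (circlepath 0 r t)) / circlepath 0 r t)) has_derivative integral (cbox 0 1) (fx i u0)) (at u0 within ball u0 r)"
      proof (rule leibniz_rule[where fx = "fx i" and f = "\<lambda>u t. g (u + axis i (circlepath 0 r t)) / circlepath 0 r t"])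
        fix u t assume u: "u \<in> ball u0 r"
        have gd: "(g has_derivative (\<lambda>h. \<Sum>j\<in>UNIV. partial_deriv j g (u + axis i (circlepath 0 r t)) * h $ j)) (at (u + axis i (circlepath 0 r t)))"
          by (rule hol3_has_derivative[OF g]) (use u r ncirc inU in auto)
        have sh: "((\<lambda>u. u + axis i (circlepath 0 r t)) has_derivative (\<lambda>h. h)) (at u)"
          using has_derivative_add[OF has_derivative_ident has_derivative_const] by simp
        have "((\<lambda>u. g (u + axis i (circlepath 0 r t))) has_derivative (\<lambda>h. \<Sum>j\<in>UNIV. partial_deriv j g (u + axis i (circlepath 0 r t)) * h $ j)) (at u)"
          using has_derivative_compose[where f = "\<lambda>u. u + axis i (circlepath 0 r t)" and f' = "\<lambda>h. h" and x = u and s = UNIV and g = g, OF sh gd] .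
        then have "((\<lambda>u. g (u + axis i (circlepath 0 r t)) * inverse (circlepath 0 r t)) has_derivative (\<lambda>h. (\<Sum>j\<in>UNIV. partial_deriv j g (u + axis i (circlepath 0 r t)) * h $ j) * inverse (circlepath 0 r t))) (at u)"
          by (rule has_derivative_mult_left)
        then have "((\<lambda>u. g (u + axis i (circlepath 0 r t)) / circlepath 0 r t) has_derivative blinfun_apply (fx i u t)) (at u)"
          unfolding fx_apply divide_inverse sum_distrib_right by (simp only: mult.assoc mult.commute[of _ "inverse _"] mult.left_commute[of _ "inverse _"])
        then show "((\<lambda>u. g (u + axis i (circlepath 0 r t)) / circlepath 0 r t) has_derivative blinfun_apply (fx i u t)) (at u within ball u0 r)"
          by (rule has_derivative_at_withinI)
      next
        fix u assume u: "u \<in> ball u0 r"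
        have "continuous_on {0..1} (\<lambda>t. g (u + axis i (circlepath 0 r t)) / circlepath 0 r t)"
        proof -
          have "continuous_on (ball u0 (3*r) \<times> {0..1}) (\<lambda>(u,t). g (u + axis i (circlepath 0 r t)) / circlepath 0 r t)"
            by (rule cont_comp[OF hol3_continuous_on[OF g] inU])
          then show ?thesis
            by (rule continuous_on_slice[where f = "\<lambda>u t. g (u + axis i (circlepath 0 r t)) / circlepath 0 r t" and u = u])
              (use u r in simp)
        qed
        then show "(\<lambda>t. g (u + axis i (circlepath 0 r t)) / circlepath 0 r t) integrable_on cbox 0 1"
          by (simp add: integrable_continuous_interval)
      next
        show "continuous_on (ball u0 r \<times> cbox 0 1) (\<lambda>(u,t). fx i u t)" using cfx by simp
      qed (use r in simp_all)
      moreover have "at u0 within ball u0 r = at u0" by (rule at_within_open) (use r(1) in simp_all)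
      moreover have "blinfun_apply (integral (cbox 0 1) (fx i u0)) = (\<lambda>h. \<Sum>j\<in>UNIV. integral {0..1} (\<lambda>t. partial_deriv j g (u0 + axis i (circlepath 0 r t)) / circlepath 0 r t) * h $ j)"
      proof
        fix h
        have int: "(\<lambda>t. fx i u0 t) integrable_on cbox 0 1"
          unfolding cbox_interval
          by (rule integrable_continuous_interval, rule continuous_on_slice[where f = "fx i" and u = u0], rule cfx)
            (use r in simp)
        have int2: "(\<lambda>t. partial_deriv j g (u0 + axis i (circlepath 0 r t)) / circlepath 0 r t) integrable_on {0..1}" for j
          by (rule integrable_continuous_interval,
              rule continuous_on_slice[where f = "\<lambda>u t. partial_deriv j g (u + axis i (circlepath 0 r t)) / circlepath 0 r t" and u = u0],
              rule cpd) (use r in simp)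
        have "blinfun_apply (integral (cbox 0 1) (fx i u0)) h = integral (cbox 0 1) (\<lambda>t. blinfun_apply (fx i u0 t) h)"
          by (rule blinfun_apply_integral[OF int])
        also have "\<dots> = (\<Sum>j\<in>UNIV. integral {0..1} (\<lambda>t. partial_deriv j g (u0 + axis i (circlepath 0 r t)) / circlepath 0 r t * h $ j))"
          unfolding fx_apply cbox_interval by (rule integral_sum[OF finite integrable_on_mult_left[OF int2]])
        finally show "blinfun_apply (integral (cbox 0 1) (fx i u0)) h = (\<Sum>j\<in>UNIV. integral {0..1} (\<lambda>t. partial_deriv j g (u0 + axis i (circlepath 0 r t)) / circlepath 0 r t) * h $ j)"
          by (simp only: integral_mult_left)
      qed
      ultimately have "((\<lambda>u. integral (cbox 0 1) (\<lambda>t. g (u + axis i (circlepath 0 r t)) / circlepath 0 r t)) has_derivative (\<lambda>h. \<Sum>j\<in>UNIV. integral {0..1} (\<lambda>t. partial_deriv j g (u0 + axis i (circlepath 0 r t)) / circlepath 0 r t) * h $ j)) (at u0)"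
        by simp
      then show ?thesis
        by (rule has_derivative_transform_within_open[of _ _ _ _ "ball u0 r"]) (use r cauchy in auto)
    qed
    then show ?thesis using cat by blast
  qed
  have ex: "\<exists>r>0. ball u (4 * r) \<subseteq> U" if "u \<in> U" for u
  proof -
    obtain e where "e > 0" "ball u e \<subseteq> U" using U \<open>u \<in> U\<close> open_contains_ball by blast
    then show ?thesis by (intro exI[of _ "e/4"]) auto
  qed
  show hp: "hol3 U (partial_deriv i g)" for i
    unfolding hol3_def
  proof
    fix u assume "u \<in> U"
    then obtain r where r: "r > 0" "ball u (4 * r) \<subseteq> U" using ex by blast
    have "hol3 {u} (partial_deriv i g)"
      by (rule hol3I[where c = "\<lambda>j _. integral {0..1} (\<lambda>t. partial_deriv j g (u + axis i (circlepath 0 r t)) / circlepath 0 r t)"])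
        (simp only: singleton_iff, use main[OF r] in blast)
    then show "\<exists>D. (partial_deriv i g has_derivative D) (at u) \<and> complex_linear_form D"
      unfolding hol3_def by blast
  qed
  show "partial_deriv j (partial_deriv i g) u = partial_deriv i (partial_deriv j g) u" if u: "u \<in> U"
  proof -
    obtain r where r: "r > 0" "ball u (4 * r) \<subseteq> U" using ex u by blast
    let ?c = "\<lambda>j. integral {0..1} (\<lambda>t. partial_deriv j g (u + axis i (circlepath 0 r t)) / circlepath 0 r t)"
    have "(partial_deriv i g has_derivative (\<lambda>h. \<Sum>j\<in>UNIV. ?c j * h $ j)) (at u)"
      using main[OF r] by blast
    moreover have "complex_linear_form (\<lambda>h. \<Sum>j\<in>UNIV. ?c j * h $ j)"
      by (auto simp: complex_linear_form_def sum.distrib sum_distrib_left algebra_simps)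
    ultimately have "haspd j (partial_deriv i g) (\<Sum>k\<in>UNIV. ?c k * (axis j 1 :: complex^3) $ k) u"
      by (rule has_derivative_haspd)
    then have "partial_deriv j (partial_deriv i g) u = (\<Sum>k\<in>UNIV. ?c k * (axis j 1 :: complex^3) $ k)"
      by (rule haspd_imp_eq)
    also have "\<dots> = ?c j" by (simp add: axis_def if_distrib cong: if_cong)
    also have "\<dots> = partial_deriv i (partial_deriv j g) u"
    proof (rule partial_deriv_Cauchy[OF hp r(1), symmetric])
      fix z :: complex assume "norm z \<le> r"
      then have "u + axis i z \<in> ball u (4 * r)" using r(1) by (simp add: dist_norm norm_axis_complex)
      then show "u + axis i z \<in> U" using r by blast
    qed
    finally show ?thesis .
  qed
qed

section \<open>Rules for partial derivatives, closure properties and the identity theorem\<close>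

lemma haspd_const: "haspd i (\<lambda>_. c) 0 u"
  unfolding haspd_def by (rule DERIV_const)

lemma haspd_add: "haspd i f D u \<Longrightarrow> haspd i g E u \<Longrightarrow> haspd i (\<lambda>v. f v + g v) (D + E) u"
  unfolding haspd_def by (rule DERIV_add)

lemma haspd_diff: "haspd i f D u \<Longrightarrow> haspd i g E u \<Longrightarrow> haspd i (\<lambda>v. f v - g v) (D - E) u"
  unfolding haspd_def by (rule DERIV_diff)

lemma haspd_minus: "haspd i f D u \<Longrightarrow> haspd i (\<lambda>v. - f v) (- D) u"
  unfolding haspd_def by (rule DERIV_minus)

lemma haspd_mult: "haspd i f D u \<Longrightarrow> haspd i g E u \<Longrightarrow> haspd i (\<lambda>v. f v * g v) (D * g u + f u * E) u"
  unfolding haspd_def by (drule (1) DERIV_mult) (simp add: mult.commute)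

lemma haspd_power: "haspd i f D u \<Longrightarrow> haspd i (\<lambda>v. f v ^ n) (of_nat n * f u ^ (n - 1) * D) u"
  unfolding haspd_def by (drule DERIV_power[of _ _ _ _ n]) (simp add: mult_ac)

lemma haspd_divide_const: "haspd i f D u \<Longrightarrow> haspd i (\<lambda>v. f v / c) (D / c) u"
  unfolding haspd_def by (rule DERIV_cdivide)

lemma haspd_divide:
  "haspd i f D u \<Longrightarrow> haspd i g E u \<Longrightarrow> g u \<noteq> 0 \<Longrightarrow>
    haspd i (\<lambda>v. f v / g v) ((D * g u - f u * E) / (g u * g u)) u"
  unfolding haspd_def by (drule (1) DERIV_divide) auto

lemmas haspd_intros = haspd_const haspd_add haspd_diff haspd_minus haspd_mult haspd_power
  haspd_divide_const

lemma haspd_cong: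
  assumes "open U" "u \<in> U" "\<And>v. v \<in> U \<Longrightarrow> f v = g v" "haspd i f D u"
  shows "haspd i g D u"
proof -
  have "continuous_on UNIV (\<lambda>z. u + axis i z)"
    by (intro continuous_intros bounded_linear.continuous_on[OF bounded_linear_axis])
  then have "open ((\<lambda>z. u + axis i z) -` U)"
    using assms(1) by (simp add: continuous_on_open_vimage)
  moreover have "0 \<in> (\<lambda>z. u + axis i z) -` U"
    using assms(2) by simp
  ultimately have "\<forall>\<^sub>F z in nhds 0. z \<in> (\<lambda>z. u + axis i z) -` U"
    by (rule eventually_nhds_in_open)
  then have "\<forall>\<^sub>F z in nhds 0. f (u + axis i z) = g (u + axis i z)"
    by (rule eventually_mono) (use assms(3) in auto)
  then show ?thesis
    using assms(4) unfolding haspd_def by (subst (asm) DERIV_cong_ev) auto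
qed

lemma partial_deriv_eqI:
  assumes "open U" "u \<in> U" "\<And>v. v \<in> U \<Longrightarrow> f v = g v" "haspd i g D u"
  shows "partial_deriv i f u = D"
  by (rule haspd_imp_eq, rule haspd_cong[OF assms(1,2) assms(3)[symmetric] assms(4)])

lemma hol3_add: "hol3 U f \<Longrightarrow> hol3 U g \<Longrightarrow> hol3 U (\<lambda>u. f u + g u)"
  by (rule hol3I[where c = "\<lambda>j u. partial_deriv j f u + partial_deriv j g u"])
    (auto intro!: derivative_eq_intros hol3_has_derivative simp: sum.distrib distrib_right)

lemma hol3_const: "hol3 U (\<lambda>u. c)"
  by (rule hol3I[where c = "\<lambda>j u. 0"]) auto

lemma hol3_mult: "hol3 U f \<Longrightarrow> hol3 U g \<Longrightarrow> hol3 U (\<lambda>u. f u * g u)"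
  by (rule hol3I[where c = "\<lambda>j u. f u * partial_deriv j g u + partial_deriv j f u * g u"])
    (auto intro!: derivative_eq_intros hol3_has_derivative
      simp: sum.distrib ring_distribs sum_distrib_left sum_distrib_right mult_ac)

lemma hol3_inverse: "hol3 U f \<Longrightarrow> (\<And>u. u \<in> U \<Longrightarrow> f u \<noteq> 0) \<Longrightarrow> hol3 U (\<lambda>u. inverse (f u))"
  by (rule hol3I[where c = "\<lambda>j u. - (inverse (f u) * partial_deriv j f u * inverse (f u))"])
    (auto intro!: derivative_eq_intros hol3_has_derivative
      simp: sum_distrib_left sum_distrib_right sum_negf mult_ac)

lemma hol3_power: "hol3 U f \<Longrightarrow> hol3 U (\<lambda>u. f u ^ n)"
  by (induction n) (auto intro: hol3_const hol3_mult)

lemma hol3_minus: "hol3 U f \<Longrightarrow> hol3 U (\<lambda>u. - f u)"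
  using hol3_mult[OF hol3_const[of U "-1"], of f] by simp

lemma hol3_diff: "hol3 U f \<Longrightarrow> hol3 U g \<Longrightarrow> hol3 U (\<lambda>u. f u - g u)"
  using hol3_add[of U f "\<lambda>u. - g u"] hol3_minus[of U g] by simp

lemma hol3_divide: "hol3 U f \<Longrightarrow> hol3 U g \<Longrightarrow> (\<And>u. u \<in> U \<Longrightarrow> g u \<noteq> 0) \<Longrightarrow> hol3 U (\<lambda>u. f u / g u)"
  unfolding divide_inverse by (intro hol3_mult hol3_inverse)

lemma hol3_cong:
  assumes "open U" "\<And>u. u \<in> U \<Longrightarrow> f u = g u" "hol3 U f"
  shows "hol3 U g"
proof -
  have "\<exists>D. (g has_derivative D) (at u) \<and> complex_linear_form D" if u: "u \<in> U" for u
  proof -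
    obtain D where D: "(f has_derivative D) (at u)" "complex_linear_form D"
      using assms(3) u unfolding hol3_def by blast
    have "(g has_derivative D) (at u)"
      by (rule has_derivative_transform_within_open[OF D(1) assms(1) u]) (use assms(2) in auto)
    with D(2) show ?thesis by blast
  qed
  then show ?thesis unfolding hol3_def by blast
qed

lemma entire3_hol3: "entire3 g \<longleftrightarrow> hol3 UNIV g"
  by (simp add: entire3_def hol3_def)

lemma has_derivative_curve:
  fixes c :: "complex \<Rightarrow> complex ^ 3"
  assumes "\<And>j. ((\<lambda>t. c t $ j) has_field_derivative c' j) (at t)"
  shows "(c has_derivative (\<lambda>h. \<chi> j. c' j * h)) (at t)"
    by (subst has_derivative_componentwise_within)
      (use assms in \<open>auto simp: has_field_derivative_def Basis_vec_def inner_axis intro!: derivative_eq_intros has_derivative_inner_left\<close>)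

lemma hol3_DERIV_curve:
  assumes "hol3 U g" "c t \<in> U" "\<And>j. ((\<lambda>t. c t $ j) has_field_derivative c' j) (at t)"
  shows "((\<lambda>t. g (c t)) has_field_derivative (\<Sum>j\<in>UNIV. partial_deriv j g (c t) * c' j)) (at t)"
proof -
  have 1: "(c has_derivative (\<lambda>h. \<chi> j. c' j * h)) (at t)"
    by (rule has_derivative_curve) (rule assms(3))
  have 2: "(g has_derivative (\<lambda>h. \<Sum>j\<in>UNIV. partial_deriv j g (c t) * h $ j)) (at (c t))"
    by (rule hol3_has_derivative[OF assms(1,2)])
  have "((\<lambda>t. g (c t)) has_derivative (\<lambda>h. \<Sum>j\<in>UNIV. partial_deriv j g (c t) * (\<chi> j. c' j * h) $ j)) (at t)"
    using has_derivative_compose[where f = c and f' = "\<lambda>h. \<chi> j. c' j * h" and x = t and s = UNIV and g = g, OF 1 2] .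
  moreover have "(\<lambda>h. \<Sum>j\<in>UNIV. partial_deriv j g (c t) * (\<chi> j. c' j * h) $ j) = (*) (\<Sum>j\<in>UNIV. partial_deriv j g (c t) * c' j)"
    by (auto simp: sum_distrib_left sum_distrib_right mult_ac)
  ultimately show ?thesis by (simp add: has_field_derivative_def)
qed

text \<open>Restriction to the complex line through a point of \<open>V\<close> and \<open>w\<close>
  reduces this to the identity theorem in one variable.\<close>

lemma entire3_eq_0:
  assumes N: "entire3 N" and V: "open V" "V \<noteq> {}" "\<And>u. u \<in> V \<Longrightarrow> N u = 0"
  shows "N w = 0"
proof -
  obtain u0 where u0: "u0 \<in> V" using V by blast
  define c where "c = (\<lambda>z::complex. u0 + z *s (w - u0))"
  have cj: "((\<lambda>t. c t $ j) has_field_derivative (w - u0) $ j) (at t)" for j t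
    unfolding c_def by (auto intro!: derivative_eq_intros)
  have d: "((\<lambda>t. N (c t)) has_field_derivative (\<Sum>j\<in>UNIV. partial_deriv j N (c t) * (w - u0) $ j)) (at t)" for t
    by (rule hol3_DERIV_curve[OF N[unfolded entire3_hol3] _ cj]) simp
  then have hol: "(\<lambda>t. N (c t)) holomorphic_on UNIV"
    by (auto simp: holomorphic_on_open)
  have "continuous_on UNIV c"
    using has_derivative_curve[OF cj] has_derivative_continuous by (blast intro: continuous_at_imp_continuous_on)
  then have op: "open (c -` V)" using V(1) by (simp add: continuous_on_open_vimage)
  have "N (c 1) = 0"
  proof (rule analytic_continuation_open[OF op open_UNIV _ connected_UNIV _ hol, of "\<lambda>_. 0"])
    show "c -` V \<noteq> {}" 
    proof -
      have "0 \<in> c -` V" using u0 by (simp add: c_def)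
      then show ?thesis by blast
    qed
  qed (use V in auto)
  then show ?thesis by (simp add: c_def)
qed

text \<open>Meromorphic functions on \<open>\<complex>\<^sup>3\<close> with poles only along the zero set of \<open>\<sigma>\<close>.\<close>

definition mero3 :: "(complex ^ 3 \<Rightarrow> complex) \<Rightarrow> (complex ^ 3 \<Rightarrow> complex) \<Rightarrow> bool" where
  "mero3 \<sigma> g \<longleftrightarrow> (\<exists>k N. entire3 N \<and> (\<forall>u. \<sigma> u \<noteq> 0 \<longrightarrow> g u * \<sigma> u ^ k = N u))"

lemma mero3_entire: "entire3 N \<Longrightarrow> mero3 \<sigma> N"
  unfolding mero3_def by (intro exI[of _ 0] exI[of _ N]) auto

lemma mero3_const: "mero3 \<sigma> (\<lambda>_. c)"
  by (rule mero3_entire) (simp add: entire3_hol3 hol3_const)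

lemma mero3_mult:
  assumes "mero3 \<sigma> f" "mero3 \<sigma> g"
  shows "mero3 \<sigma> (\<lambda>u. f u * g u)"
proof -
  obtain k N l M where "entire3 N" "\<And>u. \<sigma> u \<noteq> 0 \<Longrightarrow> f u * \<sigma> u ^ k = N u"
    "entire3 M" "\<And>u. \<sigma> u \<noteq> 0 \<Longrightarrow> g u * \<sigma> u ^ l = M u"
    using assms unfolding mero3_def by blast
  then show ?thesis
    unfolding mero3_def
    by (intro exI[of _ "k + l"] exI[of _ "\<lambda>u. N u * M u"])
      (auto simp: entire3_hol3 power_add intro!: hol3_mult, simp add: mult_ac)
qed

context
  fixes \<sigma> :: "complex ^ 3 \<Rightarrow> complex"
  assumes ent: "entire3 \<sigma>"
begin

lemma mero3_add:
  assumes "mero3 \<sigma> f" "mero3 \<sigma> g"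
  shows "mero3 \<sigma> (\<lambda>u. f u + g u)"
proof -
  obtain k N l M where "entire3 N" "\<And>u. \<sigma> u \<noteq> 0 \<Longrightarrow> f u * \<sigma> u ^ k = N u"
    "entire3 M" "\<And>u. \<sigma> u \<noteq> 0 \<Longrightarrow> g u * \<sigma> u ^ l = M u"
    using assms unfolding mero3_def by blast
  note * = this
  have "entire3 (\<lambda>u. N u * \<sigma> u ^ l + M u * \<sigma> u ^ k)"
    using * ent unfolding entire3_hol3 by (intro hol3_mult hol3_add hol3_power)
  moreover have "(f u + g u) * \<sigma> u ^ (k + l) = N u * \<sigma> u ^ l + M u * \<sigma> u ^ k" if "\<sigma> u \<noteq> 0" for u
    by (simp add: power_add algebra_simps flip: *(2)[OF that] *(4)[OF that])
  ultimately show ?thesis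
    unfolding mero3_def by blast
qed

lemma mero3_minus: "mero3 \<sigma> f \<Longrightarrow> mero3 \<sigma> (\<lambda>u. - f u)"
  using mero3_mult[OF mero3_const[of \<sigma> "-1"], of f] by simp

lemma mero3_diff: "mero3 \<sigma> f \<Longrightarrow> mero3 \<sigma> g \<Longrightarrow> mero3 \<sigma> (\<lambda>u. f u - g u)"
  using mero3_add[OF _ mero3_minus, of f g] by simp

lemma mero3_power: "mero3 \<sigma> f \<Longrightarrow> mero3 \<sigma> (\<lambda>u. f u ^ n)"
  by (induction n) (auto intro: mero3_const mero3_mult)

lemma mero3_divide_const: "mero3 \<sigma> f \<Longrightarrow> mero3 \<sigma> (\<lambda>u. f u / c)"
  using mero3_mult[OF _ mero3_const[of \<sigma> "inverse c"], of f] by (simp add: divide_inverse)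

lemma open_sigma_nz: "open {u. \<sigma> u \<noteq> 0}"
proof -
  have "continuous_on UNIV \<sigma>" using hol3_continuous_on ent[unfolded entire3_hol3] by blast
  then show ?thesis by (intro open_Collect_neq) auto
qed

lemma mero3_hol3:
  assumes "mero3 \<sigma> g"
  shows "hol3 {u. \<sigma> u \<noteq> 0} g"
proof -
  obtain k N where N: "entire3 N" "\<And>u. \<sigma> u \<noteq> 0 \<Longrightarrow> g u * \<sigma> u ^ k = N u"
    using assms unfolding mero3_def by blast
  have "hol3 {u. \<sigma> u \<noteq> 0} (\<lambda>u. N u / \<sigma> u ^ k)"
    using N(1) ent by (intro hol3_divide hol3_power) (auto simp: entire3_hol3 intro: hol3_subset)
  then show ?thesis
    by (rule hol3_cong[OF open_sigma_nz, rotated]) (use N(2) in \<open>auto simp: field_simps\<close>)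
qed

lemma mero3_haspd: "mero3 \<sigma> g \<Longrightarrow> \<sigma> u \<noteq> 0 \<Longrightarrow> haspd i g (partial_deriv i g u) u"
  by (rule hol3_haspd[OF mero3_hol3]) auto

text \<open>Differentiate g \<sigma>^k = N and multiply by \<sigma>: the pole order grows by at most
  one and the new numerator is again entire.\<close>

lemma mero3_partial_deriv:
  assumes "mero3 \<sigma> g"
  shows "mero3 \<sigma> (partial_deriv i g)"
proof -
  obtain k N where N: "entire3 N" "\<And>u. \<sigma> u \<noteq> 0 \<Longrightarrow> g u * \<sigma> u ^ k = N u"
    using assms unfolding mero3_def by blast
  have "partial_deriv i g u * \<sigma> u ^ Suc k = \<sigma> u * partial_deriv i N u - of_nat k * N u * partial_deriv i \<sigma> u"
    if u: "\<sigma> u \<noteq> 0" for u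
  proof -
    have "haspd i (\<lambda>u. g u * \<sigma> u ^ k) (partial_deriv i g u * \<sigma> u ^ k + g u * (of_nat k * \<sigma> u ^ (k - 1) * partial_deriv i \<sigma> u)) u"
      using ent by (intro haspd_mult haspd_power mero3_haspd[OF assms u] hol3_haspd[of UNIV]) (auto simp: entire3_hol3)
    then have "haspd i N (partial_deriv i g u * \<sigma> u ^ k + g u * (of_nat k * \<sigma> u ^ (k - 1) * partial_deriv i \<sigma> u)) u"
      by (rule haspd_cong[OF open_sigma_nz, rotated 2]) (use u N in auto)
    then have "partial_deriv i N u = partial_deriv i g u * \<sigma> u ^ k + g u * (of_nat k * \<sigma> u ^ (k - 1) * partial_deriv i \<sigma> u)"
      by (rule haspd_imp_eq)
    then show ?thesis using N(2)[OF u, symmetric] by (cases k) (auto simp: algebra_simps)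
  qed
  moreover have "entire3 (\<lambda>u. \<sigma> u * partial_deriv i N u - of_nat k * N u * partial_deriv i \<sigma> u)"
    using ent N(1) unfolding entire3_hol3
    by (intro hol3_diff hol3_mult hol3_const hol3_partial_deriv open_UNIV)
  ultimately show ?thesis unfolding mero3_def by blast
qed

lemma mero3_partial_deriv_commute:
  "mero3 \<sigma> g \<Longrightarrow> \<sigma> u \<noteq> 0 \<Longrightarrow>
    partial_deriv j (partial_deriv i g) u = partial_deriv i (partial_deriv j g) u"
  by (rule partial_deriv_commute[OF mero3_hol3 open_sigma_nz]) auto

text \<open>Clearing denominators moves the question from the complement of the zero set of \<sigma>
  to an entire function on the connected space C^3.\<close>

lemma mero3_zero:
  assumes g: "mero3 \<sigma> g" and V: "open V" "V \<noteq> {}" "\<And>u. u \<in> V \<Longrightarrow> \<sigma> u \<noteq> 0 \<Longrightarrow> g u = 0"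
    and u: "\<sigma> u \<noteq> 0"
  shows "g u = 0"
proof -
  obtain k N where N: "entire3 N" "\<And>u. \<sigma> u \<noteq> 0 \<Longrightarrow> g u * \<sigma> u ^ k = N u"
    using g unfolding mero3_def by blast
  \<comment> \<open>The extra factor takes care of the points of \<open>V\<close> with \<sigma> = 0,
    where nothing is known about \<open>N\<close>.\<close>
  have "entire3 (\<lambda>u. N u * \<sigma> u)"
    using N ent by (auto simp: entire3_hol3 intro: hol3_mult)
  then have "N u * \<sigma> u = 0"
  proof (rule entire3_eq_0[OF _ V(1,2)])
    fix v assume "v \<in> V"
    then show "N v * \<sigma> v = 0" using N(2)[of v] V(3)[of v] by (cases "\<sigma> v = 0") auto
  qed
  then show ?thesis using N(2)[OF u] u by auto
qed

text \<open>There are no zero divisors: \<open>g\<close> vanishes on the nonempty open set where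
  \<open>f\<close> does not, hence everywhere. An identity may thus be divided by a function that is
  merely not identically zero.\<close>

lemma mero3_mult_zero:
  assumes f: "mero3 \<sigma> f" and g: "mero3 \<sigma> g" and fg: "\<And>u. \<sigma> u \<noteq> 0 \<Longrightarrow> f u * g u = 0"
    and nz: "\<sigma> v \<noteq> 0" "f v \<noteq> 0" and u: "\<sigma> u \<noteq> 0"
  shows "g u = 0"
proof (rule mero3_zero[OF g])
  show "open ({u. \<sigma> u \<noteq> 0} \<inter> f -` (- {0}))"
    by (rule continuous_open_preimage[OF hol3_continuous_on[OF mero3_hol3[OF f]] open_sigma_nz]) auto
  show "{u. \<sigma> u \<noteq> 0} \<inter> f -` (- {0}) \<noteq> {}" using nz by blast
qed (use fg u in auto)

lemma partial_deriv_parity: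
  assumes g: "mero3 \<sigma> g" and par: "\<And>v. \<sigma> v \<noteq> 0 \<Longrightarrow> g (- v) = s * g v"
    and sym: "\<And>v. \<sigma> (- v) = 0 \<longleftrightarrow> \<sigma> v = 0" and u: "\<sigma> u \<noteq> 0"
  shows "partial_deriv i g (- u) = - s * partial_deriv i g u"
proof (rule partial_deriv_eqI[OF open_sigma_nz])
  show "- u \<in> {u. \<sigma> u \<noteq> 0}" using u sym by auto
  show "g v = s * g (- v)" if "v \<in> {u. \<sigma> u \<noteq> 0}" for v
    using par[of "- v"] that sym by auto
  have "((\<lambda>z. g (u + axis i z)) has_field_derivative partial_deriv i g u) (at (- 0))"
    using mero3_haspd[OF g u] by (simp add: haspd_def)
  then have "((\<lambda>z. g (u + axis i (- z))) has_field_derivative - partial_deriv i g u) (at 0)"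
    using DERIV_chain2[where f = "\<lambda>z. g (u + axis i z)" and g = uminus and x = 0 and s = UNIV and Db = "-1"]
      DERIV_minus[OF DERIV_ident, of 0 UNIV] by auto
  moreover have "axis i (- z) = - axis i z" for z :: complex
    by (simp add: axis_def vec_eq_iff)
  ultimately have "haspd i (\<lambda>v. g (- v)) (- partial_deriv i g u) (- u)"
    by (simp add: haspd_def)
  from haspd_mult[OF haspd_const this, of s]
  show "haspd i (\<lambda>v. s * g (- v)) (- s * partial_deriv i g u) (- u)" by simp
qed

end

section \<open>Logarithmic derivatives of the sigma function\<close>

locale sigma_curve =
  fixes l0 l1 l2 l3 :: complex and \<sigma> :: "complex ^ 3 \<Rightarrow> complex"
  assumes is_sigma: "is_sigma_function [:l0, l1, l2, l3, 1:] \<sigma>"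
begin

lemma ent: "entire3 \<sigma>" and odd_sigma: "\<sigma> (- u) = - \<sigma> u"
  using is_sigma by (auto simp: is_sigma_function_def)

lemma sigma_minus_nz [simp]: "\<sigma> (- u) = 0 \<longleftrightarrow> \<sigma> u = 0"
  by (simp add: odd_sigma)

text \<open>Iterated derivatives of -log \<sigma>, indexed by lists so that any number of indices is
  handled by one induction. The empty list would be the multi-valued logarithm itself; its value 0
  is a dummy, whence the conditions \<open>js \<noteq> []\<close>.\<close>

fun wps :: "3 list \<Rightarrow> complex ^ 3 \<Rightarrow> complex" where
  "wps [] = (\<lambda>u. 0)"
| "wps [j] = (\<lambda>u. - (partial_deriv j \<sigma> u / \<sigma> u))"
| "wps (i # j # js) = partial_deriv i (wps (j # js))"

lemma mero3_wps: "mero3 \<sigma> (wps js)"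
proof (induction js rule: wps.induct)
  case (2 j)
  have "entire3 (\<lambda>u. - partial_deriv j \<sigma> u)"
    using ent unfolding entire3_hol3 by (intro hol3_minus hol3_partial_deriv open_UNIV)
  then show ?case
    unfolding mero3_def by (intro exI[of _ 1] exI[of _ "\<lambda>u. - partial_deriv j \<sigma> u"]) auto
qed (auto intro: mero3_const mero3_partial_deriv[OF ent])

lemma wps_cons: "js \<noteq> [] \<Longrightarrow> wps (i # js) = partial_deriv i (wps js)"
  by (cases js) auto

declare wps.simps [simp del]

lemma haspd_wps: "\<sigma> u \<noteq> 0 \<Longrightarrow> js \<noteq> [] \<Longrightarrow> haspd i (wps js) (wps (i # js) u) u"
  using mero3_haspd[OF ent mero3_wps[of js], of u i] by (simp add: wps_cons)

lemma haspd_sigma: "haspd i \<sigma> (partial_deriv i \<sigma> u) u"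
  using hol3_haspd[of UNIV] ent by (simp add: entire3_hol3)

lemma haspd_partial_sigma: "haspd i (partial_deriv j \<sigma>) (partial_deriv i (partial_deriv j \<sigma>) u) u"
  using hol3_haspd[OF hol3_partial_deriv[OF _ open_UNIV], of \<sigma>] ent by (simp add: entire3_hol3)

lemma partial_sigma_commute:
  "partial_deriv i (partial_deriv j \<sigma>) u = partial_deriv j (partial_deriv i \<sigma>) u"
  using partial_deriv_commute[OF _ open_UNIV] ent by (simp add: entire3_hol3)

lemma wps2_eq:
  assumes "\<sigma> u \<noteq> 0"
  shows "wps [i, j] u = (partial_deriv i \<sigma> u * partial_deriv j \<sigma> u - partial_deriv i (partial_deriv j \<sigma>) u * \<sigma> u) / (\<sigma> u)\<^sup>2"
proof -
  have "partial_deriv i (\<lambda>u. - (partial_deriv j \<sigma> u / \<sigma> u)) u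
     = - ((partial_deriv i (partial_deriv j \<sigma>) u * \<sigma> u - partial_deriv j \<sigma> u * partial_deriv i \<sigma> u) / (\<sigma> u * \<sigma> u))"
    by (intro haspd_imp_eq haspd_minus haspd_divide haspd_partial_sigma haspd_sigma assms)
  then show ?thesis by (simp only: wps.simps power2_eq_square minus_divide_left minus_diff_eq mult.commute)
qed

lemma wps_swap: "\<sigma> u \<noteq> 0 \<Longrightarrow> wps (i # j # js) u = wps (j # i # js) u"
proof (cases js)
  case Nil
  assume "\<sigma> u \<noteq> 0"
  then show ?thesis
    unfolding Nil wps2_eq[OF \<open>\<sigma> u \<noteq> 0\<close>] partial_sigma_commute[of i j u]
    by (simp only: mult.commute)
next
  case (Cons k ks)
  assume "\<sigma> u \<noteq> 0"
  then show ?thesis unfolding Cons using mero3_partial_deriv_commute[OF ent mero3_wps[of "k # ks"]] by (simp add: wps.simps)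
qed

lemma wps_cong:
  assumes "\<And>v. \<sigma> v \<noteq> 0 \<Longrightarrow> wps js v = wps ks v" "js \<noteq> []" "ks \<noteq> []" "\<sigma> u \<noteq> 0"
  shows "wps (i # js) u = wps (i # ks) u"
  unfolding wps_cons[OF assms(2)]
  by (rule partial_deriv_eqI[OF open_sigma_nz[OF ent] _ _ haspd_wps[OF assms(4,3)]])
    (use assms(1,4) in simp_all)

text \<open>Insertion sort only exchanges neighbours, each time by \<open>wps_swap\<close>, with
  \<open>wps_cong\<close> carrying the result under an outer derivative. So the value depends only
  on the multiset of indices.\<close>

lemma wps_insort: "\<sigma> u \<noteq> 0 \<Longrightarrow> wps (insort i js) u = wps (i # js) u"
proof (induction js arbitrary: u)
  case (Cons j js)
  show ?case
  proof (cases "i \<le> j")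
    case False
    have "wps (insort i (j # js)) u = wps (j # insort i js) u" using False by simp
    also have "\<dots> = wps (j # i # js) u"
      by (rule wps_cong[OF Cons.IH]) (use Cons.prems in \<open>simp_all add: insort_not_Nil\<close>)
    also have "\<dots> = wps (i # j # js) u" by (rule wps_swap[OF Cons.prems])
    finally show ?thesis .
  qed auto
qed auto

lemma wps_sort: "\<sigma> u \<noteq> 0 \<Longrightarrow> wps (sort js) u = wps js u"
proof (induction js arbitrary: u)
  case (Cons j js)
  show ?case
  proof (cases "js = []")
    case False
    have "wps (sort (j # js)) u = wps (j # sort js) u" using wps_insort[OF Cons.prems] by simp
    also have "\<dots> = wps (j # js) u"
      by (rule wps_cong[OF Cons.IH]) (use Cons.prems False in \<open>simp_all add: set_empty[symmetric] del: set_empty\<close>)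
    finally show ?thesis .
  qed auto
qed auto

lemma wps_perm: "mset js = mset ks \<Longrightarrow> \<sigma> u \<noteq> 0 \<Longrightarrow> wps js u = wps ks u"
  using properties_for_sort[of "sort js" ks] wps_sort[of u js] wps_sort[of u ks] by simp

lemma wp2_eq: "\<sigma> u \<noteq> 0 \<Longrightarrow> wp2 \<sigma> i j u = wps [i, j] u"
proof -
  assume u: "\<sigma> u \<noteq> 0"
  have "haspd i (\<lambda>u. partial_deriv j \<sigma> u / \<sigma> u) (- wps [i, j] u) u"
    using haspd_minus[OF haspd_wps[OF u, of "[j]" i]] by (simp add: wps.simps(2))
  from haspd_imp_eq[OF this] show ?thesis by (simp add: wp2_def)
qed

lemma wp3_eq: "\<sigma> u \<noteq> 0 \<Longrightarrow> wp3 \<sigma> i j k u = wps [i, j, k] u"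
  unfolding wp3_def
  by (rule partial_deriv_eqI[OF open_sigma_nz[OF ent] _ _ haspd_wps[of u "[j, k]"]]) (simp_all add: wp2_eq)

lemma wp4_eq: "\<sigma> u \<noteq> 0 \<Longrightarrow> wp4 \<sigma> i j k l u = wps [i, j, k, l] u"
  unfolding wp4_def
  by (rule partial_deriv_eqI[OF open_sigma_nz[OF ent] _ _ haspd_wps[of u "[j, k, l]"]]) (simp_all add: wp3_eq)

lemma wps_parity:
  "\<sigma> u \<noteq> 0 \<Longrightarrow> js \<noteq> [] \<Longrightarrow> wps js (- u) = (- 1) ^ length js * wps js u"
proof (induction js arbitrary: u rule: wps.induct)
  case (2 j)
  have "mero3 \<sigma> \<sigma>" using ent by (rule mero3_entire)
  with 2 have "partial_deriv j \<sigma> (- u) = partial_deriv j \<sigma> u"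
    using partial_deriv_parity[OF ent, of \<sigma> "-1" u j] by (simp add: odd_sigma)
  then show ?case by (simp add: odd_sigma wps.simps)
next
  case (3 i j js)
  then show ?case
    using partial_deriv_parity[OF ent mero3_wps[of "j # js"], of "(- 1) ^ length (j # js)" u i] by (simp add: wps.simps)
qed auto

text \<open>At the unit vector of the third axis every monomial containing u_1 or u_2 vanishes,
  which isolates the coefficient of u_3^n in the part of weight n.\<close>

lemma taylor_coeff_line: "n < 5 \<Longrightarrow> taylor_coeff \<sigma> 0 0 n = 0" "taylor_coeff \<sigma> 0 0 5 = 1 / 20"
proof -
  have fin: "finite {(a, b, c). 5 * a + 2 * b + c = (n::nat)}" for n
    by (rule finite_subset[of _ "{..n} \<times> {..n} \<times> {..n}"]) auto
  have *: "weight_part \<sigma> n (axis 3 1) = taylor_coeff \<sigma> 0 0 n" for n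
  proof -
    have "weight_part \<sigma> n (axis 3 1) = (\<Sum>(a, b, c)\<in>{(0, 0, n)}. taylor_coeff \<sigma> a b c * (axis (3::3) 1 $ 1) ^ a * (axis (3::3) 1 $ 2) ^ b * (axis (3::3) 1 $ 3) ^ c)"
      unfolding weight_part_def
      by (rule sum.mono_neutral_right[OF fin]) (auto simp: axis_def)
    then show ?thesis by (simp add: axis_def)
  qed
  show "n < 5 \<Longrightarrow> taylor_coeff \<sigma> 0 0 n = 0"
    using is_sigma *[of n] by (simp add: is_sigma_function_def sigma_leading_part_def)
  show "taylor_coeff \<sigma> 0 0 5 = 1 / 20"
    using is_sigma *[of 5] by (simp add: is_sigma_function_def sigma_leading_part_def axis_def)
qed

text \<open>
  On the line \<open>u\<^sub>1 = u\<^sub>2 = 0\<close> the zero of order five at the origin gives \<open>\<wp>\<^sub>3\<^sub>3\<^sub>3\<close> a pole.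
\<close>

lemma p333_nonzero: "\<exists>u. \<sigma> u \<noteq> 0 \<and> wps [3, 3, 3] u \<noteq> 0"
proof (rule ccontr)
  assume "\<not> ?thesis"
  then have p0: "\<And>u. \<sigma> u \<noteq> 0 \<Longrightarrow> wps [3, 3, 3] u = 0" by blast
  define f where "f = (\<lambda>n z. (partial_deriv 3 ^^ n) \<sigma> (axis 3 z))"
  have hol: "hol3 UNIV ((partial_deriv 3 ^^ n) \<sigma>)" for n
  proof (induction n)
    case 0 show ?case using ent by (simp add: entire3_hol3)
  next
    case (Suc n) then show ?case by (simp add: hol3_partial_deriv)
  qed
  have f': "(f n has_field_derivative f (Suc n) z) (at z)" for n z
    using hol3_DERIV_line[OF hol, of 0 3 z n] by (simp add: f_def)
  have an: "f n analytic_on {0}" for n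
    using f' by (intro holomorphic_on_imp_analytic_at[of _ UNIV]) (auto simp: holomorphic_on_open)
  define F where "F = (\<lambda>n. fps_expansion (f n) 0)"
  have F: "f n has_fps_expansion F n" for n
    unfolding F_def by (rule analytic_at_imp_has_fps_expansion_0[OF an])
  have "F (Suc n) = fps_deriv (F n)" for n
  proof -
    have "deriv (f n) = f (Suc n)" using f' by (auto intro: DERIV_imp_deriv)
    then show ?thesis
      using has_fps_expansion_deriv[OF F[of n]] F[of "Suc n"] fps_expansion_unique_complex by metis
  qed
  then have Fn: "F 1 = fps_deriv (F 0)" "F 2 = fps_deriv (fps_deriv (F 0))" "F 3 = fps_deriv (fps_deriv (fps_deriv (F 0)))"
    by (simp_all add: numeral_eq_Suc)
  have c0: "fps_nth (F 0) n = taylor_coeff \<sigma> 0 0 n" for n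
  proof -
    have "(deriv ^^ n) (f 0) = f n"
      by (induction n) (use f' in \<open>auto intro!: DERIV_imp_deriv\<close>)
    then show ?thesis
      using fps_nth_fps_expansion[OF F[of 0], of n] by (simp add: taylor_coeff_def f_def)
  qed
  have F0: "F 0 \<noteq> 0"
  proof
    assume "F 0 = 0"
    then have "fps_nth (F 0) 5 = 0" by simp
    then show False unfolding c0 taylor_coeff_line(2) by simp
  qed
  have "fps_shift 5 (F 0) * fps_X ^ 5 = F 0"
    by (rule fps_shift_times_fps_X_power) (use F0 in \<open>auto intro!: subdegree_geI simp: c0 taylor_coeff_line\<close>)
  then obtain H where H: "F 0 = fps_X ^ 5 * H" "fps_nth H 0 = 1 / 20"
    using c0[of 5] taylor_coeff_line(2) by (metis fps_shift_nth add_0 mult.commute)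
  \<comment> \<open>This is \<open>f 0 z ^ 4\<close> times \<wp>_333 on the line. The last factor
    \<open>f 0 z\<close> makes the identity trivial where \<sigma> vanishes.\<close>
  have rel: "(3 * f 0 z * f 1 z * f 2 z - (f 0 z)\<^sup>2 * f 3 z - 2 * f 1 z ^ 3) * f 0 z = 0" for z
  proof (cases "f 0 z = 0")
    case False
    let ?u = "axis 3 z :: complex ^ 3"
    let ?P = "\<lambda>n. (partial_deriv 3 ^^ n) \<sigma>"
    have nz: "\<sigma> ?u \<noteq> 0" using False by (simp add: f_def)
    have hp: "haspd 3 (?P n) (?P (Suc n) u) u" for n u
      using hol3_haspd[OF hol] by simp
    have "haspd 3 (\<lambda>u. (?P 1 u * ?P 1 u - ?P 2 u * ?P 0 u) / (?P 0 u * ?P 0 u))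
       (((?P 2 ?u * ?P 1 ?u + ?P 1 ?u * ?P 2 ?u - (?P 3 ?u * ?P 0 ?u + ?P 2 ?u * ?P 1 ?u)) * (?P 0 ?u * ?P 0 ?u)
         - (?P 1 ?u * ?P 1 ?u - ?P 2 ?u * ?P 0 ?u) * (?P 1 ?u * ?P 0 ?u + ?P 0 ?u * ?P 1 ?u))
        / ((?P 0 ?u * ?P 0 ?u) * (?P 0 ?u * ?P 0 ?u))) ?u"
      using hp[of 0] hp[of 1] hp[of 2] nz
      by (intro haspd_divide haspd_diff haspd_mult) (simp_all add: numeral_eq_Suc)
    then have "wps [3, 3, 3] ?u = ((?P 2 ?u * ?P 1 ?u + ?P 1 ?u * ?P 2 ?u - (?P 3 ?u * ?P 0 ?u + ?P 2 ?u * ?P 1 ?u)) * (?P 0 ?u * ?P 0 ?u)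
         - (?P 1 ?u * ?P 1 ?u - ?P 2 ?u * ?P 0 ?u) * (?P 1 ?u * ?P 0 ?u + ?P 0 ?u * ?P 1 ?u))
        / ((?P 0 ?u * ?P 0 ?u) * (?P 0 ?u * ?P 0 ?u))"
      unfolding wps_cons[of "[3,3]", simplified list.distinct not_False_eq_True, OF TrueI]
      by (intro partial_deriv_eqI[OF open_sigma_nz[OF ent], rotated 2])
         (use nz in \<open>auto simp: wps2_eq power2_eq_square numeral_eq_Suc\<close>)
    then have "(?P 2 ?u * ?P 1 ?u + ?P 1 ?u * ?P 2 ?u - (?P 3 ?u * ?P 0 ?u + ?P 2 ?u * ?P 1 ?u)) * (?P 0 ?u * ?P 0 ?u)
         - (?P 1 ?u * ?P 1 ?u - ?P 2 ?u * ?P 0 ?u) * (?P 1 ?u * ?P 0 ?u + ?P 0 ?u * ?P 1 ?u) = 0"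
      using p0[OF nz] nz by simp
    then show ?thesis unfolding f_def by algebra
  qed simp
  have "(\<lambda>z. (3 * f 0 z * f 1 z * f 2 z - (f 0 z)\<^sup>2 * f 3 z - 2 * f 1 z ^ 3) * f 0 z) has_fps_expansion
     (3 * F 0 * F 1 * F 2 - (F 0)\<^sup>2 * F 3 - 2 * F 1 ^ 3) * F 0"
    by (intro fps_expansion_intros F)
  then have "(3 * F 0 * F 1 * F 2 - (F 0)\<^sup>2 * F 3 - 2 * F 1 ^ 3) * F 0 = 0"
    unfolding rel using fps_expansion_unique_complex has_fps_expansion_0 by blast
  with F0 have eq: "3 * F 0 * F 1 * F 2 - (F 0)\<^sup>2 * F 3 - 2 * F 1 ^ 3 = 0" by simp
  \<comment> \<open>Removing the powers of the variable from the derivatives of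
    \<open>fps_X ^ 5 * H\<close> leaves series with constant terms 5/20, 4 * 5/20 and 3 * 4 *
    5/20.\<close>
  define A where "A = 5 * H + fps_X * fps_deriv H"
  define B where "B = 4 * A + fps_X * fps_deriv A"
  define C where "C = 3 * B + fps_X * fps_deriv B"
  have der: "fps_deriv (fps_X ^ Suc n * G) = fps_X ^ n * (of_nat (Suc n) * G + fps_X * fps_deriv G)" for n and G :: "complex fps"
  proof -
    have X': "fps_deriv (fps_X ^ Suc n :: complex fps) = of_nat (Suc n) * fps_X ^ n"
      by (subst fps_deriv_power) (simp add: fps_of_nat del: of_nat_Suc power_Suc)
    show ?thesis unfolding fps_deriv_mult X' by (simp add: algebra_simps del: of_nat_Suc)
  qed
  have F1: "F 1 = fps_X ^ 4 * A" unfolding Fn H A_def using der[of 4 H] by (simp add: numeral_eq_Suc)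
  have F2: "F 2 = fps_X ^ 3 * B" unfolding Fn(2) Fn(1)[symmetric] F1 B_def using der[of 3 A] by (simp add: numeral_eq_Suc)
  have F3: "F 3 = fps_X ^ 2 * C" unfolding Fn(3) Fn(2)[symmetric] F2 C_def using der[of 2 B] by (simp add: numeral_eq_Suc)
  have "fps_X ^ 12 * (3 * H * A * B - H\<^sup>2 * C - 2 * A ^ 3) = 0"
    using eq unfolding H F1 F2 F3 by algebra
  then have z: "3 * H * A * B - H\<^sup>2 * C - 2 * A ^ 3 = 0" by simp
  have A0: "fps_nth A 0 = 1 / 4" and B0: "fps_nth B 0 = 1" and C0: "fps_nth C 0 = 3"
    by (simp_all add: A_def B_def C_def H(2))
  \<comment> \<open>The value is -1/800: the pole -10/u_3^3 of \<wp>_333 times the cube of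
    u_3^5/20.\<close>
  have "fps_nth (3 * H * A * B - H\<^sup>2 * C - 2 * A ^ 3) 0 = 3 * (1 / 20) * (1 / 4) * 1 - (1 / 20)\<^sup>2 * 3 - 2 * (1 / 4) ^ 3"
    by (simp add: A0 B0 C0 H(2) fps_power_zeroth)
  then show False unfolding z by (simp add: power2_eq_square power3_eq_cube)
qed

end

section \<open>The curve near infinity\<close>

locale curve_at_infinity =
  fixes l0 l1 l2 l3 :: complex
begin

definition qq :: "complex \<Rightarrow> complex" where
  "qq t = 1 + l3 * t ^ 3 + l2 * t ^ 6 + l1 * t ^ 9 + l0 * t ^ 12"

text \<open>From f(t^-3) = t^-12 \<open>qq t\<close>, a cube root of \<open>qq\<close> is needed to
  write y; this is the branch with value 1 at t = 0.\<close>

definition hh :: "complex \<Rightarrow> complex" where "hh t = exp (Ln (qq t) / 3)"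

definition xx :: "complex \<Rightarrow> complex" where "xx t = 1 / t ^ 3"
definition yy :: "complex \<Rightarrow> complex" where "yy t = hh t / t ^ 4"

text \<open>Minus the coefficients of \<open>du\<close> in the coordinate \<open>t\<close>.\<close>

definition ww :: "3 \<Rightarrow> complex \<Rightarrow> complex" where
  "ww j t = (if j = 1 then t ^ 4 / hh t ^ 2 else if j = 2 then t / hh t ^ 2 else 1 / hh t)"

lemma ww_simps: "ww 1 t = t ^ 4 / hh t ^ 2" "ww 2 t = t / hh t ^ 2" "ww 3 t = 1 / hh t"
  by (simp_all add: ww_def)

text \<open>On such a disc \<open>qq\<close> keeps away from the branch cut of
  \<open>Ln\<close>.\<close>

definition good_radius :: "real \<Rightarrow> bool" where "good_radius \<epsilon> \<longleftrightarrow> \<epsilon> > 0 \<and> (\<forall>t\<in>ball 0 \<epsilon>. norm (qq t - 1) < 1)"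

lemma ex_good_radius: "\<exists>\<epsilon>. good_radius \<epsilon>"
proof -
  have "isCont qq 0" unfolding qq_def by (intro continuous_intros)
  moreover have "qq 0 = 1" by (simp add: qq_def)
  ultimately obtain d where "d > 0" "\<And>t. dist t 0 < d \<Longrightarrow> dist (qq t) 1 < 1"
    unfolding continuous_at_eps_delta by (metis zero_less_one)
  then have "good_radius d" by (simp add: good_radius_def dist_norm)
  then show ?thesis by (rule exI)
qed

lemma good_radius_notin:
  assumes "good_radius \<epsilon>" "t \<in> ball 0 \<epsilon>"
  shows "qq t \<notin> \<real>\<^sub>\<le>\<^sub>0"
proof
  assume "qq t \<in> \<real>\<^sub>\<le>\<^sub>0"
  then have "1 \<le> norm (qq t - 1)"
    using abs_Re_le_cmod[of "qq t - 1"] by (simp add: complex_nonpos_Reals_iff)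
  moreover have "norm (qq t - 1) < 1" using assms unfolding good_radius_def by blast
  ultimately show False by simp
qed

lemma hh_nz [simp]: "hh t \<noteq> 0" by (simp add: hh_def)

lemma hh_0 [simp]: "hh 0 = 1" by (simp add: hh_def qq_def)

lemma hh_cube:
  assumes "good_radius \<epsilon>" "t \<in> ball 0 \<epsilon>"
  shows "hh t ^ 3 = qq t"
proof -
  have "qq t \<noteq> 0" using good_radius_notin[OF assms] by auto
  have "hh t ^ 3 = exp (of_nat 3 * (Ln (qq t) / 3))" by (simp only: hh_def exp_of_nat_mult)
  also have "of_nat 3 * (Ln (qq t) / 3) = Ln (qq t)" by simp
  also have "exp \<dots> = qq t" using \<open>qq t \<noteq> 0\<close> by simp
  finally show ?thesis .
qed

lemma hh_holomorphic:
  assumes "good_radius \<epsilon>"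
  shows "hh holomorphic_on ball 0 \<epsilon>"
  unfolding hh_def using good_radius_notin[OF assms] unfolding qq_def
  by (intro holomorphic_intros) auto

lemma on_curve:
  assumes "good_radius \<epsilon>" "t \<in> ball 0 \<epsilon>" "t \<noteq> 0"
  shows "(xx t, yy t) \<in> affine_curve [:l0, l1, l2, l3, 1:]"
proof -
  have "yy t ^ 3 = qq t / t ^ 12"
    using hh_cube[OF assms(1,2)] by (simp add: yy_def power_divide flip: power_mult)
  also have "\<dots> = poly [:l0, l1, l2, l3, 1:] (xx t)"
    using assms(3) by (simp add: qq_def xx_def field_simps eval_nat_numeral)
  finally show ?thesis by (simp add: affine_curve_def)
qed

lemma ww_holomorphic: "good_radius \<epsilon> \<Longrightarrow> ww j holomorphic_on ball 0 \<epsilon>"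
  unfolding ww_def by (cases "j = 1"; cases "j = 2") (auto intro!: holomorphic_intros hh_holomorphic)

definition primitive_on :: "real \<Rightarrow> (complex \<Rightarrow> complex ^ 3) \<Rightarrow> bool" where
  "primitive_on \<epsilon> v \<longleftrightarrow> v 0 = 0 \<and> good_radius \<epsilon> \<and>
    (\<forall>t\<in>ball 0 \<epsilon>. \<forall>j. ((\<lambda>t. v t $ j) has_field_derivative - ww j t) (at t))"

definition vv :: "complex \<Rightarrow> complex ^ 3" where
  "vv = (SOME v. \<exists>\<epsilon>. primitive_on \<epsilon> v)"

definition eps :: real where
  "eps = (SOME \<epsilon>. primitive_on \<epsilon> vv)"

lemma ex_primitive: "\<exists>v \<epsilon>. primitive_on \<epsilon> v"
proof -
  obtain \<epsilon> where g: "good_radius \<epsilon>" using ex_good_radius by blast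
  have "\<exists>F. \<forall>t\<in>ball 0 \<epsilon>. (F has_field_derivative - ww j t) (at t)" for j
  proof -
    have "(\<lambda>t. - ww j t) holomorphic_on ball 0 \<epsilon>" by (intro holomorphic_intros ww_holomorphic[OF g])
    then obtain F where "\<And>t. t \<in> ball 0 \<epsilon> \<Longrightarrow> (F has_field_derivative - ww j t) (at t within ball 0 \<epsilon>)"
      using holomorphic_convex_primitive'[of "ball 0 \<epsilon>" "\<lambda>t. - ww j t"] by auto
    then show ?thesis by (metis at_within_open open_ball)
  qed
  then obtain F where F: "\<And>j t. t \<in> ball 0 \<epsilon> \<Longrightarrow> (F j has_field_derivative - ww j t) (at t)" by metis
  define v where "v = (\<lambda>t. (\<chi> j. F j t - F j 0) :: complex ^ 3)"
  have "((\<lambda>t. v t $ j) has_field_derivative - ww j t) (at t)" if "t \<in> ball 0 \<epsilon>" for j t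
    using DERIV_diff[OF F[OF that, of j] DERIV_const[of "F j 0"]] by (simp add: v_def)
  moreover have "v 0 = 0" by (simp add: v_def vec_eq_iff)
  ultimately have "primitive_on \<epsilon> v" using g by (simp add: primitive_on_def)
  then show ?thesis by (intro exI)
qed

lemma primitive_vv: "primitive_on eps vv"
proof -
  have "\<exists>\<epsilon>. primitive_on \<epsilon> vv"
    unfolding vv_def by (rule someI_ex[where P = "\<lambda>v. \<exists>\<epsilon>. primitive_on \<epsilon> v"]) (rule ex_primitive)
  then show ?thesis
    unfolding eps_def by (rule someI_ex[where P = "\<lambda>\<epsilon>. primitive_on \<epsilon> vv"])
qed

lemma vv_0: "vv 0 = 0"
  and eps: "good_radius eps" "t \<in> ball 0 eps \<Longrightarrow> ((\<lambda>t. vv t $ j) has_field_derivative - ww j t) (at t)"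
  using primitive_vv unfolding primitive_on_def by blast+

lemma eps_pos: "eps > 0" using eps(1) by (simp add: good_radius_def)

lemma vv_has_derivative:
  "t \<in> ball 0 eps \<Longrightarrow> (vv has_derivative (\<lambda>h. \<chi> j. - ww j t * h)) (at t)"
  by (rule has_derivative_curve) (rule eps(2))

lemma ball_scale: "t \<in> ball 0 eps \<Longrightarrow> 0 \<le> r \<Longrightarrow> r \<le> 1 \<Longrightarrow> of_real r * t \<in> ball (0::complex) eps"
  using mult_left_le_one_le[of "norm t" r] by (simp add: norm_mult)

text \<open>The path is the segment from 0 to \<open>t\<close> in the local coordinate. On it the
  truncated integral is a difference of two values of the primitive, and \<open>vv 0 = 0\<close>
  gives the limit.\<close>

lemma abel_value:
  assumes t: "t \<in> ball 0 eps" "t \<noteq> 0"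
  shows "vv t \<in> abel_values [:l0, l1, l2, l3, 1:] (Some (xx t, yy t))"
proof -
  let ?f = "[:l0, l1, l2, l3, 1:]"
  define \<gamma> where "\<gamma> = (\<lambda>r::real. (xx (of_real r * t), yy (of_real r * t)))"
  obtain yy' where yy': "\<And>s. s \<in> ball 0 eps - {0} \<Longrightarrow> (yy has_field_derivative yy' s) (at s)"
    and yy'c: "continuous_on (ball 0 eps - {0}) yy'"
  proof -
    have o: "open (ball 0 eps - {0::complex})" by auto
    have h: "yy holomorphic_on ball 0 eps - {0}"
      unfolding yy_def by (intro holomorphic_intros holomorphic_on_subset[OF hh_holomorphic[OF eps(1)]]) auto
    show thesis
      by (rule that[of "deriv yy"])
        (use holomorphic_derivI[OF h o] holomorphic_on_imp_continuous_on[OF holomorphic_deriv[OF h o]] in blast)+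
  qed
  have xx': "(xx has_field_derivative (- 3 / s ^ 4)) (at s)" if "s \<noteq> 0" for s
    unfolding xx_def using that by (auto intro!: derivative_eq_intros simp: field_simps eval_nat_numeral)
  define D where "D = (\<lambda>r::real. (- 3 / (of_real r * t) ^ 4 * t, yy' (of_real r * t) * t))"
  have inb: "of_real r * t \<in> ball 0 eps - {0}" if "0 < r" "r \<le> 1" for r
    using ball_scale[OF t(1), of r] that t(2) by auto
  have lin: "((\<lambda>r. of_real r * t) has_vector_derivative t) (at r)" for r
    by (auto intro!: derivative_eq_intros simp: has_vector_derivative_def scaleR_conv_of_real)
  have \<gamma>': "(\<gamma> has_vector_derivative D r) (at r)" if r: "0 < r" "r \<le> 1" for r
    unfolding \<gamma>_def D_def
    using field_vector_diff_chain_at[OF lin xx', of r] field_vector_diff_chain_at[OF lin yy'[OF inb[OF r]]] r t(2)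
    by (intro has_vector_derivative_Pair) (auto simp: o_def mult.commute)
  have Dc: "continuous_on {\<epsilon>..1} D" if "0 < \<epsilon>" for \<epsilon>
    unfolding D_def
    by (intro continuous_intros continuous_on_compose2[OF yy'c]) (use that t(2) inb in \<open>auto\<close>)
  \<comment> \<open>With dx = -3 s^-4 ds and y = h s^-4 the form dx/(3y^2) becomes -(s^4/h^2) ds;
    multiplying by x and by y gives the other two components.\<close>
  have w: "du_form ?f (\<gamma> r) (D r) = (\<chi> j. - ww j (of_real r * t) * t)" if r: "0 < r" "r \<le> 1" for r
  proof -
    let ?s = "of_real r * t"
    have s: "?s \<noteq> 0" using r t by simp
    have y: "yy ?s \<noteq> 0" using s by (simp add: yy_def)
    have "- 3 / ?s ^ 4 * t / (3 * yy ?s ^ 2) = - ww 1 ?s * t"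
      using s by (simp add: ww_simps yy_def field_simps eval_nat_numeral)
    moreover have "xx ?s * (- ww 1 ?s * t) = - ww 2 ?s * t" "yy ?s * (- ww 1 ?s * t) = - ww 3 ?s * t"
      using s by (simp_all add: ww_simps yy_def xx_def field_simps eval_nat_numeral)
    ultimately show ?thesis
      using y unfolding du_form_def \<gamma>_def D_def Let_def prod.case
      by (simp only: if_True simp_thms vec_eq_iff forall_3 vector_3 vec_lambda_beta)
  qed
  have int: "du_integral ?f \<epsilon> 1 \<gamma> = vv t - vv (of_real \<epsilon> * t)" if e: "0 < \<epsilon>" "\<epsilon> < 1" for \<epsilon>
  proof -
    have "((\<lambda>r. du_form ?f (\<gamma> r) (vector_derivative \<gamma> (at r))) has_integral vv (of_real 1 * t) - vv (of_real \<epsilon> * t)) {\<epsilon>..1}"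
    proof (rule fundamental_theorem_of_calculus)
      fix r assume r: "r \<in> {\<epsilon>..1}"
      then have r': "0 < r" "r \<le> 1" using e by auto
      have "((\<lambda>r. of_real r * t) has_derivative (\<lambda>h. of_real h * t)) (at r)"
        by (auto intro!: derivative_eq_intros)
      from has_derivative_compose[OF this vv_has_derivative] inb[OF r']
      have "((\<lambda>r. vv (of_real r * t)) has_derivative (\<lambda>h. \<chi> j. - ww j (of_real r * t) * (of_real h * t))) (at r)"
        by simp
      moreover have "(\<lambda>h. \<chi> j. - ww j (of_real r * t) * (of_real h * t)) = (\<lambda>h. h *\<^sub>R (\<chi> j. - ww j (of_real r * t) * t))"
        by (intro ext) (simp add: vec_eq_iff, simp add: scaleR_conv_of_real)
      moreover have "vector_derivative \<gamma> (at r) = D r"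
        by (rule vector_derivative_at[OF \<gamma>'[OF r']])
      ultimately show "((\<lambda>r. vv (of_real r * t)) has_vector_derivative du_form ?f (\<gamma> r) (vector_derivative \<gamma> (at r))) (at r within {\<epsilon>..1})"
        unfolding has_vector_derivative_def using w[OF r'] has_derivative_at_withinI by metis
    qed (use e in simp)
    then show ?thesis unfolding du_integral_def by (simp add: integral_unique)
  qed
  have lim: "((\<lambda>\<epsilon>. du_integral ?f \<epsilon> 1 \<gamma>) \<longlongrightarrow> vv t) (at_right 0)"
  proof -
    have v: "isCont vv (of_real 0 * t)"
      using has_derivative_continuous[OF vv_has_derivative, of 0] eps_pos by simp
    have s: "isCont (\<lambda>\<epsilon>::real. of_real \<epsilon> * t) 0"
      by (intro continuous_intros)
    have c: "isCont (\<lambda>\<epsilon>::real. vv t - vv (of_real \<epsilon> * t)) 0"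
      by (rule continuous_diff[OF continuous_const isCont_o2[OF s v]])
    have "((\<lambda>\<epsilon>. vv t - vv (of_real \<epsilon> * t)) \<longlongrightarrow> vv t) (at_right 0)"
    proof -
      have "((\<lambda>\<epsilon>. vv t - vv (of_real \<epsilon> * t)) \<longlongrightarrow> vv t - vv (of_real 0 * t)) (at_right 0)"
        by (rule tendsto_within_subset[OF isContD[OF c] subset_UNIV])
      then show ?thesis by (simp only: of_real_0 mult_zero_left vv_0 diff_zero)
    qed
    moreover have "\<forall>\<^sub>F \<epsilon> in at_right 0. du_integral ?f \<epsilon> 1 \<gamma> = vv t - vv (of_real \<epsilon> * t)"
      unfolding eventually_at_right[OF zero_less_one] using int by (intro exI[of _ 1]) simp
    ultimately show ?thesis using tendsto_cong by fastforce
  qed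
  have inf: "filterlim \<gamma> at_infinity (at_right 0)"
  proof -
    have "((\<lambda>r::real. (of_real r * t) ^ 3) \<longlongrightarrow> 0) (at_right 0)"
      by (auto intro!: tendsto_eq_intros)
    moreover have "\<forall>\<^sub>F r in at_right (0::real). (of_real r * t) ^ 3 \<noteq> 0"
      unfolding eventually_at_right[OF zero_less_one] using t(2) by (intro exI[of _ 1]) simp
    ultimately have "filterlim (\<lambda>r::real. (of_real r * t) ^ 3) (at 0) (at_right 0)"
      by (rule filterlim_atI)
    then have "filterlim (\<lambda>r::real. inverse ((of_real r * t) ^ 3)) at_infinity (at_right 0)"
      by (rule filterlim_compose[OF filterlim_inverse_at_infinity])
    then have "filterlim (\<lambda>r::real. norm (xx (of_real r * t))) at_top (at_right 0)"
      unfolding xx_def inverse_eq_divide by (rule filterlim_at_infinity_imp_norm_at_top)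
    then have "filterlim (\<lambda>r::real. norm (\<gamma> r)) at_top (at_right 0)"
      by (rule filterlim_at_top_mono) (auto simp: \<gamma>_def norm_Pair intro!: always_eventually real_sqrt_ge_abs1[THEN order_trans[rotated]])
    then show ?thesis by (rule filterlim_norm_at_top_imp_at_infinity)
  qed
  have "\<gamma> piecewise_C1_differentiable_on {\<epsilon>..1}" if "0 < \<epsilon>" "\<epsilon> < 1" for \<epsilon>
    unfolding piecewise_C1_differentiable_on_def
  proof (intro conjI exI[of _ "{}"])
    show "continuous_on {\<epsilon>..1} \<gamma>"
    proof (rule continuous_at_imp_continuous_on, rule ballI)
      fix r assume "r \<in> {\<epsilon>..1}"
      with that show "isCont \<gamma> r" by (intro has_vector_derivative_continuous[OF \<gamma>']) auto
    qed
    have "\<forall>r\<in>{\<epsilon>..1} - {}. (\<gamma> has_vector_derivative D r) (at r)"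
      using \<gamma>' that by simp
    moreover have "continuous_on ({\<epsilon>..1} - {}) D" using Dc[OF that(1)] by simp
    ultimately show "\<gamma> C1_differentiable_on {\<epsilon>..1} - {}"
      unfolding C1_differentiable_on_def by blast
  qed simp
  moreover have "\<gamma> ` {0<..1} \<subseteq> affine_curve ?f"
    using on_curve[OF eps(1)] inb by (auto simp: \<gamma>_def)
  moreover have "\<gamma> 1 = (xx t, yy t)" by (simp add: \<gamma>_def)
  ultimately show ?thesis using lim inf by (auto intro!: exI[of _ \<gamma>])
qed

end

section \<open>Expansion of Klein's formula at infinity\<close>

lemma has_fps_expansion_transform:
  "f has_fps_expansion F \<Longrightarrow> \<forall>\<^sub>F t in nhds 0. f t = g t \<Longrightarrow> g has_fps_expansion F"
  using iffD1[OF has_fps_expansion_cong[OF _ refl]] .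

lemma fps_mult_nth_small:
  fixes F G :: "complex fps"
  shows "fps_nth (F * G) 0 = fps_nth F 0 * fps_nth G 0"
    "fps_nth (F * G) (Suc 0) = fps_nth F 0 * fps_nth G (Suc 0) + fps_nth F (Suc 0) * fps_nth G 0"
    "fps_nth (F * G) 2 = fps_nth F 0 * fps_nth G 2 + fps_nth F (Suc 0) * fps_nth G (Suc 0) + fps_nth F 2 * fps_nth G 0"
    "fps_nth (F * G) 3 = fps_nth F 0 * fps_nth G 3 + fps_nth F (Suc 0) * fps_nth G 2 + fps_nth F 2 * fps_nth G (Suc 0) + fps_nth F 3 * fps_nth G 0"
    "fps_nth (F * G) 4 = fps_nth F 0 * fps_nth G 4 + fps_nth F (Suc 0) * fps_nth G 3 + fps_nth F 2 * fps_nth G 2 + fps_nth F 3 * fps_nth G (Suc 0) + fps_nth F 4 * fps_nth G 0"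
  by (simp_all add: fps_mult_nth numeral_eq_Suc)

context curve_at_infinity
begin

lemma analytic_hh: "hh analytic_on {0}"
  by (rule holomorphic_on_imp_analytic_at[OF hh_holomorphic[OF eps(1)]]) (use eps_pos in auto)

lemma analytic_ww: "ww j analytic_on {0}"
  by (rule holomorphic_on_imp_analytic_at[OF ww_holomorphic[OF eps(1)]]) (use eps_pos in auto)

definition H :: "complex fps" where "H = fps_expansion hh 0"
definition W :: "3 \<Rightarrow> complex fps" where "W j = fps_expansion (ww j) 0"

lemma hh_fps: "hh has_fps_expansion H"
  unfolding H_def by (rule analytic_at_imp_has_fps_expansion_0[OF analytic_hh])

lemma ww_fps: "ww j has_fps_expansion W j"
  unfolding W_def by (rule analytic_at_imp_has_fps_expansion_0[OF analytic_ww])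

lemma H_cube: "H ^ 3 = 1 + fps_const l3 * fps_X ^ 3 + fps_const l2 * fps_X ^ 6 + fps_const l1 * fps_X ^ 9 + fps_const l0 * fps_X ^ 12"
proof -
  have "qq has_fps_expansion 1 + fps_const l3 * fps_X ^ 3 + fps_const l2 * fps_X ^ 6 + fps_const l1 * fps_X ^ 9 + fps_const l0 * fps_X ^ 12"
    unfolding qq_def by (intro fps_expansion_intros)
  moreover have "qq has_fps_expansion H ^ 3"
  proof -
    have "\<forall>\<^sub>F t in nhds 0. hh t ^ 3 = qq t"
      using eventually_nhds_in_open[of "ball 0 eps" 0] eps_pos hh_cube[OF eps(1)]
      by (auto elim: eventually_mono)
    moreover have "(\<lambda>t. hh t ^ 3) has_fps_expansion H ^ 3"
      by (intro fps_expansion_intros hh_fps)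
    ultimately show ?thesis by (rule has_fps_expansion_transform[rotated])
  qed
  ultimately show ?thesis using fps_expansion_unique_complex by blast
qed

text \<open>In the coefficient of order n > 0 of the cube of \<open>H\<close>, the unknown of that
  order occurs linearly with factor 3, so the orders are solved one after the other.\<close>

lemma H_nth: "fps_nth H 0 = 1" "fps_nth H (Suc 0) = 0" "fps_nth H 2 = 0" "fps_nth H 3 = l3 / 3" "fps_nth H 4 = 0"
proof -
  show 0: "fps_nth H 0 = 1" using fps_nth_fps_expansion[OF hh_fps, of 0] by simp
  have e: "fps_nth (H * H * H) n = (if n = 0 then 1 else if n = 3 then l3 else 0)" if "n < 5" for n
  proof -
    have "fps_nth (H * H * H) n = fps_nth (1 + fps_const l3 * fps_X ^ 3 + fps_const l2 * fps_X ^ 6 + fps_const l1 * fps_X ^ 9 + fps_const l0 * fps_X ^ 12) n"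
      using H_cube by (simp add: power3_eq_cube)
    then show ?thesis using that by simp
  qed
  show 1: "fps_nth H (Suc 0) = 0" using e[of 1] by (simp add: fps_mult_nth_small 0)
  show 2: "fps_nth H 2 = 0" using e[of 2] by (simp add: fps_mult_nth_small 0 1)
  have "3 * fps_nth H 3 = l3" using e[of 3] 2 by (simp add: fps_mult_nth_small 0 1)
  then show 3: "fps_nth H 3 = l3 / 3" by (simp add: field_simps)
  show 4: "fps_nth H 4 = 0" using e[of 4] 2 3 by (simp add: fps_mult_nth_small 0 1)
qed

text \<open>Read off from h w_3 = 1, as the next two from h^2 w_2 = t and h^2 w_1 = t^4. Order 3
  suffices, because integrating the differential recursion raises the order by one and orders up to
  4 are used.\<close>

lemma W3_nth: "fps_nth (W 3) 0 = 1" "fps_nth (W 3) (Suc 0) = 0" "fps_nth (W 3) 2 = 0" "fps_nth (W 3) 3 = - l3 / 3"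
proof -
  have "(\<lambda>t. hh t * ww 3 t) has_fps_expansion H * W 3" by (intro fps_expansion_intros hh_fps ww_fps)
  moreover have "(\<lambda>t. hh t * ww 3 t) = (\<lambda>_. 1)" by (simp add: ww_simps)
  ultimately have "H * W 3 = 1" using fps_expansion_unique_complex has_fps_expansion_1 by metis
  then have e: "fps_nth (H * W 3) n = fps_nth 1 n" for n by simp
  show 0: "fps_nth (W 3) 0 = 1" using e[of 0] by (simp add: H_nth)
  show 1: "fps_nth (W 3) (Suc 0) = 0" using e[of 1] by (simp add: fps_mult_nth_small 0 H_nth)
  show 2: "fps_nth (W 3) 2 = 0" using e[of 2] H_nth by (simp add: fps_mult_nth_small 0 1)
  have "fps_nth H 3 + fps_nth (W 3) 3 = 0"
    using e[of 3] H_nth(1-3) 2 by (simp add: fps_mult_nth_small 0 1 add.commute)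
  then show 3: "fps_nth (W 3) 3 = - l3 / 3" by (simp add: H_nth add_eq_0_iff)
qed

lemma W2_nth: "fps_nth (W 2) 0 = 0" "fps_nth (W 2) (Suc 0) = 1" "fps_nth (W 2) 2 = 0" "fps_nth (W 2) 3 = 0"
proof -
  have "(\<lambda>t. hh t * hh t * ww 2 t) has_fps_expansion H * H * W 2" by (intro fps_expansion_intros hh_fps ww_fps)
  moreover have "(\<lambda>t. hh t * hh t * ww 2 t) = (\<lambda>t. t)" by (simp add: ww_simps power2_eq_square)
  ultimately have "H * H * W 2 = fps_X" using fps_expansion_unique_complex has_fps_expansion_fps_X by metis
  then have e: "fps_nth (H * H * W 2) n = fps_nth fps_X n" for n by simp
  show 0: "fps_nth (W 2) 0 = 0" using e[of 0] by (simp add: H_nth)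
  show 1: "fps_nth (W 2) (Suc 0) = 1" using e[of 1] by (simp add: fps_mult_nth_small 0 H_nth)
  show 2: "fps_nth (W 2) 2 = 0" using e[of 2] H_nth by (simp add: fps_mult_nth_small 0 1)
  show 3: "fps_nth (W 2) 3 = 0" using e[of 3] H_nth 2 by (simp add: fps_mult_nth_small 0 1)
qed

lemma W1_nth: "fps_nth (W 1) 0 = 0" "fps_nth (W 1) (Suc 0) = 0" "fps_nth (W 1) 2 = 0" "fps_nth (W 1) 3 = 0"
proof -
  have "(\<lambda>t. hh t * hh t * ww 1 t) has_fps_expansion H * H * W 1" by (intro fps_expansion_intros hh_fps ww_fps)
  moreover have "(\<lambda>t. hh t * hh t * ww 1 t) = (\<lambda>t. t ^ 4)" by (simp add: ww_simps power2_eq_square)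
  ultimately have "H * H * W 1 = fps_X ^ 4" using fps_expansion_unique_complex has_fps_expansion_fps_X_power by metis
  then have e: "n < 4 \<Longrightarrow> fps_nth (H * H * W 1) n = 0" for n by simp
  show 0: "fps_nth (W 1) 0 = 0" using e[of 0] by (simp add: H_nth)
  show 1: "fps_nth (W 1) (Suc 0) = 0" using e[of 1] by (simp add: fps_mult_nth_small 0 H_nth)
  show 2: "fps_nth (W 1) 2 = 0" using e[of 2] H_nth by (simp add: fps_mult_nth_small 0 1)
  show 3: "fps_nth (W 1) 3 = 0" using e[of 3] H_nth 2 by (simp add: fps_mult_nth_small 0 1)
qed

end

sublocale sigma_curve \<subseteq> curve_at_infinity l0 l1 l2 l3 .

section \<open>Taylor coefficients of the \<wp>-functions along the curve\<close>

context sigma_curve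
begin

text \<open>Klein's formula has the opposite argument, but functions with two indices are even. With
  this sign, differentiation in \<open>t\<close> produces the factors \<open>ww j\<close> without a
  minus.\<close>

definition E :: "3 list \<Rightarrow> complex ^ 3 \<Rightarrow> complex fps" where
  "E js u = fps_expansion (\<lambda>t. wps js (u - vv t)) 0"

definition near :: "complex ^ 3 \<Rightarrow> complex set" where
  "near u = {t \<in> ball 0 eps. \<sigma> (u - vv t) \<noteq> 0}"

lemma open_near: "open (near u)"
proof -
  have c: "continuous_on (ball 0 eps) vv"
    by (intro continuous_at_imp_continuous_on ballI has_derivative_continuous[OF vv_has_derivative])
  have "continuous_on UNIV \<sigma>"
    using hol3_continuous_on ent unfolding entire3_hol3 by blast
  from continuous_on_compose2[OF this continuous_on_diff[OF continuous_on_const c], of u]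
  have "continuous_on (ball 0 eps) (\<lambda>t. \<sigma> (u - vv t))" by simp
  moreover have "open (- {0::complex})" by (simp add: open_Compl)
  ultimately have "open (ball 0 eps \<inter> (\<lambda>t. \<sigma> (u - vv t)) -` (- {0}))"
    by (rule continuous_open_preimage[OF _ open_ball])
  moreover have "near u = ball 0 eps \<inter> (\<lambda>t. \<sigma> (u - vv t)) -` (- {0})"
    by (auto simp: near_def)
  ultimately show ?thesis by simp
qed

lemma near_0: "\<sigma> u \<noteq> 0 \<Longrightarrow> 0 \<in> near u"
  using eps_pos by (simp add: near_def vv_0)

lemma eventually_near: "\<sigma> u \<noteq> 0 \<Longrightarrow> \<forall>\<^sub>F t in nhds 0. t \<in> near u"
  by (rule eventually_nhds_in_open[OF open_near near_0])

lemma wps_shift_deriv: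
  assumes "t \<in> near u" "js \<noteq> []"
  shows "((\<lambda>t. wps js (u - vv t)) has_field_derivative (\<Sum>j\<in>UNIV. wps (j # js) (u - vv t) * ww j t)) (at t)"
proof -
  have "((\<lambda>t. (u - vv t) $ j) has_field_derivative ww j t) (at t)" for j
    using DERIV_diff[OF DERIV_const eps(2)[of t j], of "u $ j"] assms(1) by (simp add: near_def)
  from hol3_DERIV_curve[where c = "\<lambda>t. u - vv t", OF mero3_hol3[OF ent mero3_wps[of js]] _ this]
  show ?thesis using assms by (simp add: near_def wps_cons)
qed

lemma E_fps:
  assumes "\<sigma> u \<noteq> 0" "js \<noteq> []"
  shows "(\<lambda>t. wps js (u - vv t)) has_fps_expansion E js u"
  unfolding E_def
proof (rule analytic_at_imp_has_fps_expansion_0)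
  have "(\<lambda>t. wps js (u - vv t)) holomorphic_on near u"
    unfolding holomorphic_on_open[OF open_near] using wps_shift_deriv[OF _ assms(2)] by blast
  then show "(\<lambda>t. wps js (u - vv t)) analytic_on {0}"
    using open_near near_0[OF assms(1)] holomorphic_on_imp_analytic_at by blast
qed

text \<open>The chain rule for power series, used as a recursion for the coefficients. As
  \<open>W 2\<close> and \<open>W 1\<close> start at orders 1 and 4, an index 3 accounts for one
  order in \<open>t\<close>, an index 2 for two and an index 1 for five.\<close>

lemma E_deriv:
  assumes "\<sigma> u \<noteq> 0" "js \<noteq> []"
  shows "fps_deriv (E js u) = E (3 # js) u * W 3 + E (2 # js) u * W 2 + E (1 # js) u * W 1"
proof -
  have "deriv (\<lambda>t. wps js (u - vv t)) has_fps_expansion fps_deriv (E js u)"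
    by (rule has_fps_expansion_deriv[OF E_fps[OF assms]])
  moreover have "\<forall>\<^sub>F t in nhds 0. deriv (\<lambda>t. wps js (u - vv t)) t
      = wps (3 # js) (u - vv t) * ww 3 t + wps (2 # js) (u - vv t) * ww 2 t + wps (1 # js) (u - vv t) * ww 1 t"
    using eventually_near[OF assms(1)]
  proof eventually_elim
    case (elim t)
    from DERIV_imp_deriv[OF wps_shift_deriv[OF elim assms(2)]] show ?case by (simp add: sum_3)
  qed
  ultimately have "(\<lambda>t. wps (3 # js) (u - vv t) * ww 3 t + wps (2 # js) (u - vv t) * ww 2 t + wps (1 # js) (u - vv t) * ww 1 t) has_fps_expansion fps_deriv (E js u)"
    by (rule has_fps_expansion_transform)
  moreover have "(\<lambda>t. wps (3 # js) (u - vv t) * ww 3 t + wps (2 # js) (u - vv t) * ww 2 t + wps (1 # js) (u - vv t) * ww 1 t) has_fps_expansion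
    E (3 # js) u * W 3 + E (2 # js) u * W 2 + E (1 # js) u * W 1"
    by (intro fps_expansion_intros E_fps ww_fps assms) auto
  ultimately show ?thesis using fps_expansion_unique_complex by blast
qed

lemma E_nth_0: "\<sigma> u \<noteq> 0 \<Longrightarrow> js \<noteq> [] \<Longrightarrow> fps_nth (E js u) 0 = wps js u"
  using fps_nth_fps_expansion[OF E_fps, of u js 0] by (simp add: vv_0)

lemma E_nth_Suc:
  assumes "\<sigma> u \<noteq> 0" "js \<noteq> []"
  shows "of_nat (Suc n) * fps_nth (E js u) (Suc n) = fps_nth (E (3 # js) u * W 3 + E (2 # js) u * W 2 + E (1 # js) u * W 1) n"
  using E_deriv[OF assms] fps_deriv_nth[of "E js u" n] by simp

lemma E_nth_1: "\<sigma> u \<noteq> 0 \<Longrightarrow> js \<noteq> [] \<Longrightarrow> fps_nth (E js u) (Suc 0) = wps (3 # js) u"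
  using E_nth_Suc[of u js 0] by (simp add: W3_nth W2_nth W1_nth E_nth_0)

lemma E_nth_2:
  assumes "\<sigma> u \<noteq> 0" "js \<noteq> []"
  shows "fps_nth (E js u) 2 = (wps (3 # 3 # js) u + wps (2 # js) u) / 2"
proof -
  have "of_nat 2 * fps_nth (E js u) 2 = wps (3 # 3 # js) u + wps (2 # js) u"
    using E_nth_Suc[OF assms, of 1] assms
    by (simp add: fps_mult_nth_small W3_nth W2_nth W1_nth E_nth_0 E_nth_1 flip: numeral_2_eq_2)
  then show ?thesis by (simp add: field_simps)
qed

lemma E_nth_3:
  assumes "\<sigma> u \<noteq> 0" "js \<noteq> []"
  shows "fps_nth (E js u) 3 = wps (3 # 3 # 3 # js) u / 6 + wps (2 # 3 # js) u / 6 + wps (3 # 2 # js) u / 3"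
proof -
  have "of_nat 3 * fps_nth (E js u) 3 = (wps (3 # 3 # 3 # js) u + wps (2 # 3 # js) u) / 2 + wps (3 # 2 # js) u"
    using E_nth_Suc[OF assms, of 2] assms
    by (simp add: fps_mult_nth_small W3_nth W2_nth W1_nth E_nth_0 E_nth_1 E_nth_2)
  then show ?thesis by (simp add: field_simps)
qed

lemma E_nth_4:
  assumes "\<sigma> u \<noteq> 0" "js \<noteq> []"
  shows "fps_nth (E js u) 4 = wps (3 # 3 # 3 # 3 # js) u / 24 + wps (2 # 3 # 3 # js) u / 24 + wps (3 # 2 # 3 # js) u / 12
     + (wps (3 # 3 # 2 # js) u + wps (2 # 2 # js) u) / 8 - l3 / 12 * wps (3 # js) u"
proof -
  have "of_nat 4 * fps_nth (E js u) 4 = wps (3 # 3 # 3 # 3 # js) u / 6 + wps (2 # 3 # 3 # js) u / 6 + wps (3 # 2 # 3 # js) u / 3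
      - l3 / 3 * wps (3 # js) u + (wps (3 # 3 # 2 # js) u + wps (2 # 2 # js) u) / 2"
    using E_nth_Suc[OF assms, of 3] assms
    by (simp add: fps_mult_nth_small W3_nth W2_nth W1_nth E_nth_0 E_nth_1 E_nth_2 E_nth_3)
  then have "4 * fps_nth (E js u) 4 = wps (3 # 3 # 3 # 3 # js) u / 6 + wps (2 # 3 # 3 # js) u / 6 + wps (3 # 2 # 3 # js) u / 3
      - l3 / 3 * wps (3 # js) u + (wps (3 # 3 # 2 # js) u + wps (2 # 2 # js) u) / 2" by simp
  then show ?thesis by algebra
qed

end

section \<open>Klein's formula in the local coordinate at infinity\<close>

context sigma_curve
begin

abbreviation Lw :: "complex ^ 3 \<Rightarrow> complex \<Rightarrow> complex \<Rightarrow> 3 list \<Rightarrow> complex" where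
  "Lw u X Y js \<equiv> wps (js @ [1]) u + X * wps (js @ [2]) u + Y * wps (js @ [3]) u"

text \<open>Klein's formula multiplied by t^10: four powers turn (1, x, y) into (t^4, t, h), and six
  turn the denominator into (1 - X t^3)^2. No pole at t = 0 is left.\<close>

lemma klein_at_infinity:
  fixes \<tau> :: "3 \<Rightarrow> complex" and k :: 3
  assumes \<tau>: "\<And>m. \<tau> m \<in> ball 0 eps - {0}" and u: "u = (\<Sum>m\<in>UNIV. vv (\<tau> m))"
    and t: "t \<in> near u" "t \<noteq> 0" "xx t \<noteq> xx (\<tau> k)"
  defines "X \<equiv> xx (\<tau> k)" and "Y \<equiv> yy (\<tau> k)"
  shows "(hh t * Lw (u - vv t) X Y [3] + t * Lw (u - vv t) X Y [2] + t ^ 4 * Lw (u - vv t) X Y [1]) * (1 - X * t ^ 3)\<^sup>2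
    = 3 * (hh t)\<^sup>2 * Y\<^sup>2 * t ^ 2
      + Y * (3 * l0 * t ^ 10 + (X * t ^ 10 + 2 * t ^ 7) * l1 + (t ^ 4 + 2 * X * t ^ 7) * l2
          + 3 * l3 * X * t ^ 4 + X\<^sup>2 * t ^ 4 + 2 * X * t)
      + hh t * (3 * l0 * t ^ 6 + (t ^ 3 + 2 * X * t ^ 6) * l1 + (X\<^sup>2 * t ^ 6 + 2 * X * t ^ 3) * l2
          + 3 * l3 * X\<^sup>2 * t ^ 3 + X\<^sup>2 + 2 * X ^ 3 * t ^ 3)"
proof -
  let ?f = "[:l0, l1, l2, l3, 1:]"
  define x y where "x = xx t" and "y = yy t"
  have tb: "t \<in> ball 0 eps" and nz: "\<sigma> (u - vv t) \<noteq> 0" using t(1) by (auto simp: near_def)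
  have neg: "vv t - u = - (u - vv t)" by simp
  have nz': "\<sigma> (vv t - u) \<noteq> 0" using nz unfolding neg by (simp only: sigma_minus_nz not_False_eq_True)
  have wp: "wp2 \<sigma> i j (vv t - u) = wps [i, j] (u - vv t)" for i j
  proof -
    have "wp2 \<sigma> i j (vv t - u) = wps [i, j] (vv t - u)" by (rule wp2_eq[OF nz'])
    also have "\<dots> = (- 1) ^ length [i, j] * wps [i, j] (u - vv t)"
      unfolding neg by (rule wps_parity[OF nz]) simp
    finally show ?thesis by simp
  qed
  have klein: "sigma_klein_formula ?f \<sigma>" using is_sigma by (simp add: is_sigma_function_def)
  have 1: "(x, y) \<in> affine_curve ?f \<and> vv t \<in> abel_values ?f (Some (x, y)) \<and>
    (\<forall>k. (xx (\<tau> k), yy (\<tau> k)) \<in> affine_curve ?f \<and> vv (\<tau> k) \<in> abel_values ?f (Some (xx (\<tau> k), yy (\<tau> k)))) \<and>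
        \<sigma> (vv t - (\<Sum>m\<in>UNIV. vv (\<tau> m))) \<noteq> 0"
    unfolding x_def y_def using on_curve[OF eps(1) tb t(2)] abel_value[OF tb t(2)] on_curve[OF eps(1)] abel_value \<tau> nz' u
    by simp
  have "(\<Sum>i\<in>UNIV. \<Sum>j\<in>UNIV. wp2 \<sigma> i j (vv t - (\<Sum>m\<in>UNIV. vv (\<tau> m))) * vector [1, x, y] $ i * vector [1, xx (\<tau> k), yy (\<tau> k)] $ j)
      = (3 * y ^ 2 * yy (\<tau> k) ^ 2 + yy (\<tau> k) * klein_T ?f x (xx (\<tau> k)) + y * klein_T ?f (xx (\<tau> k)) x) / (x - xx (\<tau> k)) ^ 2"
    using klein[unfolded sigma_klein_formula_def, rule_format, OF 1, of k] t(3)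
    unfolding Let_def prod.case x_def by blast
  then have kl: "Lw (u - vv t) X Y [1] + x * Lw (u - vv t) X Y [2] + y * Lw (u - vv t) X Y [3]
     = (3 * y ^ 2 * Y ^ 2 + Y * klein_T ?f x X + y * klein_T ?f X x) / (x - X) ^ 2"
    unfolding u[symmetric] wp X_def[symmetric] Y_def[symmetric]
    by (simp add: sum_3 vector_3 algebra_simps)
  have xt: "x * t ^ 3 = 1" and yt: "y * t ^ 4 = hh t"
    using t(2) by (simp_all add: x_def y_def xx_def yy_def)
  have xX: "(x - X) ^ 2 \<noteq> 0" using t(3) by (simp add: x_def X_def)
  have "(1 - X * t ^ 3)\<^sup>2 = t ^ 6 * (x - X) ^ 2" using xt by algebra
  moreover have "hh t * Lw (u - vv t) X Y [3] + t * Lw (u - vv t) X Y [2] + t ^ 4 * Lw (u - vv t) X Y [1]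
     = t ^ 4 * (Lw (u - vv t) X Y [1] + x * Lw (u - vv t) X Y [2] + y * Lw (u - vv t) X Y [3])"
    using xt yt by algebra
  ultimately have "(hh t * Lw (u - vv t) X Y [3] + t * Lw (u - vv t) X Y [2] + t ^ 4 * Lw (u - vv t) X Y [1]) * (1 - X * t ^ 3)\<^sup>2
    = t ^ 10 * (3 * y ^ 2 * Y ^ 2 + Y * klein_T ?f x X + y * klein_T ?f X x)"
    unfolding kl using xX by (simp add: field_simps flip: power_add)
  also have "\<dots> = 3 * (y * t ^ 4)\<^sup>2 * Y\<^sup>2 * t ^ 2
      + Y * (3 * l0 * t ^ 10 + (X * t ^ 10 + 2 * (x * t ^ 3) * t ^ 7) * l1 + ((x * t ^ 3) ^ 2 * t ^ 4 + 2 * X * (x * t ^ 3) * t ^ 7) * l2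
          + 3 * l3 * X * (x * t ^ 3) ^ 2 * t ^ 4 + X\<^sup>2 * (x * t ^ 3) ^ 2 * t ^ 4 + 2 * X * (x * t ^ 3) ^ 3 * t)
      + y * t ^ 4 * (3 * l0 * t ^ 6 + ((x * t ^ 3) * t ^ 3 + 2 * X * t ^ 6) * l1 + (X\<^sup>2 * t ^ 6 + 2 * X * (x * t ^ 3) * t ^ 3) * l2
          + 3 * l3 * X\<^sup>2 * (x * t ^ 3) * t ^ 3 + X\<^sup>2 * (x * t ^ 3) ^ 2 + 2 * X ^ 3 * (x * t ^ 3) * t ^ 3)"
    by (simp add: klein_T_def coeff_pCons numeral_eq_Suc algebra_simps)
  finally show ?thesis unfolding xt yt by simp
qed

text \<open>Give the indices 3, 2, 1 the weights 1, 2, 5 and \<open>l3\<close> the weight 3. The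
  coefficient of t^n then collects the index lists of weight n + 1, so that \<open>[1]\<close> first
  occurs for n = 4.\<close>

lemma expansion_relations:
  fixes \<tau> :: "3 \<Rightarrow> complex" and k :: 3
  assumes \<tau>: "\<And>m. \<tau> m \<in> ball 0 eps - {0}" and u: "u = (\<Sum>m\<in>UNIV. vv (\<tau> m))" and nz: "\<sigma> u \<noteq> 0"
  defines "X \<equiv> xx (\<tau> k)" and "Y \<equiv> yy (\<tau> k)"
  shows "Lw u X Y [3] = X\<^sup>2"
    "Lw u X Y [3, 3] + Lw u X Y [2] = 2 * X * Y"
    "(Lw u X Y [3, 3, 3] + Lw u X Y [2, 3]) / 2 + Lw u X Y [3, 2] = 3 * Y\<^sup>2"
    "Lw u X Y [3, 3, 3, 3] / 6 + Lw u X Y [2, 3, 3] / 6 + Lw u X Y [3, 2, 3] / 3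
       + (Lw u X Y [3, 3, 2] + Lw u X Y [2, 2]) / 2 = 4 * X ^ 3 + 3 * l3 * X\<^sup>2 + 2 * l2 * X + l1"
    "Lw u X Y [3, 3, 3, 3, 3] / 24 + Lw u X Y [2, 3, 3, 3] / 24 + Lw u X Y [3, 2, 3, 3] / 12
       + (Lw u X Y [3, 3, 2, 3] + Lw u X Y [2, 2, 3]) / 8 + l3 / 4 * Lw u X Y [3, 3]
       + Lw u X Y [3, 3, 3, 2] / 6 + Lw u X Y [2, 3, 2] / 6 + Lw u X Y [3, 2, 2] / 3 + Lw u X Y [1]
      = Y * (5 * X\<^sup>2 + 3 * l3 * X + l2)"
proof -
  define S where "S i t = Lw (u - vv t) X Y [i]" for i t
  define SF where "SF i = E [i, 1] u + fps_const X * E [i, 2] u + fps_const Y * E [i, 3] u" for i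
  have SF: "S i has_fps_expansion SF i" for i
    unfolding S_def SF_def by (intro fps_expansion_intros) (auto intro!: E_fps nz)
  define A where "A = (\<lambda>t. hh t * S 3 t + t * S 2 t + t ^ 4 * S 1 t)"
  define AF where "AF = H * SF 3 + fps_X * SF 2 + fps_X ^ 4 * SF 1"
  define B where "B = (\<lambda>t. 3 * (hh t)\<^sup>2 * Y\<^sup>2 * t ^ 2
      + Y * (3 * l0 * t ^ 10 + (X * t ^ 10 + 2 * t ^ 7) * l1 + (t ^ 4 + 2 * X * t ^ 7) * l2
          + 3 * l3 * X * t ^ 4 + X\<^sup>2 * t ^ 4 + 2 * X * t)
      + hh t * (3 * l0 * t ^ 6 + (t ^ 3 + 2 * X * t ^ 6) * l1 + (X\<^sup>2 * t ^ 6 + 2 * X * t ^ 3) * l2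
          + 3 * l3 * X\<^sup>2 * t ^ 3 + X\<^sup>2 + 2 * X ^ 3 * t ^ 3))"
  \<comment> \<open>The factor \<open>t\<close> includes the point t = 0, where Klein's formula says
    nothing; it is cancelled after passing to power series.\<close>
  have ev: "\<forall>\<^sub>F t in nhds 0. t * (A t * (1 - X * t ^ 3)\<^sup>2 - B t) = 0"
  proof -
    have "\<forall>\<^sub>F t in nhds 0. X * t ^ 3 \<noteq> 1"
    proof -
      have "open {t. X * t ^ 3 \<noteq> 1}" by (intro open_Collect_neq continuous_intros)
      from eventually_nhds_in_open[OF this, of 0] show ?thesis by simp
    qed
    with eventually_near[OF nz] show ?thesis
    proof eventually_elim
      case (elim t)
      show ?case
      proof (cases "t = 0")
        case False
        have "xx t \<noteq> X" using elim(2) False by (auto simp: xx_def)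
        then show ?thesis
          using klein_at_infinity[OF \<tau> u elim(1) False, of k] unfolding A_def B_def S_def X_def Y_def by simp
      qed simp
    qed
  qed
  define BF where "BF = fps_const (3 * Y\<^sup>2) * (H * H * fps_X ^ 2)
      + (fps_const (3 * l0 * Y + X * Y * l1) * fps_X ^ 10 + fps_const (2 * Y * l1 + 2 * X * Y * l2) * fps_X ^ 7
         + fps_const (Y * (l2 + 3 * l3 * X + X\<^sup>2)) * fps_X ^ 4 + fps_const (2 * X * Y) * fps_X)
      + (fps_const (3 * l0 + 2 * X * l1 + X\<^sup>2 * l2) * (H * fps_X ^ 6)
         + fps_const (l1 + 2 * X * l2 + 3 * l3 * X\<^sup>2 + 2 * X ^ 3) * (H * fps_X ^ 3) + fps_const (X\<^sup>2) * H)"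
  have "(\<lambda>t. 3 * Y\<^sup>2 * (hh t * hh t * t ^ 2)
      + ((3 * l0 * Y + X * Y * l1) * t ^ 10 + (2 * Y * l1 + 2 * X * Y * l2) * t ^ 7
         + (Y * (l2 + 3 * l3 * X + X\<^sup>2)) * t ^ 4 + (2 * X * Y) * t)
      + ((3 * l0 + 2 * X * l1 + X\<^sup>2 * l2) * (hh t * t ^ 6)
         + (l1 + 2 * X * l2 + 3 * l3 * X\<^sup>2 + 2 * X ^ 3) * (hh t * t ^ 3) + X\<^sup>2 * hh t)) has_fps_expansion BF"
    unfolding BF_def by (intro has_fps_expansion_add has_fps_expansion_cmult_left has_fps_expansion_mult hh_fps has_fps_expansion_fps_X_power has_fps_expansion_fps_X)
  also have "(\<lambda>t. 3 * Y\<^sup>2 * (hh t * hh t * t ^ 2)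
      + ((3 * l0 * Y + X * Y * l1) * t ^ 10 + (2 * Y * l1 + 2 * X * Y * l2) * t ^ 7
         + (Y * (l2 + 3 * l3 * X + X\<^sup>2)) * t ^ 4 + (2 * X * Y) * t)
      + ((3 * l0 + 2 * X * l1 + X\<^sup>2 * l2) * (hh t * t ^ 6)
         + (l1 + 2 * X * l2 + 3 * l3 * X\<^sup>2 + 2 * X ^ 3) * (hh t * t ^ 3) + X\<^sup>2 * hh t)) = B"
    unfolding B_def by (intro ext) algebra
  finally have BF: "B has_fps_expansion BF" .
  have AF: "A has_fps_expansion AF"
    unfolding A_def AF_def
    by (intro has_fps_expansion_add has_fps_expansion_mult hh_fps has_fps_expansion_fps_X_power has_fps_expansion_fps_X SF)
  have "(\<lambda>t. t * (A t * (1 - X * t ^ 3)\<^sup>2 - B t)) has_fps_expansion fps_X * (AF * (1 - fps_const X * fps_X ^ 3)\<^sup>2 - BF)"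
    by (intro fps_expansion_intros AF BF)
  then have "(\<lambda>_. 0) has_fps_expansion fps_X * (AF * (1 - fps_const X * fps_X ^ 3)\<^sup>2 - BF)"
    by (rule has_fps_expansion_transform[OF _ ev])
  then have "fps_X * (AF * (1 - fps_const X * fps_X ^ 3)\<^sup>2 - BF) = 0"
    using fps_expansion_unique_complex has_fps_expansion_0 by blast
  then have "AF * (1 - fps_const X * fps_X ^ 3)\<^sup>2 = BF" by simp
  moreover have "AF * (1 - fps_const X * fps_X ^ 3)\<^sup>2 = AF - fps_const (2 * X) * (AF * fps_X ^ 3) + fps_const (X\<^sup>2) * (AF * fps_X ^ 6)"
  proof -
    have "fps_const (2 * X) = 2 * fps_const X" "fps_const (X\<^sup>2) = (fps_const X)\<^sup>2"
      by (simp_all add: numeral_fps_const fps_const_power)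
    then show ?thesis by algebra
  qed
  ultimately have BF_eq: "BF = AF - fps_const (2 * X) * (AF * fps_X ^ 3) + fps_const (X\<^sup>2) * (AF * fps_X ^ 6)" by simp
  \<comment> \<open>The shifts by 3 and 6 come from expanding (1 - X t^3)^2; up to order 4 only the
    first one contributes.\<close>
  have eq: "fps_nth AF n - 2 * X * (if n < 3 then 0 else fps_nth AF (n - 3)) + X\<^sup>2 * (if n < 6 then 0 else fps_nth AF (n - 6)) = fps_nth BF n" for n
    unfolding BF_eq fps_add_nth fps_sub_nth fps_mult_left_const_nth fps_X_power_mult_right_nth by (rule refl)
  have SFn: "fps_nth (SF i) n = fps_nth (E [i, 1] u) n + X * fps_nth (E [i, 2] u) n + Y * fps_nth (E [i, 3] u) n" for i n
    by (simp add: SF_def)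
  have E0: "fps_nth (SF i) 0 = Lw u X Y [i]" for i
    by (simp add: SFn E_nth_0 nz)
  have E1: "fps_nth (SF i) (Suc 0) = Lw u X Y [3, i]" for i
    by (simp add: SFn E_nth_1 nz)
  have E2: "fps_nth (SF i) 2 = (Lw u X Y [3, 3, i] + Lw u X Y [2, i]) / 2" for i
    by (simp add: SFn E_nth_2 nz field_simps)
  have E3: "fps_nth (SF i) 3 = Lw u X Y [3, 3, 3, i] / 6 + Lw u X Y [2, 3, i] / 6 + Lw u X Y [3, 2, i] / 3" for i
    by (simp add: SFn E_nth_3 nz field_simps)
  have E4: "fps_nth (SF i) 4 = Lw u X Y [3, 3, 3, 3, i] / 24 + Lw u X Y [2, 3, 3, i] / 24 + Lw u X Y [3, 2, 3, i] / 12
     + (Lw u X Y [3, 3, 2, i] + Lw u X Y [2, 2, i]) / 8 - l3 / 12 * Lw u X Y [3, i]" for i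
    by (simp add: SFn E_nth_4 nz field_simps)
  have A0: "fps_nth AF 0 = fps_nth (SF 3) 0"
    and A1: "fps_nth AF (Suc 0) = fps_nth (SF 3) (Suc 0) + fps_nth (SF 2) 0"
    and A2: "fps_nth AF 2 = fps_nth (SF 3) 2 + fps_nth (SF 2) (Suc 0)"
    and A3: "fps_nth AF 3 = fps_nth (SF 3) 3 + l3 / 3 * fps_nth (SF 3) 0 + fps_nth (SF 2) 2"
    and A4: "fps_nth AF 4 = fps_nth (SF 3) 4 + l3 / 3 * fps_nth (SF 3) (Suc 0) + fps_nth (SF 2) 3 + fps_nth (SF 1) 0"
    by (simp_all add: AF_def fps_mult_nth_small H_nth fps_X_power_mult_nth numeral_2_eq_2[symmetric])
  have B0: "fps_nth BF 0 = X\<^sup>2"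
    and B1: "fps_nth BF (Suc 0) = 2 * X * Y"
    and B2: "fps_nth BF 2 = 3 * Y\<^sup>2"
    and B3: "fps_nth BF 3 = l1 + 2 * X * l2 + 3 * l3 * X\<^sup>2 + 2 * X ^ 3 + X\<^sup>2 * l3 / 3"
    and B4: "fps_nth BF 4 = Y * (l2 + 3 * l3 * X + X\<^sup>2)"
    by (simp_all add: BF_def fps_mult_nth_small H_nth fps_X_power_mult_right_nth)
  have aux1: "a + l3 / 3 * X\<^sup>2 + b - 2 * X * X\<^sup>2 = l1 + 2 * X * l2 + 3 * l3 * X\<^sup>2 + 2 * X ^ 3 + X\<^sup>2 * l3 / 3
      \<Longrightarrow> a + b = 4 * X ^ 3 + 3 * l3 * X\<^sup>2 + 2 * l2 * X + l1" for a b :: complex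
  proof -
    assume h: "a + l3 / 3 * X\<^sup>2 + b - 2 * X * X\<^sup>2 = l1 + 2 * X * l2 + 3 * l3 * X\<^sup>2 + 2 * X ^ 3 + X\<^sup>2 * l3 / 3"
    have "a + b = (a + l3 / 3 * X\<^sup>2 + b - 2 * X * X\<^sup>2) - l3 / 3 * X\<^sup>2 + 2 * X * X\<^sup>2"
      by simp
    then show ?thesis unfolding h by (simp add: algebra_simps power2_eq_square power3_eq_cube)
  qed
  have aux2: "a - l3 / 12 * q + l3 / 3 * q + (p + s + r) + d - 2 * X * (2 * X * Y) = Y * (l2 + 3 * l3 * X + X\<^sup>2)
      \<Longrightarrow> a + l3 / 4 * q + p + s + r + d = Y * (5 * X\<^sup>2 + 3 * l3 * X + l2)" for a p q r s d :: complex
  proof -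
    assume h: "a - l3 / 12 * q + l3 / 3 * q + (p + s + r) + d - 2 * X * (2 * X * Y) = Y * (l2 + 3 * l3 * X + X\<^sup>2)"
    have "a + l3 / 4 * q + p + s + r + d
        = (a - l3 / 12 * q + l3 / 3 * q + (p + s + r) + d - 2 * X * (2 * X * Y)) + 4 * X * X * Y"
      by simp
    then show ?thesis unfolding h by (simp add: algebra_simps power2_eq_square)
  qed
  show O0: "Lw u X Y [3] = X\<^sup>2"
    using eq[of 0] by (simp add: A0 B0 E0)
  show O1: "Lw u X Y [3, 3] + Lw u X Y [2] = 2 * X * Y"
    using eq[of "Suc 0"] unfolding A1 B1 E0 E1 by simp
  show "(Lw u X Y [3, 3, 3] + Lw u X Y [2, 3]) / 2 + Lw u X Y [3, 2] = 3 * Y\<^sup>2"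
    using eq[of 2] unfolding A2 B2 E1 E2 by simp
  have "fps_nth AF 3 - 2 * X * fps_nth AF 0 = fps_nth BF 3" using eq[of 3] by simp
  then show "Lw u X Y [3, 3, 3, 3] / 6 + Lw u X Y [2, 3, 3] / 6 + Lw u X Y [3, 2, 3] / 3
       + (Lw u X Y [3, 3, 2] + Lw u X Y [2, 2]) / 2 = 4 * X ^ 3 + 3 * l3 * X\<^sup>2 + 2 * l2 * X + l1"
    unfolding A3 A0 B3 E3 E2 E0 O0 by (rule aux1)
  have "fps_nth AF 4 - 2 * X * fps_nth AF (Suc 0) = fps_nth BF 4" using eq[of 4] by simp
  then have "fps_nth (SF 3) 4 + l3 / 3 * Lw u X Y [3, 3] + fps_nth (SF 2) 3 + Lw u X Y [1] - 2 * X * (2 * X * Y) = Y * (l2 + 3 * l3 * X + X\<^sup>2)"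
    unfolding A4 A1 B4 E1 E0 O1 .
  then show "Lw u X Y [3, 3, 3, 3, 3] / 24 + Lw u X Y [2, 3, 3, 3] / 24 + Lw u X Y [3, 2, 3, 3] / 12
       + (Lw u X Y [3, 3, 2, 3] + Lw u X Y [2, 2, 3]) / 8 + l3 / 4 * Lw u X Y [3, 3]
       + Lw u X Y [3, 3, 3, 2] / 6 + Lw u X Y [2, 3, 2] / 6 + Lw u X Y [3, 2, 2] / 3 + Lw u X Y [1]
      = Y * (5 * X\<^sup>2 + 3 * l3 * X + l2)"
    unfolding E4 E3 by (rule aux2)
qed

end

section \<open>Divisors of degree three\<close>

text \<open>The determinant of the matrix with rows (1, x_k, y_k): it is nonzero exactly if 1, x, y
  are linearly independent on the three points.\<close>

definition plane_det :: "(3 \<Rightarrow> complex) \<Rightarrow> (3 \<Rightarrow> complex) \<Rightarrow> complex" where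
  "plane_det x y = (x 2 - x 1) * (y 3 - y 1) - (x 3 - x 1) * (y 2 - y 1)"

lemma plane_det_columns:
  assumes "plane_det x y \<noteq> 0" and "\<And>k. A + x k * B + y k * C = 0"
  shows "A = 0" "B = 0" "C = 0"
proof -
  have e: "A + x 1 * B + y 1 * C = 0" "A + x 2 * B + y 2 * C = 0" "A + x 3 * B + y 3 * C = 0"
    using assms(2) by auto
  have "plane_det x y * C = 0" unfolding plane_det_def using e by algebra
  moreover have "plane_det x y * B = 0" unfolding plane_det_def using e by algebra
  ultimately show B: "B = 0" and C: "C = 0" using assms(1) by auto
  show "A = 0" using e(1) B C by simp
qed

text \<open>Cramer's rule for the transposed matrix. It serves for the Jacobian of the Abel sum,
  while \<open>plane_det_columns\<close> serves to compare coordinates.\<close>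

lemma plane_det_rows:
  fixes a x y :: "3 \<Rightarrow> complex" and k :: 3
  assumes "plane_det x y \<noteq> 0"
    and e: "a 1 + a 2 + a 3 = 0" "x 1 * a 1 + x 2 * a 2 + x 3 * a 3 = 0" "y 1 * a 1 + y 2 * a 2 + y 3 * a 3 = 0"
  shows "a k = 0"
proof -
  have "plane_det x y * a 1 = 0" "plane_det x y * a 2 = 0" "plane_det x y * a 3 = 0"
    unfolding plane_det_def using e by algebra+
  then have "a 1 = 0" "a 2 = 0" "a 3 = 0" using assms(1) by auto
  then show ?thesis using exhaust_3[of k] by auto
qed

text \<open>Functions on the three points form an algebra with basis 1, x, y, whose multiplication
  table is given by \<open>R1\<close>, \<open>R2\<close>, \<open>R3\<close>. Each conclusion
  compares a coordinate of one function computed in two ways.\<close>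

lemma three_point_algebra:
  fixes x y :: "3 \<Rightarrow> complex"
  assumes nd: "plane_det x y \<noteq> 0"
    and R1: "\<And>k. p13 + x k * p23 + y k * p33 = (x k)\<^sup>2"
    and R2: "\<And>k. c + x k * b + y k * a = x k * y k"
    and R3: "\<And>k. f + x k * e + y k * d = (y k)\<^sup>2"
    and R4: "\<And>k. g1 + x k * g2 + y k * g3 = 4 * x k ^ 3 + 3 * l3 * (x k)\<^sup>2 + 2 * l2 * x k + l1"
    and R5: "\<And>k. k1 + x k * k2 + y k * k3 = y k * (5 * (x k)\<^sup>2 + 3 * l3 * x k + l2)"
    and curve: "\<And>k. y k ^ 3 = x k ^ 4 + l3 * x k ^ 3 + l2 * (x k)\<^sup>2 + l1 * x k + l0"
  shows "p13 = a\<^sup>2 + b * p33 - p33 * d - p23 * a"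
    and "c = p33 * e - a * b"
    and "f = a * e + b\<^sup>2 - d * b - e * p23"
    and "g3 = 4 * (p33 * a + p23 * p33) + 3 * l3 * p33"
    and "g2 = 4 * (p33 * b + p23\<^sup>2 + p13) + 3 * l3 * p23 + 2 * l2"
    and "g1 = 4 * (p33 * c + p23 * p13) + 3 * l3 * p13 + l1"
    and "k1 = 5 * (a * c + b * p13) + 3 * l3 * c"
    and "d\<^sup>2 + e * a + f = (p33 * a + p23 * p33) * a + (p33 * b + p23\<^sup>2 + p13) * p33 + l3 * (p33 * a + p23 * p33) + l2 * p33"
    and "d * e + e * b = (p33 * a + p23 * p33) * b + (p33 * b + p23\<^sup>2 + p13) * p23 + p33 * c + p23 * p13
      + l3 * (p33 * b + p23\<^sup>2 + p13) + l2 * p23 + l1"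
    and "d * f + e * c = (p33 * a + p23 * p33) * c + (p33 * b + p23\<^sup>2 + p13) * p13
      + l3 * (p33 * c + p23 * p13) + l2 * p13 + l0"
proof -
  \<comment> \<open>The product of x^2 and y against the product of x and xy.\<close>
  have "(p33 * f + p23 * c - a * c - b * p13) + x k * (p33 * e + p23 * b - a * b - b * p23 - c)
      + y k * (p33 * d + p23 * a + p13 - a\<^sup>2 - b * p33) = 0" for k
    using R1[of k] R2[of k] R3[of k] by algebra
  note 1 = plane_det_columns[OF nd this]
  show "p13 = a\<^sup>2 + b * p33 - p33 * d - p23 * a" using 1(3) by algebra
  show "c = p33 * e - a * b" using 1(2) by algebra
  \<comment> \<open>The product of x and y^2 against the product of xy and y.\<close>
  have "(d * c + e * p13 - a * f - b * c) + x k * (d * b + e * p23 + f - a * e - b\<^sup>2)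
      + y k * (d * a + e * p33 - a * d - b * a - c) = 0" for k
    using R1[of k] R2[of k] R3[of k] by algebra
  note 2 = plane_det_columns[OF nd this]
  show "f = a * e + b\<^sup>2 - d * b - e * p23" using 2(2) by algebra
  have x3: "x k ^ 3 = (p33 * c + p23 * p13) + x k * (p33 * b + p23\<^sup>2 + p13) + y k * (p33 * a + p23 * p33)" for k
    using R1[of k] R2[of k] by algebra
  have "(g1 - 4 * (p33 * c + p23 * p13) - 3 * l3 * p13 - l1) + x k * (g2 - 4 * (p33 * b + p23\<^sup>2 + p13) - 3 * l3 * p23 - 2 * l2)
    + y k * (g3 - 4 * (p33 * a + p23 * p33) - 3 * l3 * p33) = 0" for k
    using R1[of k] R4[of k] x3[of k] by algebra
  note 3 = plane_det_columns[OF nd this]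
  show "g3 = 4 * (p33 * a + p23 * p33) + 3 * l3 * p33" using 3(3) by algebra
  show "g2 = 4 * (p33 * b + p23\<^sup>2 + p13) + 3 * l3 * p23 + 2 * l2" using 3(2) by algebra
  show "g1 = 4 * (p33 * c + p23 * p13) + 3 * l3 * p13 + l1" using 3(1) by algebra
  have x2y: "x k * (x k * y k) = (a * c + b * p13) + x k * (a * b + b * p23 + c) + y k * (a\<^sup>2 + b * p33)" for k
    using R1[of k] R2[of k] by algebra
  have "(k1 - 5 * (a * c + b * p13) - 3 * l3 * c) + x k * (k2 - 5 * (a * b + b * p23 + c) - 3 * l3 * b)
    + y k * (k3 - 5 * (a\<^sup>2 + b * p33) - 3 * l3 * a - l2) = 0" for k
    using R2[of k] R5[of k] x2y[of k] by algebra
  \<comment> \<open>Only the constant coordinate is recorded: it is the one that will contain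
    \<open>P 2 0 0\<close>.\<close>
  from plane_det_columns(1)[OF nd this] show "k1 = 5 * (a * c + b * p13) + 3 * l3 * c" by algebra
  have y3: "y k ^ 3 = (d * f + e * c) + x k * (d * e + e * b) + y k * (d\<^sup>2 + e * a + f)" for k
    using R2[of k] R3[of k] by algebra
  have x4: "x k ^ 4 = ((p33 * a + p23 * p33) * c + (p33 * b + p23\<^sup>2 + p13) * p13)
      + x k * ((p33 * a + p23 * p33) * b + (p33 * b + p23\<^sup>2 + p13) * p23 + p33 * c + p23 * p13)
      + y k * ((p33 * a + p23 * p33) * a + (p33 * b + p23\<^sup>2 + p13) * p33)" for k
    using R1[of k] R2[of k] x3[of k] by algebra
  \<comment> \<open>The equation y^3 = f(x) in the basis 1, x, y.\<close>
  have "(d * f + e * c - ((p33 * a + p23 * p33) * c + (p33 * b + p23\<^sup>2 + p13) * p13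
      + l3 * (p33 * c + p23 * p13) + l2 * p13 + l0))
    + x k * (d * e + e * b - ((p33 * a + p23 * p33) * b + (p33 * b + p23\<^sup>2 + p13) * p23 + p33 * c + p23 * p13
      + l3 * (p33 * b + p23\<^sup>2 + p13) + l2 * p23 + l1))
    + y k * (d\<^sup>2 + e * a + f - ((p33 * a + p23 * p33) * a + (p33 * b + p23\<^sup>2 + p13) * p33 + l3 * (p33 * a + p23 * p33) + l2 * p33)) = 0" for k
    using curve[of k] R1[of k] x3[of k] x4[of k] y3[of k] by algebra
  note 4 = plane_det_columns[OF nd this]
  show "d\<^sup>2 + e * a + f = (p33 * a + p23 * p33) * a + (p33 * b + p23\<^sup>2 + p13) * p33 + l3 * (p33 * a + p23 * p33) + l2 * p33"
    using 4(3) by simp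
  show "d * e + e * b = (p33 * a + p23 * p33) * b + (p33 * b + p23\<^sup>2 + p13) * p23 + p33 * c + p23 * p13
      + l3 * (p33 * b + p23\<^sup>2 + p13) + l2 * p23 + l1"
    using 4(2) by simp
  show "d * f + e * c = (p33 * a + p23 * p33) * c + (p33 * b + p23\<^sup>2 + p13) * p13
      + l3 * (p33 * c + p23 * p13) + l2 * p13 + l0"
    using 4(1) by simp
qed

section \<open>An open set of Abel sums of three points\<close>

context curve_at_infinity
begin

definition triples :: "(complex ^ 3) set" where
  "triples = {s. (\<forall>m. s $ m \<in> ball 0 eps - {0}) \<and> plane_det (\<lambda>m. xx (s $ m)) (\<lambda>m. yy (s $ m)) \<noteq> 0}"

lemma open_triples: "open triples"
proof -
  let ?A = "{s::complex ^ 3. \<forall>m. s $ m \<in> ball 0 eps - {0}}"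
  have "?A = (\<Inter>m\<in>UNIV. (\<lambda>s. s $ m) -` (ball 0 eps - {0}))" by auto
  moreover have "open ((\<lambda>s::complex ^ 3. s $ m) -` (ball 0 eps - {0}))" for m
    by (intro open_vimage open_delete open_ball continuous_on_component continuous_on_id)
  ultimately have A: "open ?A" by (simp add: open_INT)
  have "continuous_on (ball 0 eps - {0}) xx"
    unfolding xx_def by (intro continuous_intros) auto
  then have x: "continuous_on ?A (\<lambda>s. xx (s $ m))" for m
    by (rule continuous_on_compose2) (auto intro: continuous_on_component continuous_on_id)
  have "continuous_on (ball 0 eps - {0}) yy"
    unfolding yy_def
    by (intro continuous_on_divide continuous_on_subset[OF holomorphic_on_imp_continuous_on[OF hh_holomorphic[OF eps(1)]]])
      (auto intro: continuous_intros)
  then have y: "continuous_on ?A (\<lambda>s. yy (s $ m))" for m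
    by (rule continuous_on_compose2) (auto intro: continuous_on_component continuous_on_id)
  have "continuous_on ?A (\<lambda>s. plane_det (\<lambda>m. xx (s $ m)) (\<lambda>m. yy (s $ m)))"
    unfolding plane_det_def by (intro continuous_on_diff continuous_on_mult x y)
  moreover have "open (- {0::complex})" by (simp add: open_Compl)
  ultimately have "open (?A \<inter> (\<lambda>s. plane_det (\<lambda>m. xx (s $ m)) (\<lambda>m. yy (s $ m))) -` (- {0}))"
    by (rule continuous_open_preimage[OF _ A])
  also have "?A \<inter> (\<lambda>s. plane_det (\<lambda>m. xx (s $ m)) (\<lambda>m. yy (s $ m))) -` (- {0}) = triples"
    by (auto simp: triples_def)
  finally show ?thesis .
qed

text \<open>The points with parameters \<open>\<delta>, \<delta>/2, \<delta>/3\<close> have determinant \<open>\<sim> 170 \<delta>\<^sup>-\<^sup>7\<close> as \<open>\<delta> \<rightarrow> 0\<close>.\<close>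

lemma triples_nonempty: "triples \<noteq> {}"
proof -
  \<comment> \<open>The factors 7 = 2^3 - 1 and 26 = 3^3 - 1 come from differences of x = t^-3, and
    16 = 2^4 and 81 = 3^4 from y = h t^-4. At 0 the value is 7 * 80 - 26 * 15 = 170.\<close>
  define K where "K = (\<lambda>\<delta>. 7 * (81 * hh (\<delta> / 3) - hh \<delta>) - 26 * (16 * hh (\<delta> / 2) - hh \<delta>))"
  have h: "isCont hh 0"
    using holomorphic_on_imp_continuous_on[OF hh_holomorphic[OF eps(1)]] eps_pos
    by (simp add: continuous_on_eq_continuous_at)
  have hc: "isCont (\<lambda>\<delta>. hh (\<delta> / c)) 0" for c
  proof -
    have "isCont (\<lambda>\<delta>. \<delta> / c) 0" by (cases "c = 0") (auto intro: continuous_intros)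
    from isCont_o2[OF this, of hh] h show ?thesis by simp
  qed
  have "isCont K 0" unfolding K_def by (intro continuous_diff continuous_mult continuous_const hc h)
  moreover have "K 0 \<noteq> 0" by (simp add: K_def)
  ultimately obtain e where e: "e > 0" "\<And>\<delta>. dist 0 \<delta> < e \<Longrightarrow> K \<delta> \<noteq> 0"
    using continuous_at_avoid[of 0 K 0] by blast
  define r where "r = min e eps / 2"
  have r: "0 < r" "r < e" "r < eps" using e(1) eps_pos by (auto simp: r_def)
  define \<delta> :: complex where "\<delta> = of_real r"
  have d: "\<delta> \<noteq> 0" "norm \<delta> = r" using r by (auto simp: \<delta>_def)
  have K: "K \<delta> \<noteq> 0" using e(2)[of \<delta>] d r by simp
  let ?s = "vector [\<delta>, \<delta> / 2, \<delta> / 3] :: complex ^ 3"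
  have "plane_det (\<lambda>m. xx (?s $ m)) (\<lambda>m. yy (?s $ m)) = K \<delta> / \<delta> ^ 7"
    using d(1) by (simp add: plane_det_def xx_def yy_def K_def vector_3 field_simps)
  moreover have "?s $ m \<in> ball 0 eps - {0}" for m
  proof -
    have "r < eps * 2" "r < eps * 3" using r by auto
    then show ?thesis using exhaust_3[of m] d r(3) by (auto simp: vector_3 norm_divide)
  qed
  ultimately have "?s \<in> triples" using K d(1) by (simp add: triples_def)
  then show ?thesis by blast
qed

definition abel_sum :: "complex ^ 3 \<Rightarrow> complex ^ 3" where
  "abel_sum s = (\<Sum>m\<in>UNIV. vv (s $ m))"

lemma abel_sum_has_derivative:
  assumes "s \<in> triples"
  shows "(abel_sum has_derivative (\<lambda>h. \<Sum>m\<in>UNIV. \<chi> j. - ww j (s $ m) * h $ m)) (at s)"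
  unfolding abel_sum_def
proof (rule has_derivative_sum)
  fix m :: 3
  have c: "((\<lambda>s::complex ^ 3. s $ m) has_derivative (\<lambda>h. h $ m)) (at s)"
    by (rule bounded_linear_imp_has_derivative[OF bounded_linear_vec_nth])
  have "s $ m \<in> ball 0 eps" using assms unfolding triples_def by blast
  from has_derivative_compose[OF c vv_has_derivative[OF this]]
  show "((\<lambda>s. vv (s $ m)) has_derivative (\<lambda>h. \<chi> j. - ww j (s $ m) * h $ m)) (at s)" .
qed

text \<open>As w_2 = x w_1 and w_3 = y w_1, the Jacobian is, up to sign, the transposed matrix of
  \<open>plane_det\<close> times the diagonal matrix of the values of w_1, and these are nonzero for
  t \<noteq> 0.\<close>

lemma abel_sum_derivative_inj:
  assumes s: "s \<in> triples" and z: "(\<Sum>m\<in>UNIV. \<chi> j. - ww j (s $ m) * h $ m) = (0 :: complex ^ 3)"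
  shows "h = 0"
proof -
  let ?t = "\<lambda>m. s $ m"
  have t: "?t m \<noteq> 0" for m using s unfolding triples_def by auto
  define a where "a m = ww 1 (?t m) * h $ m" for m
  have w: "ww 2 (?t m) = xx (?t m) * ww 1 (?t m)" "ww 3 (?t m) = yy (?t m) * ww 1 (?t m)" for m
    using t[of m] by (simp_all add: ww_simps xx_def yy_def field_simps eval_nat_numeral)
  have zj: "(\<Sum>m\<in>UNIV. - ww j (?t m) * h $ m) = 0" for j
  proof -
    have "(\<Sum>m\<in>UNIV. \<chi> j. - ww j (s $ m) * h $ m) $ j = (0 :: complex ^ 3) $ j"
      by (simp only: z)
    then show ?thesis unfolding sum_component vec_lambda_beta zero_index .
  qed
  have a0: "a k = 0" for k
  proof (rule plane_det_rows)
    show "plane_det (\<lambda>m. xx (?t m)) (\<lambda>m. yy (?t m)) \<noteq> 0" using s unfolding triples_def by blast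
    show "a 1 + a 2 + a 3 = 0"
      using zj[of 1] unfolding sum_3 a_def by algebra
    show "xx (?t 1) * a 1 + xx (?t 2) * a 2 + xx (?t 3) * a 3 = 0"
      using zj[of 2] unfolding sum_3 a_def w by algebra
    show "yy (?t 1) * a 1 + yy (?t 2) * a 2 + yy (?t 3) * a 3 = 0"
      using zj[of 3] unfolding sum_3 a_def w by algebra
  qed
  have "h $ m = 0" for m using a0[of m] t[of m] by (simp add: a_def ww_simps)
  then show ?thesis by (simp add: vec_eq_iff)
qed

lemma interior_abel_sum_triples: "interior (abel_sum ` triples) \<noteq> {}"
proof -
  obtain s where s: "s \<in> triples" using triples_nonempty by blast
  define D where "D = (\<lambda>h::complex ^ 3. \<Sum>m\<in>UNIV. \<chi> j. - ww j (s $ m) * h $ m)"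
  have der: "(abel_sum has_derivative D) (at s)" unfolding D_def by (rule abel_sum_has_derivative[OF s])
  then have lin: "linear D" by (rule has_derivative_linear)
  have "D h = 0 \<Longrightarrow> h = 0" for h unfolding D_def by (rule abel_sum_derivative_inj[OF s])
  then have "inj D" using linear_injective_0[OF lin] by simp
  from linear_injective_isomorphism[OF lin this]
  obtain g where g: "linear g" "\<And>x. D (g x) = x" by blast
  have "abel_sum s \<in> interior (abel_sum ` triples)"
  proof (rule sussmann_open_mapping[OF open_triples _ s der])
    show "continuous_on triples abel_sum"
      by (intro continuous_at_imp_continuous_on ballI has_derivative_continuous[OF abel_sum_has_derivative])
    show "bounded_linear g" using g(1) by (simp add: linear_conv_bounded_linear)
    show "D \<circ> g = id" by (rule ext) (simp only: o_apply id_apply g(2))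
    show "s \<in> interior triples" using s open_triples by (simp add: interior_open)
  qed auto
  then show ?thesis by blast
qed

end

section \<open>Relations between the structure constants\<close>

text \<open>A certificate: once the two multipliers are given, a polynomial identity is all that
  remains.\<close>

lemma linear_combination2:
  "L - R = k1 * (a1 - b1) + k2 * (a2 - b2) \<Longrightarrow> a1 = b1 \<Longrightarrow> a2 = b2 \<Longrightarrow> L = (R :: complex)"
  by simp

context sigma_curve
begin

text \<open>\<open>P a b c\<close> is \<open>\<wp>\<close> with index \<open>1\<close> repeated \<open>a\<close> times, \<open>2\<close> repeated \<open>b\<close> times and \<open>3\<close> repeated \<open>c\<close> times.\<close>

definition P :: "nat \<Rightarrow> nat \<Rightarrow> nat \<Rightarrow> complex ^ 3 \<Rightarrow> complex" where
  "P a b c = wps (replicate a 1 @ replicate b 2 @ replicate c 3)"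

lemma wps_P:
  assumes "\<sigma> u \<noteq> 0"
  shows "wps js u = P (count_list js 1) (count_list js 2) (count_list js 3) u"
  unfolding P_def
proof (rule wps_perm[OF multiset_eqI assms])
  fix x :: 3
  show "count (mset js) x = count (mset (replicate (count_list js 1) 1 @ replicate (count_list js 2) 2 @ replicate (count_list js 3) 3)) x"
    using exhaust_3[of x] by (auto simp: count_mset)
qed

lemma mero3_P: "mero3 \<sigma> (P a b c)"
  unfolding P_def by (rule mero3_wps)

lemma haspd_P:
  assumes u: "\<sigma> u \<noteq> 0" and "0 < a + b + c"
  shows "haspd 1 (P a b c) (P (a + 1) b c u) u"
    and "haspd 2 (P a b c) (P a (b + 1) c u) u"
    and "haspd 3 (P a b c) (P a b (c + 1) u) u"
proof -
  let ?js = "replicate a 1 @ replicate b 2 @ replicate c 3 :: 3 list"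
  have ne: "?js \<noteq> []" using assms(2) by auto
  have c: "count_list (replicate n x) y = (if x = y then n else 0)" for n and x y :: 3
    by (induction n) auto
  have "wps (1 # ?js) u = P (a + 1) b c u" "wps (2 # ?js) u = P a (b + 1) c u" "wps (3 # ?js) u = P a b (c + 1) u"
    by (simp_all add: wps_P[OF u] c)
  then show "haspd 1 (P a b c) (P (a + 1) b c u) u" "haspd 2 (P a b c) (P a (b + 1) c u) u"
    "haspd 3 (P a b c) (P a b (c + 1) u) u"
    using haspd_wps[OF u ne, of 1] haspd_wps[OF u ne, of 2] haspd_wps[OF u ne, of 3]
    unfolding P_def[of a b c] by simp_all
qed

lemma P_parity:
  assumes "\<sigma> u \<noteq> 0" "0 < a + b + c"
  shows "P a b c (- u) = (- 1) ^ (a + b + c) * P a b c u"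
  unfolding P_def by (subst wps_parity) (use assms in \<open>auto simp: add.assoc\<close>)

text \<open>
  On the divisor, \<open>xy = cA y + cB x + cC\<close> and \<open>y\<^sup>2 = cD y + cE x + cF\<close>, while
  \<open>x\<^sup>2 = \<wp>\<^sub>3\<^sub>3 y + \<wp>\<^sub>2\<^sub>3 x + \<wp>\<^sub>1\<^sub>3\<close>.
\<close>

abbreviation "cA u \<equiv> (P 0 0 3 u + P 0 1 1 u) / 2"
abbreviation "cB u \<equiv> (P 0 1 2 u + P 0 2 0 u) / 2"
abbreviation "cC u \<equiv> (P 1 0 2 u + P 1 1 0 u) / 2"
abbreviation "cD u \<equiv> (P 0 0 4 u + 3 * P 0 1 2 u) / 6"
abbreviation "cE u \<equiv> (P 0 1 3 u + 3 * P 0 2 1 u) / 6"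
abbreviation "cF u \<equiv> (P 1 0 3 u + 3 * P 1 1 1 u) / 6"

text \<open>Left minus right sides of the ten conclusions of \<open>three_point_algebra\<close>, in
  the same order. Kept as functions of \<open>u\<close>, they are all extended from the open set by
  one argument.\<close>

definition defects :: "(complex ^ 3 \<Rightarrow> complex) list" where
  "defects = [
    \<lambda>u. P 1 0 1 u - ((cA u)\<^sup>2 + cB u * P 0 0 2 u - P 0 0 2 u * cD u - P 0 1 1 u * cA u),
    \<lambda>u. cC u - (P 0 0 2 u * cE u - cA u * cB u),
    \<lambda>u. cF u - (cA u * cE u + (cB u)\<^sup>2 - cD u * cB u - cE u * P 0 1 1 u),
    \<lambda>u. P 0 0 5 u / 6 + P 0 1 3 u + P 0 2 1 u / 2 - (4 * (P 0 0 2 u * cA u + P 0 1 1 u * P 0 0 2 u) + 3 * l3 * P 0 0 2 u),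
    \<lambda>u. P 0 1 4 u / 6 + P 0 2 2 u + P 0 3 0 u / 2
      - (4 * (P 0 0 2 u * cB u + (P 0 1 1 u)\<^sup>2 + P 1 0 1 u) + 3 * l3 * P 0 1 1 u + 2 * l2),
    \<lambda>u. P 1 0 4 u / 6 + P 1 1 2 u + P 1 2 0 u / 2
      - (4 * (P 0 0 2 u * cC u + P 0 1 1 u * P 1 0 1 u) + 3 * l3 * P 1 0 1 u + l1),
    \<lambda>u. P 1 0 5 u / 24 + 5 / 12 * P 1 1 3 u + 5 / 8 * P 1 2 1 u + l3 / 4 * P 1 0 2 u + P 2 0 0 u
      - (5 * (cA u * cC u + cB u * P 1 0 1 u) + 3 * l3 * cC u),
    \<lambda>u. (cD u)\<^sup>2 + cE u * cA u + cF u - ((P 0 0 2 u * cA u + P 0 1 1 u * P 0 0 2 u) * cA u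
      + (P 0 0 2 u * cB u + (P 0 1 1 u)\<^sup>2 + P 1 0 1 u) * P 0 0 2 u
      + l3 * (P 0 0 2 u * cA u + P 0 1 1 u * P 0 0 2 u) + l2 * P 0 0 2 u),
    \<lambda>u. cD u * cE u + cE u * cB u - ((P 0 0 2 u * cA u + P 0 1 1 u * P 0 0 2 u) * cB u
      + (P 0 0 2 u * cB u + (P 0 1 1 u)\<^sup>2 + P 1 0 1 u) * P 0 1 1 u + P 0 0 2 u * cC u + P 0 1 1 u * P 1 0 1 u
      + l3 * (P 0 0 2 u * cB u + (P 0 1 1 u)\<^sup>2 + P 1 0 1 u) + l2 * P 0 1 1 u + l1),
    \<lambda>u. cD u * cF u + cE u * cC u - ((P 0 0 2 u * cA u + P 0 1 1 u * P 0 0 2 u) * cC u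
      + (P 0 0 2 u * cB u + (P 0 1 1 u)\<^sup>2 + P 1 0 1 u) * P 1 0 1 u
      + l3 * (P 0 0 2 u * cC u + P 0 1 1 u * P 1 0 1 u) + l2 * P 1 0 1 u + l0)]"

lemma defects_mero3: "F \<in> set defects \<Longrightarrow> mero3 \<sigma> F"
  unfolding defects_def list.set insert_iff empty_iff
  by (elim disjE FalseE; hypsubst)
    (intro mero3_diff[OF ent] mero3_add[OF ent] mero3_mult mero3_power[OF ent] mero3_divide_const[OF ent] mero3_P mero3_const)+

lemma defects_local:
  assumes u: "u \<in> interior (abel_sum ` triples)" and nz: "\<sigma> u \<noteq> 0"
  shows "\<forall>F\<in>set defects. F u = 0"
proof -
  obtain s where s: "s \<in> triples" "u = abel_sum s" using u interior_subset by blast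
  define x where "x = (\<lambda>k. xx (s $ k))"
  define y where "y = (\<lambda>k. yy (s $ k))"
  have \<tau>: "\<And>m. s $ m \<in> ball 0 eps - {0}" and nd: "plane_det x y \<noteq> 0"
    using s(1) unfolding triples_def x_def y_def by blast+
  have us: "u = (\<Sum>m\<in>UNIV. vv (s $ m))" using s(2) by (simp add: abel_sum_def)
  have xy: "xx (s $ k) = x k" "yy (s $ k) = y k" for k by (simp_all add: x_def y_def)
  note O = expansion_relations[OF \<tau> us nz, unfolded xy]
  have curve: "y k ^ 3 = x k ^ 4 + l3 * x k ^ 3 + l2 * (x k)\<^sup>2 + l1 * x k + l0" for k
    using on_curve[OF eps(1), of "s $ k"] \<tau>[of k]
    by (simp add: x_def y_def affine_curve_def algebra_simps power2_eq_square power3_eq_cube power4_eq_xxxx)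
  have R1: "P 1 0 1 u + x k * P 0 1 1 u + y k * P 0 0 2 u = (x k)\<^sup>2" for k
    using O(1)[of k] by (simp add: wps_P[OF nz] numeral_eq_Suc)
  have R2: "cC u + x k * cB u + y k * cA u = x k * y k" for k
  proof -
    have "cC u + x k * cB u + y k * cA u = (Lw u (x k) (y k) [3, 3] + Lw u (x k) (y k) [2]) / 2"
      by (simp add: wps_P[OF nz] numeral_eq_Suc) (simp add: field_simps)
    then show ?thesis unfolding O(2) by simp
  qed
  have R3: "cF u + x k * cE u + y k * cD u = (y k)\<^sup>2" for k
  proof -
    have "cF u + x k * cE u + y k * cD u = ((Lw u (x k) (y k) [3, 3, 3] + Lw u (x k) (y k) [2, 3]) / 2 + Lw u (x k) (y k) [3, 2]) / 3"
      by (simp add: wps_P[OF nz] numeral_eq_Suc) (simp add: field_simps)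
    then show ?thesis unfolding O(3) by simp
  qed
  have R4: "(P 1 0 4 u / 6 + P 1 1 2 u + P 1 2 0 u / 2) + x k * (P 0 1 4 u / 6 + P 0 2 2 u + P 0 3 0 u / 2)
      + y k * (P 0 0 5 u / 6 + P 0 1 3 u + P 0 2 1 u / 2) = 4 * x k ^ 3 + 3 * l3 * (x k)\<^sup>2 + 2 * l2 * x k + l1" for k
    unfolding O(4)[of k, symmetric] by (simp add: wps_P[OF nz] numeral_eq_Suc) (simp add: field_simps)
  \<comment> \<open>Reorderings of the same indices add up: 5/12 = 1/24 + 1/12 + 1/8 + 1/6 and 5/8 =
    1/8 + 1/6 + 1/3.\<close>
  have R5: "(P 1 0 5 u / 24 + 5 / 12 * P 1 1 3 u + 5 / 8 * P 1 2 1 u + l3 / 4 * P 1 0 2 u + P 2 0 0 u)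
      + x k * (P 0 1 5 u / 24 + 5 / 12 * P 0 2 3 u + 5 / 8 * P 0 3 1 u + l3 / 4 * P 0 1 2 u + P 1 1 0 u)
      + y k * (P 0 0 6 u / 24 + 5 / 12 * P 0 1 4 u + 5 / 8 * P 0 2 2 u + l3 / 4 * P 0 0 3 u + P 1 0 1 u)
      = y k * (5 * (x k)\<^sup>2 + 3 * l3 * x k + l2)" for k
    unfolding O(5)[of k, symmetric] by (simp add: wps_P[OF nz] numeral_eq_Suc) (simp add: field_simps)
  show ?thesis
    unfolding defects_def list.set ball_simps
    using three_point_algebra[OF nd R1 R2 R3 R4 R5 curve] by simp
qed

lemma defects_zero:
  assumes "\<sigma> u \<noteq> 0"
  shows "\<forall>F\<in>set defects. F u = 0"
proof
  fix F assume F: "F \<in> set defects"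
  show "F u = 0"
    by (rule mero3_zero[OF ent defects_mero3[OF F] open_interior interior_abel_sum_triples _ assms])
      (use defects_local F in blast)
qed

end

section \<open>Even and odd parts of the relations\<close>

context sigma_curve
begin

text \<open>The case s = 1 is the relation at \<open>u\<close> and s = -1 the one at
  \<open>- u\<close>, where exactly the functions with an odd number of indices change sign.\<close>

lemma defects_signed:
  assumes nz: "\<sigma> u \<noteq> 0" and s: "s = 1 \<or> s = - 1"
  shows "P 1 0 1 u = ((s * P 0 0 3 u + P 0 1 1 u) / 2)\<^sup>2 + (s * P 0 1 2 u + P 0 2 0 u) / 2 * P 0 0 2 u
      - P 0 0 2 u * ((P 0 0 4 u + 3 * (s * P 0 1 2 u)) / 6) - P 0 1 1 u * ((s * P 0 0 3 u + P 0 1 1 u) / 2)"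
    and "(s * P 1 0 2 u + P 1 1 0 u) / 2 = P 0 0 2 u * ((P 0 1 3 u + 3 * (s * P 0 2 1 u)) / 6)
      - (s * P 0 0 3 u + P 0 1 1 u) / 2 * ((s * P 0 1 2 u + P 0 2 0 u) / 2)"
    and "(P 1 0 3 u + 3 * (s * P 1 1 1 u)) / 6 = (s * P 0 0 3 u + P 0 1 1 u) / 2 * ((P 0 1 3 u + 3 * (s * P 0 2 1 u)) / 6)
      + ((s * P 0 1 2 u + P 0 2 0 u) / 2)\<^sup>2 - (P 0 0 4 u + 3 * (s * P 0 1 2 u)) / 6 * ((s * P 0 1 2 u + P 0 2 0 u) / 2)
      - (P 0 1 3 u + 3 * (s * P 0 2 1 u)) / 6 * P 0 1 1 u"
    and "s * P 0 0 5 u / 6 + P 0 1 3 u + s * P 0 2 1 u / 2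
      = 4 * (P 0 0 2 u * ((s * P 0 0 3 u + P 0 1 1 u) / 2) + P 0 1 1 u * P 0 0 2 u) + 3 * l3 * P 0 0 2 u"
    and "s * P 0 1 4 u / 6 + P 0 2 2 u + s * P 0 3 0 u / 2
      = 4 * (P 0 0 2 u * ((s * P 0 1 2 u + P 0 2 0 u) / 2) + (P 0 1 1 u)\<^sup>2 + P 1 0 1 u) + 3 * l3 * P 0 1 1 u + 2 * l2"
    and "s * P 1 0 4 u / 6 + P 1 1 2 u + s * P 1 2 0 u / 2
      = 4 * (P 0 0 2 u * ((s * P 1 0 2 u + P 1 1 0 u) / 2) + P 0 1 1 u * P 1 0 1 u) + 3 * l3 * P 1 0 1 u + l1"
    and "P 1 0 5 u / 24 + 5 / 12 * (s * P 1 1 3 u) + 5 / 8 * P 1 2 1 u + l3 / 4 * (s * P 1 0 2 u) + P 2 0 0 u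
      = 5 * ((s * P 0 0 3 u + P 0 1 1 u) / 2 * ((s * P 1 0 2 u + P 1 1 0 u) / 2) + (s * P 0 1 2 u + P 0 2 0 u) / 2 * P 1 0 1 u)
        + 3 * l3 * ((s * P 1 0 2 u + P 1 1 0 u) / 2)"
proof -
  define v where "v = (if s = 1 then u else - u)"
  have nzv: "\<sigma> v \<noteq> 0" using nz by (simp add: v_def)
  have Pv: "P a b c v = s ^ (a + b + c) * P a b c u" if "0 < a + b + c" for a b c
    using s P_parity[OF nz that] by (auto simp: v_def)
  have ev: "P 0 0 2 v = P 0 0 2 u" "P 0 1 1 v = P 0 1 1 u" "P 0 2 0 v = P 0 2 0 u" "P 1 0 1 v = P 1 0 1 u"
    "P 1 1 0 v = P 1 1 0 u" "P 2 0 0 v = P 2 0 0 u" "P 0 0 4 v = P 0 0 4 u" "P 0 1 3 v = P 0 1 3 u" "P 1 0 3 v = P 1 0 3 u"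
    "P 0 2 2 v = P 0 2 2 u" "P 1 1 2 v = P 1 1 2 u" "P 1 2 1 v = P 1 2 1 u" "P 1 0 5 v = P 1 0 5 u"
    using s by (auto simp: Pv)
  have od: "P 0 0 3 v = s * P 0 0 3 u" "P 0 1 2 v = s * P 0 1 2 u" "P 0 2 1 v = s * P 0 2 1 u" "P 1 0 2 v = s * P 1 0 2 u"
    "P 1 1 1 v = s * P 1 1 1 u" "P 0 0 5 v = s * P 0 0 5 u" "P 0 1 4 v = s * P 0 1 4 u" "P 0 3 0 v = s * P 0 3 0 u"
    "P 1 0 4 v = s * P 1 0 4 u" "P 1 2 0 v = s * P 1 2 0 u" "P 1 1 3 v = s * P 1 1 3 u"
    using s by (auto simp: Pv)
  note D = defects_zero[OF nzv, unfolded defects_def list.set ball_simps right_minus_eq ev od]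
  from D show
    "P 1 0 1 u = ((s * P 0 0 3 u + P 0 1 1 u) / 2)\<^sup>2 + (s * P 0 1 2 u + P 0 2 0 u) / 2 * P 0 0 2 u
      - P 0 0 2 u * ((P 0 0 4 u + 3 * (s * P 0 1 2 u)) / 6) - P 0 1 1 u * ((s * P 0 0 3 u + P 0 1 1 u) / 2)"
    "(s * P 1 0 2 u + P 1 1 0 u) / 2 = P 0 0 2 u * ((P 0 1 3 u + 3 * (s * P 0 2 1 u)) / 6)
      - (s * P 0 0 3 u + P 0 1 1 u) / 2 * ((s * P 0 1 2 u + P 0 2 0 u) / 2)"
    "(P 1 0 3 u + 3 * (s * P 1 1 1 u)) / 6 = (s * P 0 0 3 u + P 0 1 1 u) / 2 * ((P 0 1 3 u + 3 * (s * P 0 2 1 u)) / 6)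
      + ((s * P 0 1 2 u + P 0 2 0 u) / 2)\<^sup>2 - (P 0 0 4 u + 3 * (s * P 0 1 2 u)) / 6 * ((s * P 0 1 2 u + P 0 2 0 u) / 2)
      - (P 0 1 3 u + 3 * (s * P 0 2 1 u)) / 6 * P 0 1 1 u"
    "s * P 0 0 5 u / 6 + P 0 1 3 u + s * P 0 2 1 u / 2
      = 4 * (P 0 0 2 u * ((s * P 0 0 3 u + P 0 1 1 u) / 2) + P 0 1 1 u * P 0 0 2 u) + 3 * l3 * P 0 0 2 u"
    "s * P 0 1 4 u / 6 + P 0 2 2 u + s * P 0 3 0 u / 2
      = 4 * (P 0 0 2 u * ((s * P 0 1 2 u + P 0 2 0 u) / 2) + (P 0 1 1 u)\<^sup>2 + P 1 0 1 u) + 3 * l3 * P 0 1 1 u + 2 * l2"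
    "s * P 1 0 4 u / 6 + P 1 1 2 u + s * P 1 2 0 u / 2
      = 4 * (P 0 0 2 u * ((s * P 1 0 2 u + P 1 1 0 u) / 2) + P 0 1 1 u * P 1 0 1 u) + 3 * l3 * P 1 0 1 u + l1"
    "P 1 0 5 u / 24 + 5 / 12 * (s * P 1 1 3 u) + 5 / 8 * P 1 2 1 u + l3 / 4 * (s * P 1 0 2 u) + P 2 0 0 u
      = 5 * ((s * P 0 0 3 u + P 0 1 1 u) / 2 * ((s * P 1 0 2 u + P 1 1 0 u) / 2) + (s * P 0 1 2 u + P 0 2 0 u) / 2 * P 1 0 1 u)
        + 3 * l3 * ((s * P 1 0 2 u + P 1 1 0 u) / 2)"
    by (simp_all only: simp_thms)
qed


text \<open>Sums and differences of the two signed versions, hence the equal or opposite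
  multipliers: parts 1, 4, 5, 6 and 8 are even, parts 2, 3 and 7 are odd.\<close>

lemma parity_relations:
  assumes nz: "\<sigma> u \<noteq> 0"
  shows "3 * (P 0 0 3 u)\<^sup>2 = 2 * P 0 0 2 u * P 0 0 4 u - 6 * P 0 0 2 u * P 0 2 0 u + 3 * (P 0 1 1 u)\<^sup>2 + 12 * P 1 0 1 u"
    and "2 * P 1 0 2 u = 2 * P 0 0 2 u * P 0 2 1 u - P 0 0 3 u * P 0 2 0 u - P 0 1 1 u * P 0 1 2 u"
    and "P 0 0 5 u = 12 * P 0 0 2 u * P 0 0 3 u - 3 * P 0 2 1 u"
    and "P 0 1 3 u = 6 * P 0 0 2 u * P 0 1 1 u + 3 * l3 * P 0 0 2 u"
    and "P 0 2 2 u = 2 * P 0 0 2 u * P 0 2 0 u + 4 * (P 0 1 1 u)\<^sup>2 + 4 * P 1 0 1 u + 3 * l3 * P 0 1 1 u + 2 * l2"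
    and "P 1 1 2 u = 2 * P 0 0 2 u * P 1 1 0 u + 4 * P 0 1 1 u * P 1 0 1 u + 3 * l3 * P 1 0 1 u + l1"
    and "6 * P 1 1 1 u = P 0 0 3 u * P 0 1 3 u - 3 * P 0 1 1 u * P 0 2 1 u + 3 * P 0 1 2 u * P 0 2 0 u - P 0 0 4 u * P 0 1 2 u"
    and "P 1 0 5 u + 15 * P 1 2 1 u + 24 * P 2 0 0 u = 30 * (P 0 0 3 u * P 1 0 2 u + P 0 1 1 u * P 1 1 0 u)
      + 60 * P 0 2 0 u * P 1 0 1 u + 36 * l3 * P 1 1 0 u"
proof -
  note p = defects_signed[OF nz, of 1, OF disjI1, OF refl] and n = defects_signed[OF nz, of "- 1", OF disjI2, OF refl]
  show "3 * (P 0 0 3 u)\<^sup>2 = 2 * P 0 0 2 u * P 0 0 4 u - 6 * P 0 0 2 u * P 0 2 0 u + 3 * (P 0 1 1 u)\<^sup>2 + 12 * P 1 0 1 u"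
    by (rule linear_combination2[OF _ p(1) n(1), of _ _ "- 6" "- 6"]) (simp add: field_simps power2_eq_square)
  show "2 * P 1 0 2 u = 2 * P 0 0 2 u * P 0 2 1 u - P 0 0 3 u * P 0 2 0 u - P 0 1 1 u * P 0 1 2 u"
    by (rule linear_combination2[OF _ p(2) n(2), of _ _ 2 "- 2"]) (simp add: field_simps)
  show "P 0 0 5 u = 12 * P 0 0 2 u * P 0 0 3 u - 3 * P 0 2 1 u"
    by (rule linear_combination2[OF _ p(4) n(4), of _ _ 3 "- 3"]) (simp add: field_simps)
  show "P 0 1 3 u = 6 * P 0 0 2 u * P 0 1 1 u + 3 * l3 * P 0 0 2 u"
    by (rule linear_combination2[OF _ p(4) n(4), of _ _ "1 / 2" "1 / 2"]) (simp add: field_simps)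
  show "P 0 2 2 u = 2 * P 0 0 2 u * P 0 2 0 u + 4 * (P 0 1 1 u)\<^sup>2 + 4 * P 1 0 1 u + 3 * l3 * P 0 1 1 u + 2 * l2"
    by (rule linear_combination2[OF _ p(5) n(5), of _ _ "1 / 2" "1 / 2"]) (simp add: field_simps)
  show "P 1 1 2 u = 2 * P 0 0 2 u * P 1 1 0 u + 4 * P 0 1 1 u * P 1 0 1 u + 3 * l3 * P 1 0 1 u + l1"
    by (rule linear_combination2[OF _ p(6) n(6), of _ _ "1 / 2" "1 / 2"]) (simp add: field_simps)
  show "6 * P 1 1 1 u = P 0 0 3 u * P 0 1 3 u - 3 * P 0 1 1 u * P 0 2 1 u + 3 * P 0 1 2 u * P 0 2 0 u - P 0 0 4 u * P 0 1 2 u"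
    by (rule linear_combination2[OF _ p(3) n(3), of _ _ 6 "- 6"]) (simp add: field_simps power2_eq_square)
  show "P 1 0 5 u + 15 * P 1 2 1 u + 24 * P 2 0 0 u = 30 * (P 0 0 3 u * P 1 0 2 u + P 0 1 1 u * P 1 1 0 u)
      + 60 * P 0 2 0 u * P 1 0 1 u + 36 * l3 * P 1 1 0 u"
    by (rule linear_combination2[OF _ p(7) n(7), of _ _ 12 12]) (simp add: field_simps)
qed

end

section \<open>Polynomial identities in the structure constants\<close>

text \<open>
  Here \<open>xy = a y + b x + \<dots>\<close> and \<open>y\<^sup>2 = d y + e x + \<dots>\<close>.  The relation \<open>d2\<close> is the coefficient of
  \<open>y\<close> in the equation of the curve.
\<close>

locale divisor_parameters =
  fixes l0 l1 l2 l3 a b d e p33 p23 p22 p13 p12 p333 p233 p223 p133 p123 p1333 :: complex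
  assumes d2: "d^2 = 2*p33^2*b - p33^2*d + p33*p23^2 + p33*p23*l3 + 2*p33*a^2 + p33*a*l3 + p33*l2 + p23*e - 2*a*e - b^2 +
      b*d"
    and v_p22: "p22 = p33^2 + b - d"
    and v_p333: "p333 = 2*a - p23"
    and v_p233: "p233 = b - p33^2 + d"
    and v_p223: "p223 = 2*e - 2*p33*p23 - p33*l3"
    and v_p13: "p13 = p33*b - p33*d - p23*a + a^2"
    and v_p12: "p12 = p33^2*p23 + p33^2*a + p33^2*l3 + p23*d - a*b - a*d"
    and v_p133: "p133 = 2*p33*e - p33^2*p23 - p33^2*a - p33^2*l3 - p23*d - a*b + a*d"
    and v_p123: "p123 = 2*p33^2*d - 3*p33^2*b - p33*p23^2 + 2*p33*p23*a - p33*p23*l3 - 2*p33*a^2 - p33*l2 - 2*p23*e + 2*a*e +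
      2*b^2 - b*d"
    and v_p1333: "p1333 = 9*p33^2*b - 6*p33^2*d + 3*p33*p23^2 - 6*p33*p23*a + 3*p33*p23*l3 + 6*p33*a^2 + 3*p33*l2 - 3*b*d"
    and v_l1: "l1 = 2*p33*p23*d - p33^2*e - 4*p33*p23*b - 2*p33*b*l3 + p33*d*l3 - p23^3 + 2*p23^2*a - p23^2*l3 - 2*p23*a^2 +
      p23*a*l3 - p23*l2 - a^2*l3 + b*e + d*e"
    and v_l0: "l0 = p33^4*d - 2*p33^4*b - p33^3*p23^2 - p33^3*p23*l3 - 2*p33^3*a^2 - p33^3*a*l3 - p33^3*l2 - 2*p33^2*p23*e +
      p33^2*a*e - 3*p33^2*b^2 + 3*p33^2*b*d - p33^2*e*l3 - 2*p33*p23^2*b + p33*p23^2*d + 4*p33*p23*a*b -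
      2*p33*p23*a*d - 2*p33*p23*b*l3 + p33*p23*d*l3 - 4*p33*a^2*b + 2*p33*a^2*d - 2*p33*b*l2 + p33*d*l2 +
      p33*e^2 + p23^3*a - 2*p23^2*a^2 + p23^2*a*l3 + 2*p23*a^3 - p23*a^2*l3 + p23*a*l2 - p23*b*e - p23*d*e -
      a^4 - a^2*l2 + a*b*e + a*d*e + b^3"
begin

lemmas basic_vals = v_p22 v_p333 v_p233 v_p223 v_p13 v_p12 v_p133 v_p123 v_p1333 v_l1 v_l0

text \<open>This relation and the next one come early because their derivatives are the source of
  the formulas for \<open>P 2 1 0\<close> and \<open>P 1 2 0\<close>.\<close>

lemma p333_p233_rel: "p333*p233 = 4*p33^2*p23 + 2*l3*p33^2 - p22*p23 - 2*p12"
  unfolding basic_vals by algebra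

lemma p233_p233_rel: "3*p233^2 = 12*p23^2*p33 + 3*p22^2 + 12*l3*p33*p23 + 12*p33*l2 - 4*p1333 + 24*p33*p13"
  unfolding basic_vals by algebra

end

text \<open>Once \<wp>_3333 and \<wp>_2333 are polynomials in two-index functions, the definitions
  of \<open>a\<close>, \<open>b\<close>, \<open>d\<close>, \<open>e\<close> can be solved for p22,
  p333, p233 and p223. The other quantities follow one after another, and the curve equation gives
  l1 and l0.\<close>

lemma divisor_parametersI:
  fixes l0 l1 l2 l3 a b d e p33 p23 p22 p13 p12 p333 p233 p223 p133 p123 p1333 p3333 p2333 :: complex
  assumes a: "2*a = p333 + p23" and b: "2*b = p233 + p22"
    and d: "6*d = p3333 + 3*p233" and e: "6*e = p2333 + 3*p223"
    and p3333: "p3333 = 6*p33^2 - 3*p22" and p2333: "p2333 = 6*p33*p23 + 3*l3*p33"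
    and p13: "p13 = a^2 + b*p33 - p33*d - p23*a"
    and p12: "p133 + p12 = 2*(p33*e - a*b)"
    and p1333: "p1333 + 3*p123 = 6*(a*e + b^2 - d*b - e*p23)"
    and p133: "2*p133 = 2*p33*p223 - p333*p22 - p23*p233"
    and p123: "6*p123 = p333*p2333 - 3*p23*p223 + 3*p233*p22 - p3333*p233"
    and y3: "d^2 + e*a + (a*e + b^2 - d*b - e*p23) = (p33*a + p23*p33)*a + (p33*b + p23^2 + p13)*p33 + l3*(p33*a +
      p23*p33) + l2*p33"
    and y2: "d*e + e*b = (p33*a + p23*p33)*b + (p33*b + p23^2 + p13)*p23 + (p33*(p33*e - a*b) + p23*p13) + l3*(p33*b +
      p23^2 + p13) + l2*p23 + l1"
    and y1: "d*(a*e + b^2 - d*b - e*p23) + e*(p33*e - a*b) = (p33*a + p23*p33)*(p33*e - a*b) + (p33*b + p23^2 + p13)*p13 +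
      l3*(p33*(p33*e - a*b) + p23*p13) + l2*p13 + l0"
  shows "divisor_parameters l0 l1 l2 l3 a b d e p33 p23 p22 p13 p12 p333 p233 p223 p133 p123 p1333"
proof
  show d2: "d^2 = 2*p33^2*b - p33^2*d + p33*p23^2 + p33*p23*l3 + 2*p33*a^2 + p33*a*l3 + p33*l2 + p23*e - 2*a*e - b^2 +
      b*d"
    using y3 p13 by algebra
  show p22: "p22 = p33^2 + b - d" using b d p3333 by algebra
  show p333: "p333 = 2*a - p23" using a by algebra
  show p233: "p233 = b - p33^2 + d" using b d p3333 by algebra
  show p223: "p223 = 2*e - 2*p33*p23 - p33*l3" using e p2333 by algebra
  show p13': "p13 = p33*b - p33*d - p23*a + a^2" using p13 by algebra
  show p133': "p133 = 2*p33*e - p33^2*p23 - p33^2*a - p33^2*l3 - p23*d - a*b + a*d" using p133 unfolding p22 p333 p233 p223 by algebra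
  show "p12 = p33^2*p23 + p33^2*a + p33^2*l3 + p23*d - a*b - a*d" using p12 p133' by algebra
  have "6*p123 = p333*(6*p33*p23 + 3*l3*p33) - 3*p23*p223 + 3*p233*p22 - (6*p33^2 - 3*p22)*p233"
    using p123 unfolding p3333 p2333 .
  then show p123': "p123 = 2*p33^2*d - 3*p33^2*b - p33*p23^2 + 2*p33*p23*a - p33*p23*l3 - 2*p33*a^2 - p33*l2 - 2*p23*e + 2*a*e + 2*b^2 - b*d"
    \<comment> \<open>Subtracting \<open>d2\<close> removes the term -d^2 that the substitution
      leaves in \<open>p123\<close>.\<close>
    by (rule linear_combination2[OF _ _ d2, of _ _ "1 / 6" _ _ "- 1", rotated]) (unfold p22 p333 p233 p223, algebra)
  show "p1333 = 9*p33^2*b - 6*p33^2*d + 3*p33*p23^2 - 6*p33*p23*a + 3*p33*p23*l3 + 6*p33*a^2 + 3*p33*l2 - 3*b*d" using p1333 unfolding p123' by algebra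
  show "l1 = 2*p33*p23*d - p33^2*e - 4*p33*p23*b - 2*p33*b*l3 + p33*d*l3 - p23^3 + 2*p23^2*a - p23^2*l3 - 2*p23*a^2 + p23*a*l3 - p23*l2 - a^2*l3 + b*e + d*e"
    by (rule linear_combination2[OF _ y2 d2, of _ _ "- 1" "0"], unfold p13') algebra
  show "l0 = p33^4*d - 2*p33^4*b - p33^3*p23^2 - p33^3*p23*l3 - 2*p33^3*a^2 - p33^3*a*l3 - p33^3*l2 - 2*p33^2*p23*e + p33^2*a*e - 3*p33^2*b^2 + 3*p33^2*b*d - p33^2*e*l3 - 2*p33*p23^2*b + p33*p23^2*d + 4*p33*p23*a*b - 2*p33*p23*a*d - 2*p33*p23*b*l3 + p33*p23*d*l3 - 4*p33*a^2*b + 2*p33*a^2*d - 2*p33*b*l2 + p33*d*l2 + p33*e^2 + p23^3*a - 2*p23^2*a^2 + p23^2*a*l3 + 2*p23*a^3 - p23*a^2*l3 + p23*a*l2 - p23*b*e - p23*d*e - a^4 - a^2*l2 + a*b*e + a*d*e + b^3"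
    \<comment> \<open>The multiplier cancels the terms in d^2, which come from d times d * b and
      from the square of \<open>p13\<close>.\<close>
    by (rule linear_combination2[OF _ y1 d2, of _ _ "- 1" "- (p33^2 + b)"], unfold p13') algebra
qed

text \<open>The hypotheses arise by differentiation, partly of identities proved in
  \<open>divisor_parameters\<close>. This is the reason for the tower of locales: a layer has to
  hold at every point with \<sigma> \<noteq> 0 before it can be differentiated to feed the next.
  Fourth-order functions with known formulas are already replaced.\<close>

locale divisor_parameters_p11 = divisor_parameters +
  fixes p122 p1223 p11 :: complex
  assumes h_p122: "2*p122 = 2*p33*p23*p233 + l3*p33*p233 - 2*p23^2*p333 - p22*p223 - 2*l3*p333*p23 - 2*p333*l2 + 4*p33*p133 -
      4*p333*p13"
    and h_p1223: "2*p1223 = 2*(p333*p23*p233 + p33*p233^2 + p33*p23*(6*p33*p23 + 3*l3*p33)) + l3*(p333*p233 + p33*(6*p33*p23 +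
      3*l3*p33)) - 4*p23*p233*p333 - 2*p23^2*(6*p33^2 - 3*p22) - (p223^2 + p22*(2*p33*p22 + 4*p23^2 + 4*p13 +
      3*l3*p23 + 2*l2)) - 2*l3*((6*p33^2 - 3*p22)*p23 + p333*p233) - 2*(6*p33^2 - 3*p22)*l2 + 4*p33*p1333 -
      4*(6*p33^2 - 3*p22)*p13"
    and h_p11: "4*p11 = 5*(p333*p133 + p23*p12) + 10*p22*p13 + 6*l3*p12 - 2*p133*p333 - 2*p33*p1333 - 2*p1223"
begin

lemma v_p122: "p122 = 3*p33^2*e - 2*p33^3*p23 - 2*p33^3*a - 2*p33^3*l3 + 4*p33*p23*b - 4*p33*p23*d - 6*p33*a*b + 6*p33*a*d +
      p33*b*l3 + p23^3 - 4*p23^2*a + p23^2*l3 + 6*p23*a^2 - 2*p23*a*l3 + p23*l2 - 4*a^3 - 2*a*l2 - b*e + d*e"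
  using h_p122 d2 unfolding basic_vals by algebra

lemma v_p1223: "p1223 = 14*p33^3*b - 8*p33^3*d + 8*p33^2*p23^2 - 2*p33^2*p23*a + 9*p33^2*p23*l3 + 12*p33^2*a^2 + 5*p33^2*a*l3
      + p33^2*l3^2 + 6*p33^2*l2 + 8*p33*p23*e - 8*p33*a*e - 6*p33*b*d + 2*p33*e*l3 + 2*p23^2*b - 6*p23*a*b +
      2*p23*a*d + 2*p23*b*l3 - p23*d*l3 + 4*a^2*b - 4*a^2*d - a*b*l3 - a*d*l3 + 2*b*l2 - 2*d*l2 - 2*e^2"
  using h_p1223 d2 unfolding basic_vals by algebra

lemma v_p11: "p11 = 2*p33^3*d - 4*p33^3*b - p33^2*p23^2 + 2*p33^2*p23*a - 3*p33^2*a^2 + p33^2*l3^2 - 2*p33^2*l2 -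
      3*p33*p23*e + 2*p33*a*e + 2*p33*b*d - p33*e*l3 - p23^2*b + 2*p23^2*d - 2*p23*a*d - p23*b*l3 + 2*p23*d*l3
      - a^2*b + a^2*d - a*b*l3 - a*d*l3 - b*l2 + d*l2 + e^2"
  using h_p11 d2 unfolding basic_vals v_p1223 by algebra

text \<open>The relation for the square of p223 solved for p11, with Q eliminated through the
  relation for p223 * p333. Without this elimination the derivative in u_1, which is to give p111,
  would contain the derivative of Q.\<close>

lemma p11_rel: "4*p11 = p223^2 - 4*p23^2*p22 + 4*p12*p23 - 4*p13*p22 + 4*p12*l3 - 4*l3*p22*p23 - l3^2*p33^2 - 4*l2*p22 +
      4*l2*p33^2 - 2*p33*(p333*p223 - 4*p33*p13 - 2*p33*p23^2 - l3*p33*p23 - 2*p33^2*p22 + 2*p22^2)"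
  unfolding basic_vals v_p11 using d2 by algebra

end

locale divisor_parameters_full = divisor_parameters_p11 +
  fixes p222 p113 p112 p111 Q :: complex
  assumes h_p222: "p222 = 2*p33*p233 - 2*p333*p23 - l3*p333"
    and h_p113: "4*p113 = 2*p233*p12 + 4*p223*p13 - 2*p133*p22 - 4*p23*p123"
    and h_p112: "2*p112 = 8*p33*p133*p23 + 4*p33^2*p123 + 4*l3*p33*p133 - p122*p23 - p22*p123 - p1333*p233 - p333*(2*p33*p12 +
      4*p23*p13 + 3*l3*p13 + l1)"
    and h_p111: "4*p111 = 2*p223*p1223 - 8*p23*p123*p22 - 4*p23^2*p122 + 4*(p112*p23 + p12*p123) - 4*(p113*p22 + p13*p122) +
      4*l3*p112 - 4*l3*(p122*p23 + p22*p123) - 2*l3^2*p33*p133 - 4*l2*p122 + 8*l2*p33*p133 - 2*p133*(p333*p223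
      - 4*p33*p13 - 2*p33*p23^2 - l3*p33*p23 - 2*p33^2*p22 + 2*p22^2) - 2*p33*(p1333*p223 + p333*p1223 -
      4*p133*p13 - 4*p33*p113 - 2*p133*p23^2 - 4*p33*p23*p123 - l3*(p133*p23 + p33*p123) - 4*p33*p133*p22 -
      2*p33^2*p122 + 4*p22*p122)"
    and h_Q: "Q = p1333 - 6*p33*p13"
begin

lemma v_p222: "p222 = 2*p33*b - 2*p33^3 + 2*p33*d + 2*p23^2 - 4*p23*a + p23*l3 - 2*a*l3"
  using h_p222 d2 unfolding basic_vals by algebra

lemma v_p113: "p113 = 2*p33^2*p23*b - p33^3*e + 2*p33^2*a*b + p33^2*d*l3 + p33*p23^3 + p33*p23^2*l3 + p33*p23*a*l3 +
      p33*p23*l2 - p33*a^2*l3 + p33*b*e - p33*d*e + 2*p23^2*e - 4*p23*a*e - 2*p23*b^2 + 2*p23*b*d + 2*a^2*e -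
      2*a*b*d"
  using h_p113 d2 unfolding basic_vals by algebra

lemma v_p112: "p112 = 8*p33^4*b - 4*p33^4*d + 2*p33^3*p23^2 - 4*p33^3*p23*a + 6*p33^3*a^2 - 2*p33^3*l3^2 + 4*p33^3*l2 +
      7*p33^2*p23*e - 4*p33^2*a*e - 2*p33^2*b^2 - 4*p33^2*b*d + 4*p33^2*e*l3 - 2*p33*p23^2*b - 4*p33*p23^2*d +
      4*p33*p23*a*d - 5*p33*p23*d*l3 + 2*p33*a^2*b - 2*p33*a^2*d - 2*p33*a*b*l3 + 4*p33*a*d*l3 - 2*p33*d*l2 -
      p23^4 + 2*p23^3*a - p23^3*l3 + p23^2*a*l3 - p23^2*l2 + 3*p23*a^2*l3 + 2*p23*a*l2 + 3*p23*b*e - p23*d*e -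
      2*a^3*l3 - 4*a*b*e - 2*b^3 + 4*b^2*d"
  using h_p112 d2 unfolding basic_vals v_p122 by algebra

lemma v_p111: "p111 = 4*p33^4*p23*b - 2*p33^4*p23*d + 16*p33^4*a*b - 8*p33^4*a*d + 12*p33^4*b*l3 - 6*p33^4*d*l3 +
      2*p33^3*p23^2*a + 2*p33^3*p23^2*l3 - 2*p33^3*p23*a^2 - 2*p33^3*p23*a*l3 + 2*p33^3*p23*l2 + 14*p33^3*a^3
      + 14*p33^3*a^2*l3 + 8*p33^3*a*l2 + 9*p33^3*b*e - 6*p33^3*d*e - 2*p33^3*l3^3 + 6*p33^3*l3*l2 +
      5*p33^2*p23^2*e + 7*p33^2*p23*a*e - 12*p33^2*p23*b^2 + 6*p33^2*p23*b*d + 12*p33^2*p23*e*l3 - p33^2*a^2*e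
      + 6*p33^2*a*b^2 - 12*p33^2*a*b*d - 6*p33^2*b^2*l3 - 3*p33^2*b*d*l3 + 3*p33^2*e*l3^2 + 4*p33^2*e*l2 -
      11*p33*p23^3*b + p33*p23^3*d + 20*p33*p23^2*a*b - 10*p33*p23^2*a*d - 13*p33*p23^2*b*l3 -
      4*p33*p23^2*d*l3 - 22*p33*p23*a^2*b + 14*p33*p23*a^2*d + 9*p33*p23*a*b*l3 - 2*p33*p23*b*l3^2 -
      9*p33*p23*b*l2 - 5*p33*p23*d*l3^2 + 3*p33*p23*d*l2 + 11*p33*p23*e^2 + 14*p33*a^3*b - 10*p33*a^3*d +
      p33*a^2*b*l3 - 2*p33*a^2*d*l3 - 2*p33*a*b*l3^2 + 10*p33*a*b*l2 + 4*p33*a*d*l3^2 - 8*p33*a*d*l2 -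
      10*p33*a*e^2 - 3*p33*b*d*e - 2*p33*b*l3*l2 - 2*p33*d*l3*l2 + 3*p33*e^2*l3 - 2*p23^5 + 7*p23^4*a -
      4*p23^4*l3 - 11*p23^3*a^2 + 10*p23^3*a*l3 - 2*p23^3*l3^2 - 3*p23^3*l2 + 14*p23^2*a^3 - 6*p23^2*a^2*l3 +
      3*p23^2*a*l3^2 + 9*p23^2*a*l2 + 6*p23^2*b*e - 6*p23^2*d*e - 3*p23^2*l3*l2 - 10*p23*a^4 + 4*p23*a^3*l3 +
      3*p23*a^2*l3^2 - 9*p23*a^2*l2 - 5*p23*a*b*e + 7*p23*a*d*e + 6*p23*a*l3*l2 - 2*p23*b^3 + 6*p23*b^2*d +
      7*p23*b*e*l3 - 5*p23*d*e*l3 - p23*l2^2 + 4*a^5 - 2*a^3*l3^2 + 6*a^3*l2 + a^2*b*e - 5*a^2*d*e - 2*a*b^3 -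
      5*a*b*e*l3 + a*d*e*l3 + 2*a*l2^2 - 3*b^3*l3 + 6*b^2*d*l3 + 3*b*e*l2 - 3*d*e*l2 - 2*e^3"
  using h_p111 d2 unfolding basic_vals v_p122 v_p1223 v_p113 v_p112 by algebra

lemma v_Q: "Q = 3*p33^2*b + 3*p33*p23^2 + 3*p33*p23*l3 + 3*p33*l2 - 3*b*d"
  using h_Q d2 unfolding basic_vals by algebra

lemmas vals = basic_vals v_p11 v_p122 v_p222 v_p113 v_p112 v_p111 v_Q

text \<open>After \<open>vals\<close> both sides are polynomials in a, b, d, e, p33, p23, l2, l3.
  They agree identically here, and modulo the equation \<open>d2\<close> in those relations below to
  which it is supplied.\<close>

lemma rel_p333_squared:
  "p333^2 = 4*p33^3 + 4*p13 + p23^2 - 4*p22*p33"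
  unfolding vals by algebra

lemma rel_p233_p333:
  "p233*p333 = 4*p23*p33^2 - 2*p12 - p22*p23 + 2*l3*p33^2"
  unfolding vals by algebra

lemma rel_p233_squared:
  "p233^2 = 4*p23^2*p33 + p22^2 + 4*l3*p23*p33 + 4*p33*l2 - (4/3)*Q"
  unfolding vals by algebra

lemma rel_p223_p333:
  "p223*p333 = 2*p23^2*p33 + 2*p22*p33^2 - 2*p22^2 + l3*p23*p33 + 4*p13*p33 + (2/3)*Q"
  unfolding vals using d2 by algebra

lemma rel_p223_p233:
  "p223*p233 = 2*p13*l3 + 2*l1 + 4*p13*p23 + 2*p23*p22*p33 + 2*p23^3 + p22*p33*l3
           + 2*p23^2*l3 + 2*p23*l2"
  unfolding vals by algebra

lemma rel_p222_p333:
  "p222*p333 = 6*p23*p22*p33 - 4*p12*p33 - 2*p23^3 + 4*p22*p33*l3 - 8*p13*p23 - p23^2*l3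
           - 4*p13*l3"
  unfolding vals by algebra

lemma rel_p223_squared:
  "p223^2 = 4*p23^2*p22 + 4*p11 - 4*p12*p23 + 4*p13*p22 - 4*p12*l3 + 4*l3*p22*p23
           + l3^2*p33^2 + 4*l2*p22 - 4*l2*p33^2 + (4/3)*p33*Q"
  unfolding vals using d2 by algebra

lemma rel_p222_p233:
  "p222*p233 = 2*p23^2*p22 + 2*p22^2*p33 + 4*p12*p23 + 2*p12*l3 + l3*p22*p23
           - 2*l3^2*p33^2 + 8*l2*p33^2 - (8/3)*p33*Q"
  unfolding vals by algebra

lemma rel_p133_p333:
  "p133*p333 = p12*p23 - 2*p13*p22 + 4*p13*p33^2 + (2/3)*p33*Q"
  unfolding vals using d2 by algebra

lemma rel_p222_p223:
  "p222*p223 = 2*p22^2*l3 - l3^2*p23*p33 + 4*p22^2*p23 + 4*l2*p23*p33 + 4*p33*l1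
           - (2/3)*l3*Q - (4/3)*p23*Q"
  unfolding vals using d2 by algebra

lemma rel_p133_p233:
  "p133*p233 = 2*l3*p13*p33 + 2*p33*l1 + p12*p22 + 4*p33*p23*p13 + (2/3)*p23*Q"
  unfolding vals by algebra

lemma rel_p123_p333:
  "p123*p333 = 2*p12*p33^2 - 2*p12*p22 + 2*p33*p23*p13 + 2*l3*p13*p33 - (1/3)*p23*Q"
  unfolding vals using d2 by algebra

lemma rel_p222_squared:
  "p222^2 = 4*p22^3 + 8*p11*p33 - 8*p13^2 - 4*p33*p12*l3 + 4*p23*p13*l3 + 4*p13*l3^2
           - 4*p22*p33*l3^2 + p23^2*l3^2 - 8*p13*l2 + 16*p33*l2*p22 - 4*p23^2*l2 - 8*l0
           - 4*p22*Q - 4*p23*l1"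
  unfolding vals using d2 by algebra

lemma rel_p133_p223:
  "p133*p223 = 2*p13*p33*p22 + 2*p13*p23^2 + 2*p11*p33 + 2*p13^2 - p33*p12*l3 + 2*p13*l2
           + 2*p23*p13*l3 + 2*l0 + (2/3)*p22*Q"
  unfolding vals using d2 by algebra

lemma rel_p123_p233:
  "p123*p233 = 2*p13*l2 + 2*p13^2 + 2*p33*p12*l3 + 2*p23*p33*p12 + 2*p13*p23^2 - 2*p11*p33
           + 2*p23*p13*l3 + 2*l0 - (1/3)*p22*Q"
  unfolding vals by algebra

lemma rel_p122_p333:
  "p122*p333 = 2*p13*p33*p22 - 2*p13*p23^2 + 4*p23*p33*p12 - 2*p11*p33 - 6*p13^2 + 2*l0
           + 2*p33*p12*l3 - p23*p13*l3 - 2*p13*l2 + p23*l1 + (2/3)*p22*Q"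
  unfolding vals using d2 by algebra

lemma rel_p133_p222:
  "p133*p222 = -2*p12*p23^2 + 4*p23*p13*p22 - p23*p12*l3 + 2*p22*p13*l3 + 2*p33*p12*p22
           + 4*p33^2*l1 - (2/3)*p33*l3*Q"
  unfolding vals using d2 by algebra

lemma rel_p123_p223:
  "p123*p223 = 2*p22*l1 + 2*p22*p13*l3 - 2*p33^2*l1 + 2*p12*p23^2 + 2*p23*p13*p22
           - 2*p11*p23 + 2*p23*p12*l3 + (1/3)*p33*l3*Q"
  unfolding vals using d2 by algebra

lemma rel_p122_p233:
  "p122*p233 = -p22*p13*l3 + 4*p12*p13 + 2*p12*p23^2 + 2*p12*l2 - p22*l1 + 2*p23*p12*l3
           + 4*p33^2*l1 + 2*p33*p12*p22 - (2/3)*p33*l3*Q"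
  unfolding vals by algebra

lemma rel_p133_squared:
  "p133^2 = p12^2 + 4*p33*l0 + 4*p33*p13^2 + (4/3)*p13*Q"
  unfolding vals using d2 by algebra

lemma rel_p123_p222:
  "p123*p222 = 2*p22*p23*p12 - 2*p12^2 + 2*p13*p22^2 - 2*p23*p33*l1 - 2*l3^2*p13*p33
           + 2*p22*p12*l3 + 8*p33*p13*l2 - (8/3)*p13*Q + (1/3)*p23*l3*Q"
  unfolding vals using d2 by algebra

lemma rel_p122_p223:
  "p122*p223 = 4*p22*p23*p12 - 2*p11*p22 + 2*p12^2 + 2*p22*p12*l3 + l3^2*p13*p33
           + 4*p23*p33*l1 + p33*l3*l1 + 8*p33*l0 + (4/3)*p13*Q - (2/3)*p23*l3*Q - 4*p33*p13*l2
           - (2/3)*l2*Q"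
  unfolding vals using d2 by algebra

lemma rel_p113_p333:
  "p113*p333 = 2*p33*p13^2 + 2*p33^2*p11 - 2*p12^2 + 2*p33*p13*l2 - p23*p33*l1 - 2*p33*l0
           - (2/3)*p13*Q"
  unfolding vals using d2 by algebra

lemma rel_p123_p133:
  "p123*p133 = 2*p23*p13^2 + 2*p13*l1 + 2*p13^2*l3 - 2*p23*l0 + 2*p33*p12*p13
           + (1/3)*p12*Q"
  unfolding vals using d2 by algebra

lemma rel_p122_p222:
  "p122*p222 = 6*p33*p22*l1 - p23*l3*l1 - 2*p33*p12*l3^2 - 2*p23^2*l1 + 2*l3*p13*l2
           + 2*l3*p11*p33 + p23*p13*l3^2 - 2*p13^2*l3 - (2/3)*p22*l3*Q + 4*p33*p12*l2
           - 2*l3*l0 + 4*p22^2*p12 - (4/3)*p12*Q - 8*p13*l1"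
  unfolding vals using d2 by algebra

lemma rel_p113_p233:
  "p113*p233 = 2*p13^2*l3 + 2*p23*p13^2 + 2*p33*p12*l2 + 2*p13*l1 + 2*p33*p23*p11
           - 2*p23*l0 - p33*p22*l1 - (2/3)*p12*Q"
  unfolding vals by algebra

lemma rel_p112_p333:
  "p112*p333 = 2*p23*p13*l2 - p23^2*l1 - 4*p13^2*l3 + 4*p33*p12*p13 - 2*p23*l0
           + 2*p33*p23*p11 - 2*p23*p13^2 + (4/3)*p12*Q"
  unfolding vals using d2 by algebra

lemma rel_p123_squared:
  "p123^2 = (1/3)*p23*p12*l2 - (8/3)*p11*p13 + (10/3)*p13*p23*p12 - (1/3)*p33*p11*p22
           + (2/9)*p33*l2*Q - (1/3)*p23*p22*l1 + (1/3)*p22*p13*l2 + 3*p22*l0 + (1/3)*p12*l1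
           + (1/3)*p23^2*p11 + (1/3)*p13^2*p22 - (8/3)*p33^2*l0 + (1/3)*p33*p12^2
           + 3*p12*p13*l3 - (1/3)*p33^2*l3*l1"
  unfolding vals using d2 by algebra

lemma rel_p122_p133:
  "p122*p133 = -(8/3)*p11*p13 + (4/3)*p13*p23*p12 + (2/3)*p33*p11*p22 - (2/3)*p23^2*p11
           + (4/3)*p13^2*p22 + (4/3)*p33*p12^2 + (2/3)*p23*p22*l1 - (2/3)*p22*p13*l2
           - (2/3)*p23*p12*l2 + 3*p12*p13*l3 + (2/3)*p33^2*l3*l1 + (1/3)*p12*l1
           + (16/3)*p33^2*l0 - (4/9)*p33*l2*Q"
  unfolding vals using d2 by algebra

lemma rel_p113_p223:
  "p113*p223 = (4/3)*p11*p13 + (4/3)*p13*p23*p12 + (2/3)*p33*p11*p22 + (4/3)*p23^2*p11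
           + (4/3)*p23*p12*l2 + (4/3)*p13^2*p22 - (2/3)*p33*p12^2 - (4/3)*p23*p22*l1
           + (4/3)*p22*p13*l2 - (1/3)*p33^2*l3*l1 + (4/3)*p12*l1 - (8/3)*p33^2*l0
           + (2/9)*p33*l2*Q"
  unfolding vals using d2 by algebra

lemma rel_p112_p233:
  "p112*p233 = (16/3)*p11*p13 + (4/3)*p13*p23*p12 + (2/3)*p33*p11*p22 + (4/3)*p23^2*p11
           - (4/9)*p33*l2*Q - (2/3)*p13^2*p22 + (4/3)*p33*p12^2 - (1/3)*p23*p22*l1
           - (2/3)*p22*p13*l2 - 6*p22*l0 + (4/3)*p23*p12*l2 + (2/3)*p33^2*l3*l1
           + (10/3)*p12*l1 + (16/3)*p33^2*l0"
  unfolding vals using d2 by algebra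

lemma rel_p122_p123:
  "p122*p123 = 2*p33*l3*l0 + 2*p12*p13*p22 - 2*p11*p12 + 2*l1*p13*p33 + 2*l3*p12^2
           + 2*p23*p12^2 - (1/3)*l1*Q - (1/3)*p13*l3*Q"
  unfolding vals using d2 by algebra

lemma rel_p113_p222:
  "p113*p222 = -8*p23*p33*l0 - 4*p33*l3*l0 + 8*l1*p13*p33 + 4*p22*p12*l2 + (2/3)*l1*Q
           + 4*p12*p13*p22 + 4*p11*p12 - l3*p23*p33*l1 - 2*p23*p12^2 + 2*p22*p23*p11
           - 4*l3*p12^2 - 2*p22^2*l1 + (2/3)*p23*l2*Q - (4/3)*p13*l3*Q"
  unfolding vals using d2 by algebra

lemma rel_p112_p223:
  "p112*p223 = 8*p33*l3*l0 + l3*p23*p33*l1 - 4*l1*p13*p33 + 2*p23*p12^2 + (2/3)*p13*l3*Q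
           + 2*p22*p23*p11 + 8*p23*p33*l0 + 2*l3*p12^2 - (2/3)*p23*l2*Q - (4/3)*l1*Q"
  unfolding vals using d2 by algebra

lemma rel_p122_squared:
  "p122^2 = -4*l2*p13^2 - 4*l2*l0 + l1^2 - 16*l0*p13 - 8*l0*p23^2 + 4*p22*p12^2
           + 2*l3*p13*l1 + p13^2*l3^2 + 4*l1*p13*p23 + 4*l1*p12*p33 + 8*p33*p22*l0
           - (4/3)*p12*l3*Q + (4/3)*p11*Q - 4*l3*p23*l0"
  unfolding vals using d2 by algebra

lemma rel_p111_p333:
  "p111*p333 = -9*l3*p23*l0 - 2*p13*l2^2 + l2*p23*l1 - 2*l2*p11*p33 + 2*p11*Q
           - 10*l0*p23^2 + 6*p33*p13*p11 - 10*l0*p13 - 2*p13^3 + 7*l1*p13*p23 + 2*l1*p12*p33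
           - 2*p33*p22*l0 + 6*l3*p13*l1 + 2*l1^2 - 6*l2*l0 - 4*l2*p13^2"
  unfolding vals using d2 by algebra

lemma rel_p113_p133:
  "p113*p133 = 2*p33*p13*p11 + 2*l2*p13^2 + 2*l0*p13 + 2*l0*p23^2 + 2*p13^3 + l1*p12*p33
           - 2*p33*p22*l0 - 2*l1*p13*p23"
  unfolding vals using d2 by algebra

lemma rel_p112_p222:
  "p112*p222 = 4*l2*p13^2 + 2*p23*l3*p13*l2 - 2*l2*p23*l1 + 4*l2*p11*p33 - p23^2*l3*l1
           + 4*l2*l0 - 2*l1^2 + 8*l0*p23^2 + 2*p11*p22^2 + 2*p22*p12^2 + (2/3)*p12*l3*Q
           - 2*l3*p33*p12*l2 + 2*l3*p33*p22*l1 + 4*p13*l2^2 - 8*l3*p13*l1 - (8/3)*p11*Q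
           - 8*l1*p13*p23 + 4*l1*p12*p33 + 8*l3*p23*l0 - (2/3)*l2*p22*Q - 2*p13^2*l3^2"
  unfolding vals using d2 by algebra

lemma rel_p113_p123:
  "p113*p123 = -2*p33^2*l3*l0 + 2*l2*p12*p13 + 2*p12*p13^2 + 2*p12*l0 - 2*p23*p22*l0
           + 2*p13*p23*p11 + (1/3)*p33*l1*Q"
  unfolding vals using d2 by algebra

lemma rel_p111_p233:
  "p111*p233 = 2*p12*p33*p11 - 2*p12*p13^2 + 6*l1*p12*l3 + 6*l1*p12*p23 + 4*p13*p23*p11
           - 2*p12*l2^2 - 2*p11*l1 - 4*l2*p12*p13 + l2*p22*l1 - 2*l2*p23*p11 - 8*p23*p22*l0
           + p13*p22*l1 + 4*p33^2*l3*l0 + 6*p11*p13*l3 - 9*l3*p22*l0 + 2*p12*l0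
           - (2/3)*p33*l1*Q"
  unfolding vals using d2 by algebra

lemma rel_p112_p133:
  "p112*p133 = 4*p33^2*l3*l0 + 2*p12*p33*p11 + 2*l2*p12*p13 - 2*p13*p22*l1 + 2*p12*l0
           + 2*p12*p13^2 + 4*p23*p22*l0 - (2/3)*p33*l1*Q - l1*p12*p23"
  unfolding vals using d2 by algebra

lemma rel_p113_p122:
  "p113*p122 = 2*p22*p13*p11 - 4*p33*l2*l0 + 2*p12^2*p13 - 4*p22^2*l0 + p33*l1^2
           + 2*p12*p22*l1 - 4*p23*p33*l3*l0 + l1*l3*p13*p33 - (2/3)*p13*l2*Q + 8*p13*p33*l0
           + (4/3)*l0*Q + (2/3)*p23*l1*Q"
  unfolding vals using d2 by algebra

lemma rel_p112_p123:
  "p112*p123 = 8*p33*l2*l0 + 2*p12^2*p13 + 2*p12*p23*p11 + 2*p22^2*l0 - 2*p33*l1^2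
           + 2*l2*p12^2 - 2*p12*p22*l1 + 2*p23*p33*l3*l0 - (8/3)*l0*Q - (1/3)*p23*l1*Q"
  unfolding vals using d2 by algebra

lemma rel_p111_p223:
  "p111*p223 = -12*p33*l2*l0 + 2*p22*p13*p11 + 6*p11*l3*p12 - 4*p11^2 + 4*p33*l1^2
           - 4*p22^2*l0 - 2*l2*p11*p22 - 8*p13*p33*l0 - (4/3)*p23*l1*Q - l2*p33*l3*l1
           + 8*p23*p33*l3*l0 + (2/3)*p13*l2*Q + (2/3)*l2^2*Q - 2*l2*p12^2 - 2*p12^2*p13
           + 4*p12*p23*p11 - l1*l3*p13*p33 - 2*l3*l1*Q + 4*p12*p22*l1 + (4/3)*l0*Q
           + 9*p33*l3^2*l0"
  unfolding vals using d2 by algebra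

lemma rel_p111_p222:
  "p111*p222 = 6*l3*l2*l0 - 6*l1*l0 - 2*l3*l1^2 - 2*p22*l1*Q - 6*l3^2*p13*l1 - 8*l3*l0*p13
           - 2*p12^3 + 2*p12*l2*Q + 10*l3*l0*p23^2 + 4*p23*l2^2*p13 - 2*l3*p11*Q
           + 6*p11*p22*p12 - 4*p33*p12*l2^2 - 16*l0*p13*p23 + 9*l3^2*p23*l0 - 4*p23*l1^2
           - 2*l3*l2*p13^2 + 2*l3*p13*l2^2 + 6*l2*p13*l1 - 8*l0*p12*p33 + 10*l1*p13^2
           + 2*l3*l2*p11*p33 - 2*p23^2*l2*l1 + 4*l3*l1*p12*p33 + 2*l2*p33*p22*l1
           - l3*l2*p23*l1 + 2*p11*p33*l1 - 7*l3*l1*p13*p23 + 2*l3*l0*p22*p33"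
  unfolding vals using d2 by algebra

lemma rel_p112_p122:
  "p112*p122 = 2*p11*p22*p12 + 2*p11*p33*l1 - 2*l1*l0 - 8*l3*l0*p13 + 2*p12^3
           - 2*l3*l0*p23^2 + 8*l0*p12*p33 + 2*l3*l0*p22*p33 + 2*l2*p13*l1 + l3*l1*p13*p23
           - p23*l1^2 - 2*l1*p13^2 - (2/3)*p12*l2*Q"
  unfolding vals using d2 by algebra

lemma rel_p113_squared:
  "p113^2 = 4*p13^2*p11 - 4*l0*p13*p22 - 4*l0*p12*p23 - 4*p33^2*l2*l0 + p33^2*l1^2
           + 4*l1*p12*p13 + (4/3)*p33*l0*Q"
  unfolding vals using d2 by algebra

lemma rel_p111_p133:
  "p111*p133 = 8*l0*p12*p23 - l1*p12*l2 - 6*l2*p22*l0 + 2*l2*p11*p13 + 2*p22*l1^2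
           - 2*p33^2*l1^2 - 6*l0*p11 + 2*p33*p11^2 + 9*l0*p12*l3 - (8/3)*p33*l0*Q - l1*p12*p13
           - 2*l1*p11*p23 + 2*p13^2*p11 - 4*l0*p13*p22 + 8*p33^2*l2*l0"
  unfolding vals using d2 by algebra

lemma rel_p112_p113:
  "p112*p113 = -4*p23*p33*l2*l0 + 2*l1*p12^2 + p23*p33*l1^2 - 4*l0*p12*p22 + 4*p12*p13*p11
           + (4/3)*p23*l0*Q - (2/3)*p13*l1*Q + 4*l0*l3*p13*p33"
  unfolding vals using d2 by algebra

lemma rel_p111_p123:
  "p111*p123 = 2*p12*p13*p11 - 2*p33*l3*l1^2 + 2*l1*p33*l0 - 2*l0*l3*p13*p33
           + 2*p11*p12*l2 - 2*p11*p22*l1 + 6*l2*p33*l3*l0 + 8*p23*p33*l2*l0 + 2*l0*p12*p22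
           - 2*p23*p33*l1^2 + (1/3)*l2*l1*Q - 3*l3*l0*Q - (8/3)*p23*l0*Q + (1/3)*p13*l1*Q
           + 2*p23*p11^2"
  unfolding vals using d2 by algebra

lemma rel_p111_p122:
  "p111*p122 = -3*l3*l1*l0 - l2*l1^2 + 4*l2^2*l0 - 8*l0^2 - l1*p13^2*l3 - 8*l1*l0*p23
           - 2*p23^2*l1^2 + 4*l2*l0*p23^2 - (8/3)*p22*l0*Q + (2/3)*p12*l1*Q - (2/3)*l2*p11*Q
           + l1^2*p13 + 8*l2*l0*p13 - 9*l3^2*l0*p13 - 2*l3*l1^2*p23 + 2*p11^2*p22
           - 2*l2*l1*p12*p33 + 2*p11*p12^2 + 8*l0*p13^2 + l2*l3*p13*l1 + 4*l3*l0*p12*p33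
           + 2*l2*l1*p13*p23 - 8*l3*l0*p13*p23 + 4*l2*p33*p22*l0 + 2*l3*l1*p11*p33
           + 6*l2*l3*p23*l0"
  unfolding vals using d2 by algebra

lemma rel_p112_squared:
  "p112^2 = -8*l0*p13^2 + 8*l0*p11*p33 - 4*l1*l0*p23 - 4*l2*l0*p23^2 - 8*l2*l0*p13
           + 4*p11*p12^2 - 8*l0^2 + 4*l3*l0*p13*p23 + 4*l3*l0*p12*p33 + p23^2*l1^2
           + 4*l1^2*p13 + (4/3)*p22*l0*Q - (4/3)*p12*l1*Q"
  unfolding vals using d2 by algebra

lemma rel_p111_p113:
  "p111*p113 = 4*l0*p33*p13*l2 + 4*p11^2*p13 - p33*l2*l1^2 + 4*p33*l2^2*l0 - l1^2*p13*p33
           - 3*p33*l3*l1*l0 + 2*p12*p11*l1 - 6*p22*l0*p11 + 2*l0*p12^2 - 2*l2*l0*Q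
           - (4/3)*l0*p13*Q + (2/3)*l1^2*Q + 8*p33*l0^2"
  unfolding vals using d2 by algebra

lemma rel_p111_p112:
  "p111*p112 = -(4/3)*p12*l0*Q + 2*l3*p13*l1^2 + 8*l2*l1*l0 + l1^2*p13*p23
           - (2/3)*p11*l1*Q + 6*l3*p33*l0*p11 + 4*p11^2*p12 + 4*p23*l2^2*l0 - 18*l3*l0^2
           - 2*l1^3 - 16*p23*l0^2 - 2*l3*p13^2*l0 - 6*l3*p13*l2*l0 - 3*l1*l3*p23*l0
           + 2*l1*p33*p22*l0 - l2*p23*l1^2 - 2*l1^2*p12*p33 - 2*l1*l0*p23^2 + 8*l1*l0*p13
           + 4*l0*p33*p12*l2"
  unfolding vals using d2 by algebra

lemma rel_p111_squared:
  "p111^2 = -4*p23*l1^3 - 8*p23^2*l0^2 - 8*p13*l2^2*l0 - 4*l2*l0*p13^2 + 16*p23*l2*l1*l0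
           + 4*p23*l1*l0*p13 + 6*l3*l1*l0*p13 - 4*l0*p11*Q - 36*l3*p23*l0^2 + 18*l3*l2*l1*l0
           + l2^2*l1^2 - 4*l3*l1^3 - 4*l2^3*l0 - 4*l1^2*l0 - 27*l3^2*l0^2 + 12*l2*l0^2
           + 2*p13*l2*l1^2 + 16*p13*l0^2 + l1^2*p13^2 - 4*p12*l1*p33*l0 - 4*p11*p33*l1^2
           + 16*p11*p33*l2*l0 + 4*p11^3 + 8*p33*p22*l0^2"
  unfolding vals using d2 by algebra

lemmas quadratic_relations =
rel_p333_squared rel_p233_p333 rel_p233_squared rel_p223_p333 rel_p223_p233 rel_p222_p333
  rel_p223_squared rel_p222_p233 rel_p133_p333 rel_p222_p223 rel_p133_p233 rel_p123_p333
  rel_p222_squared rel_p133_p223 rel_p123_p233 rel_p122_p333 rel_p133_p222 rel_p123_p223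
  rel_p122_p233 rel_p133_squared rel_p123_p222 rel_p122_p223 rel_p113_p333 rel_p123_p133
  rel_p122_p222 rel_p113_p233 rel_p112_p333 rel_p123_squared rel_p122_p133 rel_p113_p223
  rel_p112_p233 rel_p122_p123 rel_p113_p222 rel_p112_p223 rel_p122_squared rel_p111_p333
  rel_p113_p133 rel_p112_p222 rel_p113_p123 rel_p111_p233 rel_p112_p133 rel_p113_p122 rel_p112_p123
  rel_p111_p223 rel_p111_p222 rel_p112_p122 rel_p113_squared rel_p111_p133 rel_p112_p113
  rel_p111_p123 rel_p111_p122 rel_p112_squared rel_p111_p113 rel_p111_p112 rel_p111_squared

end

section \<open>Derivatives of the structure constants\<close>

context sigma_curve
begin

text \<open>The rules compute the derivatives of the two sides as \<open>x\<close> and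
  \<open>y\<close>; the last two premises leave room to bring these into the wanted form.\<close>

lemma differentiate:
  assumes "\<And>v. \<sigma> v \<noteq> 0 \<Longrightarrow> F v = G v" "\<sigma> u \<noteq> 0"
    and "haspd i F x u" "haspd i G y u" "x = x'" "y = y'"
  shows "x' = y'"
proof -
  have "haspd i G x u"
    by (rule haspd_cong[OF open_sigma_nz[OF ent] _ _ assms(3)]) (use assms(1,2) in simp_all)
  then show ?thesis using haspd_unique[OF _ assms(4)] assms(5,6) by blast
qed

text \<open>Differentiating the expression for \<open>\<wp>\<^sub>3\<^sub>3\<^sub>3\<^sup>2\<close> gives this formula multiplied by \<open>\<wp>\<^sub>3\<^sub>3\<^sub>3\<close>.\<close>

lemma P004:
  assumes "\<sigma> u \<noteq> 0"
  shows "P 0 0 4 u = 6 * (P 0 0 2 u)\<^sup>2 - 3 * P 0 2 0 u"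
proof -
  obtain w where w: "\<sigma> w \<noteq> 0" "P 0 0 3 w \<noteq> 0"
    using p333_nonzero by (auto simp: P_def numeral_3_eq_3)
  have z: "P 0 0 3 v * (P 0 0 4 v - (6 * (P 0 0 2 v)\<^sup>2 - 3 * P 0 2 0 v)) = 0" if v: "\<sigma> v \<noteq> 0" for v
  proof -
    have "6 * P 0 0 3 v * P 0 0 4 v = 2 * P 0 0 3 v * P 0 0 4 v + 2 * P 0 0 2 v * P 0 0 5 v
        - 6 * P 0 0 3 v * P 0 2 0 v - 6 * P 0 0 2 v * P 0 2 1 v + 6 * P 0 1 1 v * P 0 1 2 v + 12 * P 1 0 2 v"
      by (rule differentiate[OF parity_relations(1) v, where i = 3], assumption,
          (rule haspd_intros haspd_P v | (simp; fail))+,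
          (simp_all add: algebra_simps power2_eq_square del: One_nat_def)?)
    \<comment> \<open>Substituting for \<open>P 0 0 5\<close> and \<open>P 1 0 2\<close> leaves only
      terms with the factor \<open>P 0 0 3\<close>.\<close>
    then show ?thesis using parity_relations(2,3)[OF v] by algebra
  qed
  have "P 0 0 4 u - (6 * (P 0 0 2 u)\<^sup>2 - 3 * P 0 2 0 u) = 0"
    by (rule mero3_mult_zero[OF ent mero3_P _ z w assms])
      (intro mero3_diff[OF ent] mero3_mult mero3_power[OF ent] mero3_P mero3_const)
  then show ?thesis by simp
qed

lemma divisor_parameters_P:
  assumes u: "\<sigma> u \<noteq> 0"
  shows "divisor_parameters l0 l1 l2 l3 (cA u) (cB u) (cD u) (cE u) (P 0 0 2 u) (P 0 1 1 u) (P 0 2 0 u)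
    (P 1 0 1 u) (P 1 1 0 u) (P 0 0 3 u) (P 0 1 2 u) (P 0 2 1 u) (P 1 0 2 u) (P 1 1 1 u) (P 1 0 3 u)"
proof -
  define a b c d e f where def: "a = cA u" "b = cB u" "c = cC u" "d = cD u" "e = cE u" "f = cF u"
  note D = defects_zero[OF u, unfolded defects_def list.set ball_simps right_minus_eq, folded def]
  note D8 = D[THEN conjunct2, THEN conjunct2, THEN conjunct2, THEN conjunct2, THEN conjunct2, THEN conjunct2, THEN conjunct2]
  note y3 = D8[THEN conjunct1] and y2 = D8[THEN conjunct2, THEN conjunct1]
    and y1 = D8[THEN conjunct2, THEN conjunct2, THEN conjunct1]
  have c: "c = P 0 0 2 u * e - a * b" and f: "f = a * e + b\<^sup>2 - d * b - e * P 0 1 1 u"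
    using D by simp_all
  show ?thesis
    unfolding def[symmetric]
  proof (rule divisor_parametersI)
    show "2 * a = P 0 0 3 u + P 0 1 1 u" "2 * b = P 0 1 2 u + P 0 2 0 u"
      "6 * d = P 0 0 4 u + 3 * P 0 1 2 u" "6 * e = P 0 1 3 u + 3 * P 0 2 1 u"
      by (simp_all add: def)
    show "P 0 0 4 u = 6 * (P 0 0 2 u)\<^sup>2 - 3 * P 0 2 0 u" by (rule P004[OF u])
    show "P 0 1 3 u = 6 * P 0 0 2 u * P 0 1 1 u + 3 * l3 * P 0 0 2 u"
      "2 * P 1 0 2 u = 2 * P 0 0 2 u * P 0 2 1 u - P 0 0 3 u * P 0 2 0 u - P 0 1 1 u * P 0 1 2 u"
      "6 * P 1 1 1 u = P 0 0 3 u * P 0 1 3 u - 3 * P 0 1 1 u * P 0 2 1 u + 3 * P 0 1 2 u * P 0 2 0 u - P 0 0 4 u * P 0 1 2 u"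
      by (rule parity_relations[OF u])+
    show "P 1 0 1 u = a\<^sup>2 + b * P 0 0 2 u - P 0 0 2 u * d - P 0 1 1 u * a"
      using D by simp
    show "P 1 0 2 u + P 1 1 0 u = 2 * (P 0 0 2 u * e - a * b)" unfolding c[symmetric] by (simp add: def)
    show "P 1 0 3 u + 3 * P 1 1 1 u = 6 * (a * e + b\<^sup>2 - d * b - e * P 0 1 1 u)" unfolding f[symmetric] by (simp add: def)
  qed (use y3 y2 y1 c f in algebra)+
qed

text \<open>\<open>P 0 1 4\<close> is both the derivative of \<open>P 0 0 4\<close> in u_2 and that
  of \<open>P 0 1 3\<close> in u_3; only the first formula contains \<open>P 0 3 0\<close>.\<close>

lemma P030:
  assumes u: "\<sigma> u \<noteq> 0"
  shows "P 0 3 0 u = 2 * P 0 0 2 u * P 0 1 2 u - 2 * P 0 0 3 u * P 0 1 1 u - l3 * P 0 0 3 u"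
proof -
  have "P 0 1 4 u = 12 * P 0 0 2 u * P 0 1 2 u - 3 * P 0 3 0 u"
    by (rule differentiate[OF P004 u, where i = 2], assumption,
          (rule haspd_intros haspd_P u | (simp; fail))+,
          (simp_all add: algebra_simps power2_eq_square del: One_nat_def)?)
  moreover have "P 0 1 4 u = 6 * P 0 0 3 u * P 0 1 1 u + 6 * P 0 0 2 u * P 0 1 2 u + 3 * l3 * P 0 0 3 u"
    by (rule differentiate[OF parity_relations(4) u, where i = 3], assumption,
          (rule haspd_intros haspd_P u | (simp; fail))+,
          (simp_all add: algebra_simps power2_eq_square del: One_nat_def)?)
  ultimately show ?thesis by algebra
qed

text \<open>Compatibility of the formulas for \<open>P 0 2 2\<close> and \<open>P 1 1 2\<close>:
  both lead to \<open>P 1 2 2\<close>, and the terms with \<open>P 1 2 0\<close> cancel.\<close>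

lemma P201:
  assumes u: "\<sigma> u \<noteq> 0"
  shows "4 * P 2 0 1 u = 2 * P 0 1 2 u * P 1 1 0 u + 4 * P 0 2 1 u * P 1 0 1 u - 2 * P 1 0 2 u * P 0 2 0 u - 4 * P 0 1 1 u * P 1 1 1 u"
proof -
  have "P 1 2 2 u = 2 * P 1 0 2 u * P 0 2 0 u + 2 * P 0 0 2 u * P 1 2 0 u + 8 * P 0 1 1 u * P 1 1 1 u + 4 * P 2 0 1 u + 3 * l3 * P 1 1 1 u"
    by (rule differentiate[OF parity_relations(5) u, where i = 1], assumption,
          (rule haspd_intros haspd_P u | (simp; fail))+,
          (simp_all add: algebra_simps power2_eq_square del: One_nat_def)?)
  moreover have "P 1 2 2 u = 2 * P 0 1 2 u * P 1 1 0 u + 2 * P 0 0 2 u * P 1 2 0 u + 4 * P 0 2 1 u * P 1 0 1 u + 4 * P 0 1 1 u * P 1 1 1 u + 3 * l3 * P 1 1 1 u"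
    by (rule differentiate[OF parity_relations(6) u, where i = 2], assumption,
          (rule haspd_intros haspd_P u | (simp; fail))+,
          (simp_all add: algebra_simps power2_eq_square del: One_nat_def)?)
  ultimately show ?thesis by algebra
qed

text \<open>The relation for the square of \<wp>_233, differentiated in u_3, contains
  \<open>P 1 0 4\<close>, which \<open>P004\<close> differentiated in u_1 expresses through
  \<open>P 1 2 0\<close>.\<close>

lemma P120:
  assumes u: "\<sigma> u \<noteq> 0"
  shows "2 * P 1 2 0 u = 2 * P 0 0 2 u * P 0 1 1 u * P 0 1 2 u + l3 * P 0 0 2 u * P 0 1 2 u - 2 * (P 0 1 1 u)\<^sup>2 * P 0 0 3 u
    - P 0 2 0 u * P 0 2 1 u - 2 * l3 * P 0 0 3 u * P 0 1 1 u - 2 * P 0 0 3 u * l2 + 4 * P 0 0 2 u * P 1 0 2 u - 4 * P 0 0 3 u * P 1 0 1 u"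
proof -
  have "P 1 0 4 u = 12 * P 0 0 2 u * P 1 0 2 u - 3 * P 1 2 0 u"
    by (rule differentiate[OF P004 u, where i = 1], assumption,
          (rule haspd_intros haspd_P u | (simp; fail))+,
          (simp_all add: algebra_simps power2_eq_square del: One_nat_def)?)
  moreover have "6 * P 0 1 2 u * P 0 1 3 u = 24 * P 0 1 1 u * P 0 1 2 u * P 0 0 2 u + 12 * (P 0 1 1 u)\<^sup>2 * P 0 0 3 u
      + 6 * P 0 2 0 u * P 0 2 1 u + 12 * l3 * (P 0 0 3 u * P 0 1 1 u + P 0 0 2 u * P 0 1 2 u) + 12 * P 0 0 3 u * l2
      - 4 * P 1 0 4 u + 24 * (P 0 0 3 u * P 1 0 1 u + P 0 0 2 u * P 1 0 2 u)"
    by (rule differentiate[OF divisor_parameters.p233_p233_rel[OF divisor_parameters_P] u, where i = 3], assumption,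
          (rule haspd_intros haspd_P u | (simp; fail))+,
          (simp_all add: algebra_simps power2_eq_square del: One_nat_def)?)
  ultimately show ?thesis using parity_relations(4)[OF u] by algebra
qed

lemma P121:
  assumes u: "\<sigma> u \<noteq> 0"
  shows "2 * P 1 2 1 u = 2 * (P 0 0 3 u * P 0 1 1 u * P 0 1 2 u + P 0 0 2 u * (P 0 1 2 u)\<^sup>2 + P 0 0 2 u * P 0 1 1 u * P 0 1 3 u)
    + l3 * (P 0 0 3 u * P 0 1 2 u + P 0 0 2 u * P 0 1 3 u) - 4 * P 0 1 1 u * P 0 1 2 u * P 0 0 3 u - 2 * (P 0 1 1 u)\<^sup>2 * P 0 0 4 u
    - ((P 0 2 1 u)\<^sup>2 + P 0 2 0 u * P 0 2 2 u) - 2 * l3 * (P 0 0 4 u * P 0 1 1 u + P 0 0 3 u * P 0 1 2 u) - 2 * P 0 0 4 u * l2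
    + 4 * P 0 0 2 u * P 1 0 3 u - 4 * P 0 0 4 u * P 1 0 1 u"
  by (rule differentiate[OF P120 u, where i = 3], assumption,
          (rule haspd_intros haspd_P u | (simp; fail))+,
          (simp_all add: algebra_simps power2_eq_square del: One_nat_def)?)

text \<open>Order 4 of the expansion gives \<wp>_11 together with \<open>P 1 0 5\<close>; the latter
  is removed by differentiating the formula for \<open>P 0 0 5\<close> in u_1.\<close>

lemma P200:
  assumes u: "\<sigma> u \<noteq> 0"
  shows "4 * P 2 0 0 u = 5 * (P 0 0 3 u * P 1 0 2 u + P 0 1 1 u * P 1 1 0 u) + 10 * P 0 2 0 u * P 1 0 1 u + 6 * l3 * P 1 1 0 u
    - 2 * P 1 0 2 u * P 0 0 3 u - 2 * P 0 0 2 u * P 1 0 3 u - 2 * P 1 2 1 u"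
proof -
  have "P 1 0 5 u = 12 * P 1 0 2 u * P 0 0 3 u + 12 * P 0 0 2 u * P 1 0 3 u - 3 * P 1 2 1 u"
    by (rule differentiate[OF parity_relations(3) u, where i = 1], assumption,
          (rule haspd_intros haspd_P u | (simp; fail))+,
          (simp_all add: algebra_simps power2_eq_square del: One_nat_def)?)
  then show ?thesis using parity_relations(8)[OF u] by algebra
qed

text \<open>\<wp>_12 occurs linearly in the relation for \<wp>_333 \<wp>_233, so its derivative in
  u_1 can be isolated.\<close>

lemma P210:
  assumes u: "\<sigma> u \<noteq> 0"
  shows "2 * P 2 1 0 u = 8 * P 0 0 2 u * P 1 0 2 u * P 0 1 1 u + 4 * (P 0 0 2 u)\<^sup>2 * P 1 1 1 u + 4 * l3 * P 0 0 2 u * P 1 0 2 u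
    - P 1 2 0 u * P 0 1 1 u - P 0 2 0 u * P 1 1 1 u - P 1 0 3 u * P 0 1 2 u - P 0 0 3 u * P 1 1 2 u"
proof -
  have "P 1 0 3 u * P 0 1 2 u + P 0 0 3 u * P 1 1 2 u = 8 * P 0 0 2 u * P 1 0 2 u * P 0 1 1 u + 4 * (P 0 0 2 u)\<^sup>2 * P 1 1 1 u
    + 4 * l3 * P 0 0 2 u * P 1 0 2 u - P 1 2 0 u * P 0 1 1 u - P 0 2 0 u * P 1 1 1 u - 2 * P 2 1 0 u"
    by (rule differentiate[OF divisor_parameters.p333_p233_rel[OF divisor_parameters_P] u, where i = 1], assumption,
          (rule haspd_intros haspd_P u | (simp; fail))+,
          (simp_all add: algebra_simps power2_eq_square del: One_nat_def)?)
  then show ?thesis by algebra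
qed

lemma divisor_parameters_p11_P:
  assumes u: "\<sigma> u \<noteq> 0"
  shows "divisor_parameters_p11 l0 l1 l2 l3 (cA u) (cB u) (cD u) (cE u) (P 0 0 2 u) (P 0 1 1 u) (P 0 2 0 u)
    (P 1 0 1 u) (P 1 1 0 u) (P 0 0 3 u) (P 0 1 2 u) (P 0 2 1 u) (P 1 0 2 u) (P 1 1 1 u) (P 1 0 3 u)
    (P 1 2 0 u) (P 1 2 1 u) (P 2 0 0 u)"
  unfolding divisor_parameters_p11_def divisor_parameters_p11_axioms_def
  using divisor_parameters_P[OF u] P120[OF u] P121[OF u, unfolded P004[OF u] parity_relations(4,5)[OF u]] P200[OF u]
  by blast

text \<open>The derivative of \<open>p11_rel\<close> in u_1: its right side involves only functions
  for which formulas are already available.\<close>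

lemma P300:
  assumes u: "\<sigma> u \<noteq> 0"
  shows "4 * P 3 0 0 u = 2 * P 0 2 1 u * P 1 2 1 u - 8 * P 0 1 1 u * P 1 1 1 u * P 0 2 0 u - 4 * (P 0 1 1 u)\<^sup>2 * P 1 2 0 u
    + 4 * (P 2 1 0 u * P 0 1 1 u + P 1 1 0 u * P 1 1 1 u) - 4 * (P 2 0 1 u * P 0 2 0 u + P 1 0 1 u * P 1 2 0 u) + 4 * l3 * P 2 1 0 u
    - 4 * l3 * (P 1 2 0 u * P 0 1 1 u + P 0 2 0 u * P 1 1 1 u) - 2 * l3\<^sup>2 * P 0 0 2 u * P 1 0 2 u - 4 * l2 * P 1 2 0 u
    + 8 * l2 * P 0 0 2 u * P 1 0 2 u
    - 2 * P 1 0 2 u * (P 0 0 3 u * P 0 2 1 u - 4 * P 0 0 2 u * P 1 0 1 u - 2 * P 0 0 2 u * (P 0 1 1 u)\<^sup>2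
        - l3 * P 0 0 2 u * P 0 1 1 u - 2 * (P 0 0 2 u)\<^sup>2 * P 0 2 0 u + 2 * (P 0 2 0 u)\<^sup>2)
    - 2 * P 0 0 2 u * (P 1 0 3 u * P 0 2 1 u + P 0 0 3 u * P 1 2 1 u - 4 * P 1 0 2 u * P 1 0 1 u - 4 * P 0 0 2 u * P 2 0 1 u
        - 2 * P 1 0 2 u * (P 0 1 1 u)\<^sup>2 - 4 * P 0 0 2 u * P 0 1 1 u * P 1 1 1 u
        - l3 * (P 1 0 2 u * P 0 1 1 u + P 0 0 2 u * P 1 1 1 u)
        - 4 * P 0 0 2 u * P 1 0 2 u * P 0 2 0 u - 2 * (P 0 0 2 u)\<^sup>2 * P 1 2 0 u + 4 * P 0 2 0 u * P 1 2 0 u)"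
  by (rule differentiate[OF divisor_parameters_p11.p11_rel[OF divisor_parameters_p11_P] u, where i = 1], assumption,
          (rule haspd_intros haspd_P u | (simp; fail))+,
          (simp_all add: algebra_simps power2_eq_square del: One_nat_def)?)

lemma divisor_parameters_full_P:
  assumes u: "\<sigma> u \<noteq> 0"
  shows "divisor_parameters_full l0 l1 l2 l3 (cA u) (cB u) (cD u) (cE u) (P 0 0 2 u) (P 0 1 1 u) (P 0 2 0 u)
    (P 1 0 1 u) (P 1 1 0 u) (P 0 0 3 u) (P 0 1 2 u) (P 0 2 1 u) (P 1 0 2 u) (P 1 1 1 u) (P 1 0 3 u)
    (P 1 2 0 u) (P 1 2 1 u) (P 2 0 0 u) (P 0 3 0 u) (P 2 0 1 u) (P 2 1 0 u) (P 3 0 0 u)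
    (P 1 0 3 u - 6 * P 0 0 2 u * P 1 0 1 u)"
  unfolding divisor_parameters_full_def divisor_parameters_full_axioms_def
  using divisor_parameters_p11_P[OF u] P030[OF u] P201[OF u] P210[OF u, unfolded parity_relations(6)[OF u]] P300[OF u]
  by blast

lemma wp_P:
  assumes u: "\<sigma> u \<noteq> 0"
  shows "wp2 \<sigma> 1 1 u = P 2 0 0 u" "wp2 \<sigma> 1 2 u = P 1 1 0 u" "wp2 \<sigma> 1 3 u = P 1 0 1 u"
    "wp2 \<sigma> 2 2 u = P 0 2 0 u" "wp2 \<sigma> 2 3 u = P 0 1 1 u" "wp2 \<sigma> 3 3 u = P 0 0 2 u"
    "wp3 \<sigma> 1 1 1 u = P 3 0 0 u" "wp3 \<sigma> 1 1 2 u = P 2 1 0 u" "wp3 \<sigma> 1 1 3 u = P 2 0 1 u"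
    "wp3 \<sigma> 1 2 2 u = P 1 2 0 u" "wp3 \<sigma> 1 2 3 u = P 1 1 1 u" "wp3 \<sigma> 1 3 3 u = P 1 0 2 u"
    "wp3 \<sigma> 2 2 2 u = P 0 3 0 u" "wp3 \<sigma> 2 2 3 u = P 0 2 1 u" "wp3 \<sigma> 2 3 3 u = P 0 1 2 u"
    "wp3 \<sigma> 3 3 3 u = P 0 0 3 u"
    "Q1333 \<sigma> u = P 1 0 3 u - 6 * P 0 0 2 u * P 1 0 1 u"
  by (simp_all add: Q1333_def wp2_eq wp3_eq wp4_eq wps_P u numeral_eq_Suc)

end

theorem theorem4p3:
  fixes l0 l1 l2 l3 :: complex and \<sigma> :: "complex ^ 3 \<Rightarrow> complex"
  assumes "nonsingular_curve [:l0, l1, l2, l3, 1:]"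
    and "is_sigma_function [:l0, l1, l2, l3, 1:] \<sigma>"
  shows "\<forall>u. \<sigma> u \<noteq> 0 \<longrightarrow>
    (let p11 = wp2 \<sigma> 1 1 u;
         p12 = wp2 \<sigma> 1 2 u;
         p13 = wp2 \<sigma> 1 3 u;
         p22 = wp2 \<sigma> 2 2 u;
         p23 = wp2 \<sigma> 2 3 u;
         p33 = wp2 \<sigma> 3 3 u;
         p111 = wp3 \<sigma> 1 1 1 u;
         p112 = wp3 \<sigma> 1 1 2 u;
         p113 = wp3 \<sigma> 1 1 3 u;
         p122 = wp3 \<sigma> 1 2 2 u;
         p123 = wp3 \<sigma> 1 2 3 u;
         p133 = wp3 \<sigma> 1 3 3 u;
         p222 = wp3 \<sigma> 2 2 2 u;
         p223 = wp3 \<sigma> 2 2 3 u;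
         p233 = wp3 \<sigma> 2 3 3 u;
         p333 = wp3 \<sigma> 3 3 3 u;
         Q = Q1333 \<sigma> u
     in
      (p333^2 = 4*p33^3 + 4*p13 + p23^2 - 4*p22*p33) \<and>
      (p233*p333 = 4*p23*p33^2 - 2*p12 - p22*p23 + 2*l3*p33^2) \<and>
      (p233^2 = 4*p23^2*p33 + p22^2 + 4*l3*p23*p33 + 4*p33*l2 - (4/3)*Q) \<and>
      (p223*p333 = 2*p23^2*p33 + 2*p22*p33^2 - 2*p22^2 + l3*p23*p33 + 4*p13*p33 + (2/3)*Q) \<and>
      (p223*p233 = 2*p13*l3 + 2*l1 + 4*p13*p23 + 2*p23*p22*p33 + 2*p23^3 + p22*p33*l3
           + 2*p23^2*l3 + 2*p23*l2) \<and>
      (p222*p333 = 6*p23*p22*p33 - 4*p12*p33 - 2*p23^3 + 4*p22*p33*l3 - 8*p13*p23 - p23^2*l3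
           - 4*p13*l3) \<and>
      (p223^2 = 4*p23^2*p22 + 4*p11 - 4*p12*p23 + 4*p13*p22 - 4*p12*l3 + 4*l3*p22*p23
           + l3^2*p33^2 + 4*l2*p22 - 4*l2*p33^2 + (4/3)*p33*Q) \<and>
      (p222*p233 = 2*p23^2*p22 + 2*p22^2*p33 + 4*p12*p23 + 2*p12*l3 + l3*p22*p23
           - 2*l3^2*p33^2 + 8*l2*p33^2 - (8/3)*p33*Q) \<and>
      (p133*p333 = p12*p23 - 2*p13*p22 + 4*p13*p33^2 + (2/3)*p33*Q) \<and>
      (p222*p223 = 2*p22^2*l3 - l3^2*p23*p33 + 4*p22^2*p23 + 4*l2*p23*p33 + 4*p33*l1
           - (2/3)*l3*Q - (4/3)*p23*Q) \<and>
      (p133*p233 = 2*l3*p13*p33 + 2*p33*l1 + p12*p22 + 4*p33*p23*p13 + (2/3)*p23*Q) \<and>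
      (p123*p333 = 2*p12*p33^2 - 2*p12*p22 + 2*p33*p23*p13 + 2*l3*p13*p33 - (1/3)*p23*Q) \<and>
      (p222^2 = 4*p22^3 + 8*p11*p33 - 8*p13^2 - 4*p33*p12*l3 + 4*p23*p13*l3 + 4*p13*l3^2
           - 4*p22*p33*l3^2 + p23^2*l3^2 - 8*p13*l2 + 16*p33*l2*p22 - 4*p23^2*l2 - 8*l0
           - 4*p22*Q - 4*p23*l1) \<and>
      (p133*p223 = 2*p13*p33*p22 + 2*p13*p23^2 + 2*p11*p33 + 2*p13^2 - p33*p12*l3 + 2*p13*l2
           + 2*p23*p13*l3 + 2*l0 + (2/3)*p22*Q) \<and>
      (p123*p233 = 2*p13*l2 + 2*p13^2 + 2*p33*p12*l3 + 2*p23*p33*p12 + 2*p13*p23^2 - 2*p11*p33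
           + 2*p23*p13*l3 + 2*l0 - (1/3)*p22*Q) \<and>
      (p122*p333 = 2*p13*p33*p22 - 2*p13*p23^2 + 4*p23*p33*p12 - 2*p11*p33 - 6*p13^2 + 2*l0
           + 2*p33*p12*l3 - p23*p13*l3 - 2*p13*l2 + p23*l1 + (2/3)*p22*Q) \<and>
      (p133*p222 = -2*p12*p23^2 + 4*p23*p13*p22 - p23*p12*l3 + 2*p22*p13*l3 + 2*p33*p12*p22
           + 4*p33^2*l1 - (2/3)*p33*l3*Q) \<and>
      (p123*p223 = 2*p22*l1 + 2*p22*p13*l3 - 2*p33^2*l1 + 2*p12*p23^2 + 2*p23*p13*p22
           - 2*p11*p23 + 2*p23*p12*l3 + (1/3)*p33*l3*Q) \<and>
      (p122*p233 = -p22*p13*l3 + 4*p12*p13 + 2*p12*p23^2 + 2*p12*l2 - p22*l1 + 2*p23*p12*l3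
           + 4*p33^2*l1 + 2*p33*p12*p22 - (2/3)*p33*l3*Q) \<and>
      (p133^2 = p12^2 + 4*p33*l0 + 4*p33*p13^2 + (4/3)*p13*Q) \<and>
      (p123*p222 = 2*p22*p23*p12 - 2*p12^2 + 2*p13*p22^2 - 2*p23*p33*l1 - 2*l3^2*p13*p33
           + 2*p22*p12*l3 + 8*p33*p13*l2 - (8/3)*p13*Q + (1/3)*p23*l3*Q) \<and>
      (p122*p223 = 4*p22*p23*p12 - 2*p11*p22 + 2*p12^2 + 2*p22*p12*l3 + l3^2*p13*p33
           + 4*p23*p33*l1 + p33*l3*l1 + 8*p33*l0 + (4/3)*p13*Q - (2/3)*p23*l3*Q - 4*p33*p13*l2
           - (2/3)*l2*Q) \<and>
      (p113*p333 = 2*p33*p13^2 + 2*p33^2*p11 - 2*p12^2 + 2*p33*p13*l2 - p23*p33*l1 - 2*p33*l0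
           - (2/3)*p13*Q) \<and>
      (p123*p133 = 2*p23*p13^2 + 2*p13*l1 + 2*p13^2*l3 - 2*p23*l0 + 2*p33*p12*p13
           + (1/3)*p12*Q) \<and>
      (p122*p222 = 6*p33*p22*l1 - p23*l3*l1 - 2*p33*p12*l3^2 - 2*p23^2*l1 + 2*l3*p13*l2
           + 2*l3*p11*p33 + p23*p13*l3^2 - 2*p13^2*l3 - (2/3)*p22*l3*Q + 4*p33*p12*l2
           - 2*l3*l0 + 4*p22^2*p12 - (4/3)*p12*Q - 8*p13*l1) \<and>
      (p113*p233 = 2*p13^2*l3 + 2*p23*p13^2 + 2*p33*p12*l2 + 2*p13*l1 + 2*p33*p23*p11
           - 2*p23*l0 - p33*p22*l1 - (2/3)*p12*Q) \<and>
      (p112*p333 = 2*p23*p13*l2 - p23^2*l1 - 4*p13^2*l3 + 4*p33*p12*p13 - 2*p23*l0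
           + 2*p33*p23*p11 - 2*p23*p13^2 + (4/3)*p12*Q) \<and>
      (p123^2 = (1/3)*p23*p12*l2 - (8/3)*p11*p13 + (10/3)*p13*p23*p12 - (1/3)*p33*p11*p22
           + (2/9)*p33*l2*Q - (1/3)*p23*p22*l1 + (1/3)*p22*p13*l2 + 3*p22*l0 + (1/3)*p12*l1
           + (1/3)*p23^2*p11 + (1/3)*p13^2*p22 - (8/3)*p33^2*l0 + (1/3)*p33*p12^2
           + 3*p12*p13*l3 - (1/3)*p33^2*l3*l1) \<and>
      (p122*p133 = -(8/3)*p11*p13 + (4/3)*p13*p23*p12 + (2/3)*p33*p11*p22 - (2/3)*p23^2*p11
           + (4/3)*p13^2*p22 + (4/3)*p33*p12^2 + (2/3)*p23*p22*l1 - (2/3)*p22*p13*l2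
           - (2/3)*p23*p12*l2 + 3*p12*p13*l3 + (2/3)*p33^2*l3*l1 + (1/3)*p12*l1
           + (16/3)*p33^2*l0 - (4/9)*p33*l2*Q) \<and>
      (p113*p223 = (4/3)*p11*p13 + (4/3)*p13*p23*p12 + (2/3)*p33*p11*p22 + (4/3)*p23^2*p11
           + (4/3)*p23*p12*l2 + (4/3)*p13^2*p22 - (2/3)*p33*p12^2 - (4/3)*p23*p22*l1
           + (4/3)*p22*p13*l2 - (1/3)*p33^2*l3*l1 + (4/3)*p12*l1 - (8/3)*p33^2*l0
           + (2/9)*p33*l2*Q) \<and>
      (p112*p233 = (16/3)*p11*p13 + (4/3)*p13*p23*p12 + (2/3)*p33*p11*p22 + (4/3)*p23^2*p11
           - (4/9)*p33*l2*Q - (2/3)*p13^2*p22 + (4/3)*p33*p12^2 - (1/3)*p23*p22*l1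
           - (2/3)*p22*p13*l2 - 6*p22*l0 + (4/3)*p23*p12*l2 + (2/3)*p33^2*l3*l1
           + (10/3)*p12*l1 + (16/3)*p33^2*l0) \<and>
      (p122*p123 = 2*p33*l3*l0 + 2*p12*p13*p22 - 2*p11*p12 + 2*l1*p13*p33 + 2*l3*p12^2
           + 2*p23*p12^2 - (1/3)*l1*Q - (1/3)*p13*l3*Q) \<and>
      (p113*p222 = -8*p23*p33*l0 - 4*p33*l3*l0 + 8*l1*p13*p33 + 4*p22*p12*l2 + (2/3)*l1*Q
           + 4*p12*p13*p22 + 4*p11*p12 - l3*p23*p33*l1 - 2*p23*p12^2 + 2*p22*p23*p11
           - 4*l3*p12^2 - 2*p22^2*l1 + (2/3)*p23*l2*Q - (4/3)*p13*l3*Q) \<and>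
      (p112*p223 = 8*p33*l3*l0 + l3*p23*p33*l1 - 4*l1*p13*p33 + 2*p23*p12^2 + (2/3)*p13*l3*Q
           + 2*p22*p23*p11 + 8*p23*p33*l0 + 2*l3*p12^2 - (2/3)*p23*l2*Q - (4/3)*l1*Q) \<and>
      (p122^2 = -4*l2*p13^2 - 4*l2*l0 + l1^2 - 16*l0*p13 - 8*l0*p23^2 + 4*p22*p12^2
           + 2*l3*p13*l1 + p13^2*l3^2 + 4*l1*p13*p23 + 4*l1*p12*p33 + 8*p33*p22*l0
           - (4/3)*p12*l3*Q + (4/3)*p11*Q - 4*l3*p23*l0) \<and>
      (p111*p333 = -9*l3*p23*l0 - 2*p13*l2^2 + l2*p23*l1 - 2*l2*p11*p33 + 2*p11*Q
           - 10*l0*p23^2 + 6*p33*p13*p11 - 10*l0*p13 - 2*p13^3 + 7*l1*p13*p23 + 2*l1*p12*p33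
           - 2*p33*p22*l0 + 6*l3*p13*l1 + 2*l1^2 - 6*l2*l0 - 4*l2*p13^2) \<and>
      (p113*p133 = 2*p33*p13*p11 + 2*l2*p13^2 + 2*l0*p13 + 2*l0*p23^2 + 2*p13^3 + l1*p12*p33
           - 2*p33*p22*l0 - 2*l1*p13*p23) \<and>
      (p112*p222 = 4*l2*p13^2 + 2*p23*l3*p13*l2 - 2*l2*p23*l1 + 4*l2*p11*p33 - p23^2*l3*l1
           + 4*l2*l0 - 2*l1^2 + 8*l0*p23^2 + 2*p11*p22^2 + 2*p22*p12^2 + (2/3)*p12*l3*Q
           - 2*l3*p33*p12*l2 + 2*l3*p33*p22*l1 + 4*p13*l2^2 - 8*l3*p13*l1 - (8/3)*p11*Q
           - 8*l1*p13*p23 + 4*l1*p12*p33 + 8*l3*p23*l0 - (2/3)*l2*p22*Q - 2*p13^2*l3^2) \<and>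
      (p113*p123 = -2*p33^2*l3*l0 + 2*l2*p12*p13 + 2*p12*p13^2 + 2*p12*l0 - 2*p23*p22*l0
           + 2*p13*p23*p11 + (1/3)*p33*l1*Q) \<and>
      (p111*p233 = 2*p12*p33*p11 - 2*p12*p13^2 + 6*l1*p12*l3 + 6*l1*p12*p23 + 4*p13*p23*p11
           - 2*p12*l2^2 - 2*p11*l1 - 4*l2*p12*p13 + l2*p22*l1 - 2*l2*p23*p11 - 8*p23*p22*l0
           + p13*p22*l1 + 4*p33^2*l3*l0 + 6*p11*p13*l3 - 9*l3*p22*l0 + 2*p12*l0
           - (2/3)*p33*l1*Q) \<and>
      (p112*p133 = 4*p33^2*l3*l0 + 2*p12*p33*p11 + 2*l2*p12*p13 - 2*p13*p22*l1 + 2*p12*l0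
           + 2*p12*p13^2 + 4*p23*p22*l0 - (2/3)*p33*l1*Q - l1*p12*p23) \<and>
      (p113*p122 = 2*p22*p13*p11 - 4*p33*l2*l0 + 2*p12^2*p13 - 4*p22^2*l0 + p33*l1^2
           + 2*p12*p22*l1 - 4*p23*p33*l3*l0 + l1*l3*p13*p33 - (2/3)*p13*l2*Q + 8*p13*p33*l0
           + (4/3)*l0*Q + (2/3)*p23*l1*Q) \<and>
      (p112*p123 = 8*p33*l2*l0 + 2*p12^2*p13 + 2*p12*p23*p11 + 2*p22^2*l0 - 2*p33*l1^2
           + 2*l2*p12^2 - 2*p12*p22*l1 + 2*p23*p33*l3*l0 - (8/3)*l0*Q - (1/3)*p23*l1*Q) \<and>
      (p111*p223 = -12*p33*l2*l0 + 2*p22*p13*p11 + 6*p11*l3*p12 - 4*p11^2 + 4*p33*l1^2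
           - 4*p22^2*l0 - 2*l2*p11*p22 - 8*p13*p33*l0 - (4/3)*p23*l1*Q - l2*p33*l3*l1
           + 8*p23*p33*l3*l0 + (2/3)*p13*l2*Q + (2/3)*l2^2*Q - 2*l2*p12^2 - 2*p12^2*p13
           + 4*p12*p23*p11 - l1*l3*p13*p33 - 2*l3*l1*Q + 4*p12*p22*l1 + (4/3)*l0*Q
           + 9*p33*l3^2*l0) \<and>
      (p111*p222 = 6*l3*l2*l0 - 6*l1*l0 - 2*l3*l1^2 - 2*p22*l1*Q - 6*l3^2*p13*l1 - 8*l3*l0*p13
           - 2*p12^3 + 2*p12*l2*Q + 10*l3*l0*p23^2 + 4*p23*l2^2*p13 - 2*l3*p11*Q
           + 6*p11*p22*p12 - 4*p33*p12*l2^2 - 16*l0*p13*p23 + 9*l3^2*p23*l0 - 4*p23*l1^2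
           - 2*l3*l2*p13^2 + 2*l3*p13*l2^2 + 6*l2*p13*l1 - 8*l0*p12*p33 + 10*l1*p13^2
           + 2*l3*l2*p11*p33 - 2*p23^2*l2*l1 + 4*l3*l1*p12*p33 + 2*l2*p33*p22*l1
           - l3*l2*p23*l1 + 2*p11*p33*l1 - 7*l3*l1*p13*p23 + 2*l3*l0*p22*p33) \<and>
      (p112*p122 = 2*p11*p22*p12 + 2*p11*p33*l1 - 2*l1*l0 - 8*l3*l0*p13 + 2*p12^3
           - 2*l3*l0*p23^2 + 8*l0*p12*p33 + 2*l3*l0*p22*p33 + 2*l2*p13*l1 + l3*l1*p13*p23
           - p23*l1^2 - 2*l1*p13^2 - (2/3)*p12*l2*Q) \<and>
      (p113^2 = 4*p13^2*p11 - 4*l0*p13*p22 - 4*l0*p12*p23 - 4*p33^2*l2*l0 + p33^2*l1^2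
           + 4*l1*p12*p13 + (4/3)*p33*l0*Q) \<and>
      (p111*p133 = 8*l0*p12*p23 - l1*p12*l2 - 6*l2*p22*l0 + 2*l2*p11*p13 + 2*p22*l1^2
           - 2*p33^2*l1^2 - 6*l0*p11 + 2*p33*p11^2 + 9*l0*p12*l3 - (8/3)*p33*l0*Q - l1*p12*p13
           - 2*l1*p11*p23 + 2*p13^2*p11 - 4*l0*p13*p22 + 8*p33^2*l2*l0) \<and>
      (p112*p113 = -4*p23*p33*l2*l0 + 2*l1*p12^2 + p23*p33*l1^2 - 4*l0*p12*p22 + 4*p12*p13*p11
           + (4/3)*p23*l0*Q - (2/3)*p13*l1*Q + 4*l0*l3*p13*p33) \<and>
      (p111*p123 = 2*p12*p13*p11 - 2*p33*l3*l1^2 + 2*l1*p33*l0 - 2*l0*l3*p13*p33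
           + 2*p11*p12*l2 - 2*p11*p22*l1 + 6*l2*p33*l3*l0 + 8*p23*p33*l2*l0 + 2*l0*p12*p22
           - 2*p23*p33*l1^2 + (1/3)*l2*l1*Q - 3*l3*l0*Q - (8/3)*p23*l0*Q + (1/3)*p13*l1*Q
           + 2*p23*p11^2) \<and>
      (p111*p122 = -3*l3*l1*l0 - l2*l1^2 + 4*l2^2*l0 - 8*l0^2 - l1*p13^2*l3 - 8*l1*l0*p23
           - 2*p23^2*l1^2 + 4*l2*l0*p23^2 - (8/3)*p22*l0*Q + (2/3)*p12*l1*Q - (2/3)*l2*p11*Q
           + l1^2*p13 + 8*l2*l0*p13 - 9*l3^2*l0*p13 - 2*l3*l1^2*p23 + 2*p11^2*p22
           - 2*l2*l1*p12*p33 + 2*p11*p12^2 + 8*l0*p13^2 + l2*l3*p13*l1 + 4*l3*l0*p12*p33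
           + 2*l2*l1*p13*p23 - 8*l3*l0*p13*p23 + 4*l2*p33*p22*l0 + 2*l3*l1*p11*p33
           + 6*l2*l3*p23*l0) \<and>
      (p112^2 = -8*l0*p13^2 + 8*l0*p11*p33 - 4*l1*l0*p23 - 4*l2*l0*p23^2 - 8*l2*l0*p13
           + 4*p11*p12^2 - 8*l0^2 + 4*l3*l0*p13*p23 + 4*l3*l0*p12*p33 + p23^2*l1^2
           + 4*l1^2*p13 + (4/3)*p22*l0*Q - (4/3)*p12*l1*Q) \<and>
      (p111*p113 = 4*l0*p33*p13*l2 + 4*p11^2*p13 - p33*l2*l1^2 + 4*p33*l2^2*l0 - l1^2*p13*p33
           - 3*p33*l3*l1*l0 + 2*p12*p11*l1 - 6*p22*l0*p11 + 2*l0*p12^2 - 2*l2*l0*Q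
           - (4/3)*l0*p13*Q + (2/3)*l1^2*Q + 8*p33*l0^2) \<and>
      (p111*p112 = -(4/3)*p12*l0*Q + 2*l3*p13*l1^2 + 8*l2*l1*l0 + l1^2*p13*p23
           - (2/3)*p11*l1*Q + 6*l3*p33*l0*p11 + 4*p11^2*p12 + 4*p23*l2^2*l0 - 18*l3*l0^2
           - 2*l1^3 - 16*p23*l0^2 - 2*l3*p13^2*l0 - 6*l3*p13*l2*l0 - 3*l1*l3*p23*l0
           + 2*l1*p33*p22*l0 - l2*p23*l1^2 - 2*l1^2*p12*p33 - 2*l1*l0*p23^2 + 8*l1*l0*p13
           + 4*l0*p33*p12*l2) \<and>
      (p111^2 = -4*p23*l1^3 - 8*p23^2*l0^2 - 8*p13*l2^2*l0 - 4*l2*l0*p13^2 + 16*p23*l2*l1*l0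
           + 4*p23*l1*l0*p13 + 6*l3*l1*l0*p13 - 4*l0*p11*Q - 36*l3*p23*l0^2 + 18*l3*l2*l1*l0
           + l2^2*l1^2 - 4*l3*l1^3 - 4*l2^3*l0 - 4*l1^2*l0 - 27*l3^2*l0^2 + 12*l2*l0^2
           + 2*p13*l2*l1^2 + 16*p13*l0^2 + l1^2*p13^2 - 4*p12*l1*p33*l0 - 4*p11*p33*l1^2
           + 16*p11*p33*l2*l0 + 4*p11^3 + 8*p33*p22*l0^2))"
proof -
  interpret sigma_curve l0 l1 l2 l3 \<sigma>
    by unfold_locales (rule assms(2))
  show ?thesis
    unfolding Let_def
    by (intro allI impI, simp only: wp_P not_False_eq_True, intro conjI;
        rule divisor_parameters_full.quadratic_relations[OF divisor_parameters_full_P]; assumption)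
qed

end
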